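(* Let $\mathscr C$ be a Galois category and let $\{F_i \mid i \in I\}$ be a finite jointly conservative family of fibre functors $F_i \colon \mathscr C \to \mathbf{Fin}$. Let $\Pi_1(\mathscr C)$ be the fundamental category of $\mathscr C$ with respect to this family. Then the evaluation functor $$\operatorname{ev} \colon \mathscr C \to \operatorname{Fun}^{\mathrm{cts}}(\Pi_1(\mathscr C),\mathbf{Fin}), \qquad A \mapsto (F_i \mapsto F_i(A))$$ is an equivalence of categories.
   Context: $\mathbf{Fin}$ is the category of finite sets. A pretopos is a small category $\mathscr C$ such that: (1) $\mathscr C$ has finite limits; (2) $\mathscr C$ has finite coproducts, and these are disjoint and universal (stable under base change); (3) every equivalence relation in $\mathscr C$ is effective; (4) every epimorphism in $\mathscr C$ is a universal effective epimorphism. A morphism of pretopoi is a functor preserving finite limits, finite coproducts, and effective epimorphisms. The category $\mathbf{Fin}$ is a pretopos. A fibre functor on a pretopos $\mathscr C$ is a morphism of pretopoi $\mathscr C \to \mathbf{Fin}$. A Galois category is a pretopos $\mathscr C$ for which there exists a finite family $\{F_i \mid i \in I\}$ of fibre functors that is jointly conservative: if $f$ is a map in $\mathscr C$ such that $F_i(f)$ is an isomorphism for all $i \in I$, then $f$ is an isomorphism. Given such a family, the fundamental category $\Pi_1(\mathscr C)$ is the full subcategory of the category $\operatorname{Fun}^{\mathrm{lex}}(\mathscr C,\mathbf{Fin})$ of left exact functors on the objects $F_i$, $i\in I$, with its enrichment in profinite sets: $\operatorname{Hom}(F,G)$ (natural transformations) is topologised as a closed subspace of $\prod_{A \in \mathscr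 C} \operatorname{Hom}(F(A),G(A))$, each factor being a finite discrete set; composition is continuous. For a category $\Pi$ enriched in topological spaces, a functor $F \colon \Pi \to \mathbf{Fin}$ is continuous if for all $x,y \in \Pi$ the map $\operatorname{Hom}(x,y) \times F(x) \to F(y)$, $(\phi,a) \mapsto F(\phi)(a)$, is continuous (finite sets being discrete). $\operatorname{Fun}^{\mathrm{cts}}(\Pi,\mathbf{Fin})$ is the category of continuous functors and natural transformations. *)

theory Defs
  imports "HOL-Analysis.Analysis" "HOL-Library.Infinite_Typeclass"
begin

section \<open>Categories\<close>

record ('o, 'a) cat =
  Ob :: "'o set"
  Arr :: "'a set"
  Dom :: "'a \<Rightarrow> 'o"
  Cod :: "'a \<Rightarrow> 'o"
  Id :: "'o \<Rightarrow> 'a"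
  Comp :: "'a \<Rightarrow> 'a \<Rightarrow> 'a"  (infixr "\<cdot>\<index>" 70)

definition hom :: "('o, 'a, 'm) cat_scheme \<Rightarrow> 'o \<Rightarrow> 'o \<Rightarrow> 'a set" where
  "hom C x y = {f \<in> Arr C. Dom C f = x \<and> Cod C f = y}"

locale category =
  fixes C :: "('o, 'a, 'm) cat_scheme" (structure)
  assumes dom_in_Ob: "f \<in> Arr C \<Longrightarrow> Dom C f \<in> Ob C"
    and cod_in_Ob: "f \<in> Arr C \<Longrightarrow> Cod C f \<in> Ob C"
    and Id_in_hom: "x \<in> Ob C \<Longrightarrow> Id C x \<in> hom C x x"
    and Comp_in_hom: "f \<in> hom C x y \<Longrightarrow> g \<in> hom C y z \<Longrightarrow> g \<cdot> f \<in> hom C x z"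
    and Comp_Id: "f \<in> hom C x y \<Longrightarrow> f \<cdot> Id C x = f"
    and Id_Comp: "f \<in> hom C x y \<Longrightarrow> Id C y \<cdot> f = f"
    and Comp_assoc:
      "f \<in> hom C x y \<Longrightarrow> g \<in> hom C y z \<Longrightarrow> h \<in> hom C z w \<Longrightarrow> (h \<cdot> g) \<cdot> f = h \<cdot> (g \<cdot> f)"

definition is_iso :: "('o, 'a, 'm) cat_scheme \<Rightarrow> 'a \<Rightarrow> bool" where
  "is_iso C f \<longleftrightarrow> f \<in> Arr C \<and>
     (\<exists>g \<in> hom C (Cod C f) (Dom C f).
        g \<cdot>\<^bsub>C\<^esub> f = Id C (Dom C f) \<and> f \<cdot>\<^bsub>C\<^esub> g = Id C (Cod C f))"

definition isomorphic :: "('o, 'a, 'm) cat_scheme \<Rightarrow> 'o \<Rightarrow> 'o \<Rightarrow> bool" where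
  "isomorphic C x y \<longleftrightarrow> (\<exists>f \<in> hom C x y. is_iso C f)"

definition is_mono :: "('o, 'a, 'm) cat_scheme \<Rightarrow> 'a \<Rightarrow> bool" where
  "is_mono C f \<longleftrightarrow> f \<in> Arr C \<and>
     (\<forall>t. \<forall>g \<in> hom C t (Dom C f). \<forall>h \<in> hom C t (Dom C f). f \<cdot>\<^bsub>C\<^esub> g = f \<cdot>\<^bsub>C\<^esub> h \<longrightarrow> g = h)"

definition is_epi :: "('o, 'a, 'm) cat_scheme \<Rightarrow> 'a \<Rightarrow> bool" where
  "is_epi C f \<longleftrightarrow> f \<in> Arr C \<and>
     (\<forall>t. \<forall>g \<in> hom C (Cod C f) t. \<forall>h \<in> hom C (Cod C f) t. g \<cdot>\<^bsub>C\<^esub> f = h \<cdot>\<^bsub>C\<^esub> f \<longrightarrow> g = h)"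

definition full_subcat :: "('o, 'a, 'm) cat_scheme \<Rightarrow> 'o set \<Rightarrow> ('o, 'a) cat" where
  "full_subcat C S =
     \<lparr>Ob = Ob C \<inter> S, Arr = {f \<in> Arr C. Dom C f \<in> S \<and> Cod C f \<in> S},
      Dom = Dom C, Cod = Cod C, Id = Id C, Comp = Comp C\<rparr>"

section \<open>Functors and natural transformations\<close>

text \<open>Functors and natural transformations are extensional (\<^const>\<open>undefined\<close> outside the
  category), so that HOL equality is equality of functors and of natural transformations.\<close>

record ('o, 'a, 'p, 'b) ftor =
  fob :: "'o \<Rightarrow> 'p"
  far :: "'a \<Rightarrow> 'b"

definition is_functor ::
  "('o, 'a, 'm) cat_scheme \<Rightarrow> ('p, 'b, 'n) cat_scheme \<Rightarrow> ('o, 'a, 'p, 'b) ftor \<Rightarrow> bool" where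
  "is_functor C D F \<longleftrightarrow> category C \<and> category D \<and>
     fob F \<in> Ob C \<rightarrow>\<^sub>E Ob D \<and>
     far F \<in> (\<Pi>\<^sub>E f \<in> Arr C. hom D (fob F (Dom C f)) (fob F (Cod C f))) \<and>
     (\<forall>x \<in> Ob C. far F (Id C x) = Id D (fob F x)) \<and>
     (\<forall>x y z. \<forall>f \<in> hom C x y. \<forall>g \<in> hom C y z. far F (g \<cdot>\<^bsub>C\<^esub> f) = far F g \<cdot>\<^bsub>D\<^esub> far F f)"

definition id_functor :: "('o, 'a, 'm) cat_scheme \<Rightarrow> ('o, 'a, 'o, 'a) ftor" where
  "id_functor C = \<lparr>fob = (\<lambda>x \<in> Ob C. x), far = (\<lambda>f \<in> Arr C. f)\<rparr>"

definition comp_functor ::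
  "('o, 'a, 'm) cat_scheme \<Rightarrow> ('p, 'b, 'q, 'c) ftor \<Rightarrow> ('o, 'a, 'p, 'b) ftor \<Rightarrow> ('o, 'a, 'q, 'c) ftor" where
  "comp_functor C G F = \<lparr>fob = compose (Ob C) (fob G) (fob F), far = compose (Arr C) (far G) (far F)\<rparr>"

record ('o, 'a, 'p, 'b) ntrans =
  nsrc :: "('o, 'a, 'p, 'b) ftor"
  ntgt :: "('o, 'a, 'p, 'b) ftor"
  ncmp :: "'o \<Rightarrow> 'b"

definition is_ntrans ::
  "('o, 'a, 'm) cat_scheme \<Rightarrow> ('p, 'b, 'n) cat_scheme \<Rightarrow> ('o, 'a, 'p, 'b) ntrans \<Rightarrow> bool" where
  "is_ntrans C D \<eta> \<longleftrightarrow> is_functor C D (nsrc \<eta>) \<and> is_functor C D (ntgt \<eta>) \<and>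
     ncmp \<eta> \<in> (\<Pi>\<^sub>E x \<in> Ob C. hom D (fob (nsrc \<eta>) x) (fob (ntgt \<eta>) x)) \<and>
     (\<forall>f \<in> Arr C. ncmp \<eta> (Cod C f) \<cdot>\<^bsub>D\<^esub> far (nsrc \<eta>) f = far (ntgt \<eta>) f \<cdot>\<^bsub>D\<^esub> ncmp \<eta> (Dom C f))"

definition functor_cat ::
  "('o, 'a, 'm) cat_scheme \<Rightarrow> ('p, 'b, 'n) cat_scheme \<Rightarrow>
     (('o, 'a, 'p, 'b) ftor, ('o, 'a, 'p, 'b) ntrans) cat" where
  "functor_cat C D =
     \<lparr>Ob = {F. is_functor C D F}, Arr = {\<eta>. is_ntrans C D \<eta>}, Dom = nsrc, Cod = ntgt,
      Id = (\<lambda>F. \<lparr>nsrc = F, ntgt = F, ncmp = (\<lambda>x \<in> Ob C. Id D (fob F x))\<rparr>),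
      Comp = (\<lambda>\<theta> \<eta>. \<lparr>nsrc = nsrc \<eta>, ntgt = ntgt \<theta>, ncmp = (\<lambda>x \<in> Ob C. ncmp \<theta> x \<cdot>\<^bsub>D\<^esub> ncmp \<eta> x)\<rparr>)\<rparr>"

definition is_equivalence ::
  "('o, 'a, 'm) cat_scheme \<Rightarrow> ('p, 'b, 'n) cat_scheme \<Rightarrow> ('o, 'a, 'p, 'b) ftor \<Rightarrow> bool" where
  "is_equivalence C D F \<longleftrightarrow> is_functor C D F \<and>
     (\<exists>G. is_functor D C G \<and>
        isomorphic (functor_cat C C) (comp_functor C G F) (id_functor C) \<and>
        isomorphic (functor_cat D D) (comp_functor D F G) (id_functor D))"

section \<open>Finite limits and colimits\<close>

definition is_cone ::
  "('o, 'a, 'm) cat_scheme \<Rightarrow> ('i, 'j, 'n) cat_scheme \<Rightarrow> ('i, 'j, 'o, 'a) ftor \<Rightarrow> 'o \<Rightarrow> ('i \<Rightarrow> 'a) \<Rightarrow> bool" where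
  "is_cone C J X l p \<longleftrightarrow> l \<in> Ob C \<and> (\<forall>j \<in> Ob J. p j \<in> hom C l (fob X j)) \<and>
     (\<forall>u \<in> Arr J. far X u \<cdot>\<^bsub>C\<^esub> p (Dom J u) = p (Cod J u))"

definition is_limit ::
  "('o, 'a, 'm) cat_scheme \<Rightarrow> ('i, 'j, 'n) cat_scheme \<Rightarrow> ('i, 'j, 'o, 'a) ftor \<Rightarrow> 'o \<Rightarrow> ('i \<Rightarrow> 'a) \<Rightarrow> bool" where
  "is_limit C J X l p \<longleftrightarrow> is_cone C J X l p \<and>
     (\<forall>t q. is_cone C J X t q \<longrightarrow> (\<exists>!h. h \<in> hom C t l \<and> (\<forall>j \<in> Ob J. p j \<cdot>\<^bsub>C\<^esub> h = q j)))"

text \<open>Every finite category is isomorphic to one whose objects and arrows are natural numbers;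
  likewise finite families may be indexed by finite sets of natural numbers.\<close>

definition finite_category :: "(nat, nat) cat \<Rightarrow> bool" where
  "finite_category J \<longleftrightarrow> category J \<and> finite (Ob J) \<and> finite (Arr J)"

definition has_finite_limits :: "('o, 'a, 'm) cat_scheme \<Rightarrow> bool" where
  "has_finite_limits C \<longleftrightarrow>
     (\<forall>J X. finite_category J \<and> is_functor J C X \<longrightarrow> (\<exists>l p. is_limit C J X l p))"

definition preserves_finite_limits ::
  "('o, 'a, 'm) cat_scheme \<Rightarrow> ('p, 'b, 'n) cat_scheme \<Rightarrow> ('o, 'a, 'p, 'b) ftor \<Rightarrow> bool" where
  "preserves_finite_limits C D F \<longleftrightarrow>
     (\<forall>J X l p. finite_category J \<and> is_functor J C X \<and> is_limit C J X l p \<longrightarrow>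
        is_limit D J (comp_functor J F X) (fob F l) (\<lambda>j. far F (p j)))"

definition is_initial :: "('o, 'a, 'm) cat_scheme \<Rightarrow> 'o \<Rightarrow> bool" where
  "is_initial C z \<longleftrightarrow> z \<in> Ob C \<and> (\<forall>x \<in> Ob C. \<exists>!h. h \<in> hom C z x)"

text \<open>\<open>is_pullback C f g p q\<close>: \<open>p\<close> and \<open>q\<close> exhibit their common domain as the fibre
  product of \<open>f\<close> and \<open>g\<close>, with \<open>f p = g q\<close>; so \<open>q\<close> is the base change of \<open>f\<close> along \<open>g\<close>.\<close>

definition is_pullback :: "('o, 'a, 'm) cat_scheme \<Rightarrow> 'a \<Rightarrow> 'a \<Rightarrow> 'a \<Rightarrow> 'a \<Rightarrow> bool" where
  "is_pullback C f g p q \<longleftrightarrow> f \<in> Arr C \<and> g \<in> Arr C \<and> Cod C f = Cod C g \<and>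
     p \<in> Arr C \<and> q \<in> Arr C \<and> Dom C p = Dom C q \<and> Cod C p = Dom C f \<and> Cod C q = Dom C g \<and>
     f \<cdot>\<^bsub>C\<^esub> p = g \<cdot>\<^bsub>C\<^esub> q \<and>
     (\<forall>t. \<forall>a \<in> hom C t (Dom C f). \<forall>b \<in> hom C t (Dom C g). f \<cdot>\<^bsub>C\<^esub> a = g \<cdot>\<^bsub>C\<^esub> b \<longrightarrow>
        (\<exists>!h. h \<in> hom C t (Dom C p) \<and> p \<cdot>\<^bsub>C\<^esub> h = a \<and> q \<cdot>\<^bsub>C\<^esub> h = b))"

definition is_coequaliser :: "('o, 'a, 'm) cat_scheme \<Rightarrow> 'a \<Rightarrow> 'a \<Rightarrow> 'a \<Rightarrow> bool" where
  "is_coequaliser C r s q \<longleftrightarrow> r \<in> Arr C \<and> s \<in> Arr C \<and> Dom C r = Dom C s \<and> Cod C r = Cod C s \<and>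
     q \<in> Arr C \<and> Dom C q = Cod C r \<and> q \<cdot>\<^bsub>C\<^esub> r = q \<cdot>\<^bsub>C\<^esub> s \<and>
     (\<forall>t. \<forall>k \<in> hom C (Cod C r) t. k \<cdot>\<^bsub>C\<^esub> r = k \<cdot>\<^bsub>C\<^esub> s \<longrightarrow>
        (\<exists>!h. h \<in> hom C (Cod C q) t \<and> h \<cdot>\<^bsub>C\<^esub> q = k))"

definition is_coproduct ::
  "('o, 'a, 'm) cat_scheme \<Rightarrow> 'k set \<Rightarrow> ('k \<Rightarrow> 'o) \<Rightarrow> 'o \<Rightarrow> ('k \<Rightarrow> 'a) \<Rightarrow> bool" where
  "is_coproduct C K X s \<iota> \<longleftrightarrow> s \<in> Ob C \<and> (\<forall>k \<in> K. \<iota> k \<in> hom C (X k) s) \<and>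
     (\<forall>t \<in> Ob C. \<forall>g. (\<forall>k \<in> K. g k \<in> hom C (X k) t) \<longrightarrow>
        (\<exists>!h. h \<in> hom C s t \<and> (\<forall>k \<in> K. h \<cdot>\<^bsub>C\<^esub> \<iota> k = g k)))"

definition has_finite_coproducts :: "('o, 'a, 'm) cat_scheme \<Rightarrow> bool" where
  "has_finite_coproducts C \<longleftrightarrow>
     (\<forall>(K :: nat set) X. finite K \<and> X ` K \<subseteq> Ob C \<longrightarrow> (\<exists>s \<iota>. is_coproduct C K X s \<iota>))"

definition preserves_finite_coproducts ::
  "('o, 'a, 'm) cat_scheme \<Rightarrow> ('p, 'b, 'n) cat_scheme \<Rightarrow> ('o, 'a, 'p, 'b) ftor \<Rightarrow> bool" where
  "preserves_finite_coproducts C D F \<longleftrightarrow>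
     (\<forall>(K :: nat set) X s \<iota>. finite K \<and> is_coproduct C K X s \<iota> \<longrightarrow>
        is_coproduct D K (\<lambda>k. fob F (X k)) (fob F s) (\<lambda>k. far F (\<iota> k)))"

definition finite_coproducts_disjoint :: "('o, 'a, 'm) cat_scheme \<Rightarrow> bool" where
  "finite_coproducts_disjoint C \<longleftrightarrow>
     (\<forall>(K :: nat set) X s \<iota>. finite K \<and> is_coproduct C K X s \<iota> \<longrightarrow>
        (\<forall>k \<in> K. is_mono C (\<iota> k)) \<and>
        (\<forall>k \<in> K. \<forall>l \<in> K. \<forall>p q. k \<noteq> l \<and> is_pullback C (\<iota> k) (\<iota> l) p q \<longrightarrow> is_initial C (Dom C p)))"

definition finite_coproducts_universal :: "('o, 'a, 'm) cat_scheme \<Rightarrow> bool" where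
  "finite_coproducts_universal C \<longleftrightarrow>
     (\<forall>(K :: nat set) X s \<iota> f p q.
        finite K \<and> is_coproduct C K X s \<iota> \<and> f \<in> Arr C \<and> Cod C f = s \<and>
        (\<forall>k \<in> K. is_pullback C (\<iota> k) f (p k) (q k)) \<longrightarrow>
        is_coproduct C K (\<lambda>k. Dom C (q k)) (Dom C f) q)"

section \<open>Pretopoi\<close>

definition is_effective_epi :: "('o, 'a, 'm) cat_scheme \<Rightarrow> 'a \<Rightarrow> bool" where
  "is_effective_epi C f \<longleftrightarrow> (\<exists>p q. is_pullback C f f p q \<and> is_coequaliser C p q f)"

definition is_universal_effective_epi :: "('o, 'a, 'm) cat_scheme \<Rightarrow> 'a \<Rightarrow> bool" where
  "is_universal_effective_epi C f \<longleftrightarrow> is_effective_epi C f \<and>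
     (\<forall>g p q. is_pullback C f g p q \<longrightarrow> is_effective_epi C q)"

text \<open>In terms of generalised elements: \<open>r, s : R \<rightarrow> A\<close> identify \<open>Hom(T, R)\<close> with an
  equivalence relation on \<open>Hom(T, A)\<close>, for every \<open>T\<close>.\<close>

definition is_equivalence_relation :: "('o, 'a, 'm) cat_scheme \<Rightarrow> 'a \<Rightarrow> 'a \<Rightarrow> bool" where
  "is_equivalence_relation C r s \<longleftrightarrow> r \<in> Arr C \<and> s \<in> Arr C \<and> Dom C r = Dom C s \<and> Cod C r = Cod C s \<and>
     (\<forall>t \<in> Ob C.
        inj_on (\<lambda>u. (r \<cdot>\<^bsub>C\<^esub> u, s \<cdot>\<^bsub>C\<^esub> u)) (hom C t (Dom C r)) \<and>
        equiv (hom C t (Cod C r)) ((\<lambda>u. (r \<cdot>\<^bsub>C\<^esub> u, s \<cdot>\<^bsub>C\<^esub> u)) ` hom C t (Dom C r)))"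

definition is_effective_relation :: "('o, 'a, 'm) cat_scheme \<Rightarrow> 'a \<Rightarrow> 'a \<Rightarrow> bool" where
  "is_effective_relation C r s \<longleftrightarrow> (\<exists>q. is_coequaliser C r s q \<and> is_pullback C q q r s)"

locale pretopos = category C
  for C :: "('o, 'a, 'm) cat_scheme" (structure) +
  assumes finite_limits: "has_finite_limits C"
    and finite_coproducts: "has_finite_coproducts C"
    and coproducts_disjoint: "finite_coproducts_disjoint C"
    and coproducts_universal: "finite_coproducts_universal C"
    and relations_effective: "is_equivalence_relation C r s \<Longrightarrow> is_effective_relation C r s"
    and epis_effective: "is_epi C f \<Longrightarrow> is_universal_effective_epi C f"

definition pretopos_morphism ::
  "('o, 'a, 'm) cat_scheme \<Rightarrow> ('p, 'b, 'n) cat_scheme \<Rightarrow> ('o, 'a, 'p, 'b) ftor \<Rightarrow> bool" where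
  "pretopos_morphism C D F \<longleftrightarrow> is_functor C D F \<and>
     preserves_finite_limits C D F \<and> preserves_finite_coproducts C D F \<and>
     (\<forall>f. is_effective_epi C f \<longrightarrow> is_effective_epi D (far F f))"

section \<open>Finite sets and Galois categories\<close>

text \<open>The objects of \<open>Fin\<close> are the finite subsets of a fixed but arbitrary infinite type \<open>'u\<close>,
  which contain a copy of every finite set.\<close>

record 'u set_map =
  msrc :: "'u set"
  mtgt :: "'u set"
  mfun :: "'u \<Rightarrow> 'u"

definition Fin :: "('u :: infinite set, 'u set_map) cat" where
  "Fin =
     \<lparr>Ob = {S. finite S},
      Arr = {f. finite (msrc f) \<and> finite (mtgt f) \<and> mfun f \<in> msrc f \<rightarrow>\<^sub>E mtgt f},
      Dom = msrc, Cod = mtgt,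
      Id = (\<lambda>S. \<lparr>msrc = S, mtgt = S, mfun = (\<lambda>a \<in> S. a)\<rparr>),
      Comp = (\<lambda>g f. \<lparr>msrc = msrc f, mtgt = mtgt g, mfun = compose (msrc f) (mfun g) (mfun f)\<rparr>)\<rparr>"

type_synonym ('o, 'a, 'u) fin_ftor = "('o, 'a, 'u set, 'u set_map) ftor"
type_synonym ('o, 'a, 'u) fin_ntrans = "('o, 'a, 'u set, 'u set_map) ntrans"

definition fibre_functor :: "('o, 'a, 'm) cat_scheme \<Rightarrow> ('o, 'a, 'u :: infinite) fin_ftor \<Rightarrow> bool" where
  "fibre_functor C F \<longleftrightarrow> pretopos_morphism C Fin F"

definition jointly_conservative ::
  "('o, 'a, 'm) cat_scheme \<Rightarrow> 'i set \<Rightarrow> ('i \<Rightarrow> ('o, 'a, 'u :: infinite) fin_ftor) \<Rightarrow> bool" where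
  "jointly_conservative C I F \<longleftrightarrow>
     (\<forall>f \<in> Arr C. (\<forall>i \<in> I. is_iso Fin (far (F i) f)) \<longrightarrow> is_iso C f)"

definition galois_category :: "'u :: infinite itself \<Rightarrow> ('o, 'a, 'm) cat_scheme \<Rightarrow> bool" where
  "galois_category U C \<longleftrightarrow> pretopos C \<and>
     (\<exists>(I :: nat set) (F :: nat \<Rightarrow> ('o, 'a, 'u) fin_ftor).
        finite I \<and> (\<forall>i \<in> I. fibre_functor C (F i)) \<and> jointly_conservative C I F)"

section \<open>Topologically enriched categories and the fundamental category\<close>

record ('o, 'a) top_cat = "('o, 'a) cat" +
  HomTop :: "'o \<Rightarrow> 'o \<Rightarrow> 'a topology"

locale top_category = category P
  for P :: "('o, 'a, 'm) top_cat_scheme" (structure) +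
  assumes topspace_HomTop: "x \<in> Ob P \<Longrightarrow> y \<in> Ob P \<Longrightarrow> topspace (HomTop P x y) = hom P x y"
    and continuous_Comp: "x \<in> Ob P \<Longrightarrow> y \<in> Ob P \<Longrightarrow> z \<in> Ob P \<Longrightarrow>
      continuous_map (prod_topology (HomTop P y z) (HomTop P x y)) (HomTop P x z) (\<lambda>(g, f). g \<cdot> f)"

definition continuous_functor ::
  "('o, 'a, 'm) top_cat_scheme \<Rightarrow> ('o, 'a, 'u :: infinite) fin_ftor \<Rightarrow> bool" where
  "continuous_functor P F \<longleftrightarrow> top_category P \<and> is_functor P Fin F \<and>
     (\<forall>x \<in> Ob P. \<forall>y \<in> Ob P.
        continuous_map (prod_topology (HomTop P x y) (discrete_topology (fob F x)))
          (discrete_topology (fob F y)) (\<lambda>(\<phi>, a). mfun (far F \<phi>) a))"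

definition Fun_cts ::
  "('o, 'a, 'm) top_cat_scheme \<Rightarrow> (('o, 'a, 'u :: infinite) fin_ftor, ('o, 'a, 'u) fin_ntrans) cat" where
  "Fun_cts P = full_subcat (functor_cat P Fin) {F. continuous_functor P F}"

definition Fun_lex ::
  "('o, 'a, 'm) cat_scheme \<Rightarrow> (('o, 'a, 'u :: infinite) fin_ftor, ('o, 'a, 'u) fin_ntrans) cat" where
  "Fun_lex C = full_subcat (functor_cat C Fin) {F. preserves_finite_limits C Fin F}"

text \<open>The topology on natural transformations from \<open>G\<close> to \<open>H\<close> is the one induced from the
  product of the finite discrete sets \<open>hom Fin (G A) (H A)\<close>.\<close>

definition Pi1 ::
  "('o, 'a, 'm) cat_scheme \<Rightarrow> 'i set \<Rightarrow> ('i \<Rightarrow> ('o, 'a, 'u :: infinite) fin_ftor) \<Rightarrow>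
     (('o, 'a, 'u) fin_ftor, ('o, 'a, 'u) fin_ntrans) top_cat" where
  "Pi1 C I F = cat.extend (full_subcat (Fun_lex C) (F ` I))
     \<lparr>HomTop = (\<lambda>G H. pullback_topology (hom (full_subcat (Fun_lex C) (F ` I)) G H) ncmp
        (product_topology (\<lambda>A. discrete_topology (hom Fin (fob G A) (fob H A))) (Ob C)))\<rparr>"

definition eval_at ::
  "(('o, 'a, 'p, 'b) ftor, ('o, 'a, 'p, 'b) ntrans, 'm) cat_scheme \<Rightarrow> 'o \<Rightarrow>
     (('o, 'a, 'p, 'b) ftor, ('o, 'a, 'p, 'b) ntrans, 'p, 'b) ftor" where
  "eval_at P A = \<lparr>fob = (\<lambda>G \<in> Ob P. fob G A), far = (\<lambda>\<phi> \<in> Arr P. ncmp \<phi> A)\<rparr>"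

definition ev ::
  "('o, 'a, 'n) cat_scheme \<Rightarrow> (('o, 'a, 'p, 'b) ftor, ('o, 'a, 'p, 'b) ntrans, 'm) cat_scheme \<Rightarrow>
     ('o, 'a,
      (('o, 'a, 'p, 'b) ftor, ('o, 'a, 'p, 'b) ntrans, 'p, 'b) ftor,
      (('o, 'a, 'p, 'b) ftor, ('o, 'a, 'p, 'b) ntrans, 'p, 'b) ntrans) ftor" where
  "ev C P =
     \<lparr>fob = (\<lambda>A \<in> Ob C. eval_at P A),
      far = (\<lambda>f \<in> Arr C.
        \<lparr>nsrc = eval_at P (Dom C f), ntgt = eval_at P (Cod C f), ncmp = (\<lambda>G \<in> Ob P. far G f)\<rparr>)\<rparr>"

end

theory Submission
  imports Defs
begin

text \<open>Call \<open>d \<in> G D\<close> minimal if no proper subobject of \<open>D\<close> contains it. Since subobjects are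
  detected by the finitely many finite fibres, every element comes from a minimal one, and every arrow
  that hits a minimal element is surjective on all fibres. By compactness, a minimal \<open>d \<in> G D\<close>
  can be sent to any \<open>y \<in> H D\<close> by a natural transformation \<open>G \<rightarrow> H\<close>. Hence a family of subsets of the
  fibres of \<open>A\<close> that is stable under natural transformations is the union of the images of finitely many
  minimal elements, that is, a subobject of \<open>A\<close>. Applied to graphs, this shows that evaluation is full;
  it is faithful because equalisers are detected on fibres. For a continuous \<open>\<Gamma>\<close>, the value of
  \<open>\<phi> \<mapsto> \<Gamma> \<phi> x\<close> depends on finitely many coordinates of \<open>\<phi>\<close>, hence only on \<open>\<phi> d\<close> for a single minimal
  \<open>d\<close>. So \<open>\<Gamma>\<close> is covered by the image of a finite coproduct \<open>E\<close>, and the kernel of this cover is a stable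
  subset of the fibres of \<open>E \<times> E\<close>, which comes from an effective equivalence relation on \<open>E\<close>.\<close>

section \<open>Categories, functors and equivalences\<close>

text \<open>Natural transformations between fibre functors need not be invertible, so neither group
  orbits nor Galois objects are available. The substitute is that minimality, although tested on one
  element \<open>d\<close> of one fibre \<open>G\<close>, constrains every fibre: an arrow into
  \<open>D\<close> that is injective on fibres and hits \<open>d\<close> is surjective on each
  \<open>H D\<close>. Applied to images this yields preimages, applied to equalisers it yields
  independence of the chosen arrow, and these two facts are what the extension of a partially
  prescribed transformation needs. A refinement handles only finitely many pairs (object, element),
  whereas naturality concerns all objects at once; this gap is what compactness bridges. Compactness
  is needed a second time for continuous functors: continuity gives a finite set of coordinates near
  each transformation, and a finite subcover makes it uniform. Finiteness of the family and of all
  fibres lets the relevant points be collected in a single finite coproduct. Isomorphy, equality and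
  factorisation of arrows are all tested on elements of fibres.\<close>

lemma homD: "f \<in> hom C x y \<Longrightarrow> f \<in> Arr C" "f \<in> hom C x y \<Longrightarrow> Dom C f = x"
    "f \<in> hom C x y \<Longrightarrow> Cod C f = y"
  by (simp_all add: hom_def)

lemma hom_self: "f \<in> Arr C \<Longrightarrow> f \<in> hom C (Dom C f) (Cod C f)"
  by (simp add: hom_def)

lemma (in category) hom_Ob: "f \<in> hom C x y \<Longrightarrow> x \<in> Ob C \<and> y \<in> Ob C"
  using dom_in_Ob cod_in_Ob by (auto simp: hom_def)

lemma (in category) seq_simps:
  assumes "f \<in> Arr C" "g \<in> Arr C" "Cod C f = Dom C g"
  shows "g \<cdot> f \<in> Arr C" "Dom C (g \<cdot> f) = Dom C f" "Cod C (g \<cdot> f) = Cod C g"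
    "h \<in> Arr C \<Longrightarrow> Cod C g = Dom C h \<Longrightarrow> (h \<cdot> g) \<cdot> f = h \<cdot> (g \<cdot> f)"
proof -
  have "f \<in> hom C (Dom C f) (Dom C g)" "g \<in> hom C (Dom C g) (Cod C g)"
    using assms by (simp_all add: hom_def)
  note h = this Comp_in_hom[OF this]
  show "g \<cdot> f \<in> Arr C" "Dom C (g \<cdot> f) = Dom C f" "Cod C (g \<cdot> f) = Cod C g"
    using h(3) by (simp_all add: hom_def)
  show "(h \<cdot> g) \<cdot> f = h \<cdot> (g \<cdot> f)" if "h \<in> Arr C" "Cod C g = Dom C h"
    by (rule Comp_assoc[OF h(1,2)]) (use that in \<open>simp add: hom_def\<close>)
qed

lemma category_full_subcat:
  assumes "category C"
  shows "category (full_subcat C S)"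
proof -
  interpret category C by fact
  have h: "f \<in> hom C x y" if "f \<in> hom (full_subcat C S) x y" for f x y
    using that by (simp add: hom_def full_subcat_def)
  have h': "f \<in> hom (full_subcat C S) x y" if "f \<in> hom C x y" "x \<in> S" "y \<in> S" for f x y
    using that by (simp add: hom_def full_subcat_def)
  have ob: "x \<in> S \<and> y \<in> S" if "f \<in> hom (full_subcat C S) x y" for f x y
    using that by (auto simp: hom_def full_subcat_def)
  have c: "Comp (full_subcat C S) = Comp C" "Id (full_subcat C S) = Id C"
    "Ob (full_subcat C S) = Ob C \<inter> S"
    by (simp_all add: full_subcat_def)
  show ?thesis
  proof
    fix f assume "f \<in> Arr (full_subcat C S)"
    then show "Dom (full_subcat C S) f \<in> Ob (full_subcat C S)"
      "Cod (full_subcat C S) f \<in> Ob (full_subcat C S)"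
      using dom_in_Ob cod_in_Ob by (auto simp: full_subcat_def)
  next
    fix x assume "x \<in> Ob (full_subcat C S)"
    then show "Id (full_subcat C S) x \<in> hom (full_subcat C S) x x"
      unfolding c by (intro h' Id_in_hom) auto
  next
    fix f x y g z assume "f \<in> hom (full_subcat C S) x y" "g \<in> hom (full_subcat C S) y z"
    then show "g \<cdot>\<^bsub>full_subcat C S\<^esub> f \<in> hom (full_subcat C S) x z"
      unfolding c by (meson h h' ob Comp_in_hom)
  next
    fix f x y assume "f \<in> hom (full_subcat C S) x y"
    then show "f \<cdot>\<^bsub>full_subcat C S\<^esub> Id (full_subcat C S) x = f"
       "Id (full_subcat C S) y \<cdot>\<^bsub>full_subcat C S\<^esub> f = f"
      unfolding c using h Comp_Id Id_Comp by blast+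
  next
    fix f x y g z k w assume "f \<in> hom (full_subcat C S) x y" "g \<in> hom (full_subcat C S) y z"
      "k \<in> hom (full_subcat C S) z w"
    then show "(k \<cdot>\<^bsub>full_subcat C S\<^esub> g) \<cdot>\<^bsub>full_subcat C S\<^esub> f = k \<cdot>\<^bsub>full_subcat C S\<^esub> (g \<cdot>\<^bsub>full_subcat C S\<^esub> f)"
      unfolding c by (meson h Comp_assoc)
  qed
qed

lemma is_functorD:
  assumes "is_functor C D F"
  shows "category C" "category D" "x \<in> Ob C \<Longrightarrow> fob F x \<in> Ob D"
    "f \<in> hom C x y \<Longrightarrow> far F f \<in> hom D (fob F x) (fob F y)"
    "x \<in> Ob C \<Longrightarrow> far F (Id C x) = Id D (fob F x)"
    "f \<in> hom C x y \<Longrightarrow> g \<in> hom C y z \<Longrightarrow> far F (g \<cdot>\<^bsub>C\<^esub> f) = far F g \<cdot>\<^bsub>D\<^esub> far F f"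
  using assms unfolding is_functor_def hom_def by (auto simp: PiE_iff Pi_iff)

lemma functor_eqI:
  assumes "is_functor C D F" "is_functor C D G"
    "\<And>x. x \<in> Ob C \<Longrightarrow> fob F x = fob G x" "\<And>f. f \<in> Arr C \<Longrightarrow> far F f = far G f"
  shows "F = G"
proof -
  have "fob F = fob G"
    using assms by (intro PiE_ext[of "fob F" "Ob C" "\<lambda>_. Ob D"]) (auto simp: is_functor_def)
  moreover have "far F = far G"
    using assms unfolding is_functor_def by (intro extensionalityI[of _ "Arr C"]) (auto simp: PiE_iff)
  ultimately show ?thesis by simp
qed

lemma functorI:
  assumes "category C" "category D" "\<And>x. x \<in> Ob C \<Longrightarrow> \<phi> x \<in> Ob D"
    "\<And>f x y. f \<in> hom C x y \<Longrightarrow> \<psi> f \<in> hom D (\<phi> x) (\<phi> y)"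
    "\<And>x. x \<in> Ob C \<Longrightarrow> \<psi> (Id C x) = Id D (\<phi> x)"
    "\<And>x y z f g. f \<in> hom C x y \<Longrightarrow> g \<in> hom C y z \<Longrightarrow> \<psi> (g \<cdot>\<^bsub>C\<^esub> f) = \<psi> g \<cdot>\<^bsub>D\<^esub> \<psi> f"
  shows "is_functor C D \<lparr>fob = restrict \<phi> (Ob C), far = restrict \<psi> (Arr C)\<rparr>"
proof -
  interpret category C by fact
  have "\<psi> f \<in> hom D (\<phi> (Dom C f)) (\<phi> (Cod C f))" if "f \<in> Arr C" for f
    using assms(4) hom_self that by metis
  moreover have "Id C x \<in> Arr C" if "x \<in> Ob C" for x
    using Id_in_hom that homD by metis
  moreover have "f \<in> Arr C" "g \<in> Arr C" "g \<cdot>\<^bsub>C\<^esub> f \<in> Arr C" if "f \<in> hom C x y" "g \<in> hom C y z" for f g x y z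
    using that Comp_in_hom homD(1) by metis+
  ultimately show ?thesis
    using assms dom_in_Ob cod_in_Ob unfolding is_functor_def by (auto simp: PiE_iff)
qed

lemma is_functor_comp:
  assumes "is_functor C D F" "is_functor D E G"
  shows "is_functor C E (comp_functor C G F)"
  unfolding comp_functor_def compose_def
proof (rule functorI)
  note F = is_functorD[OF assms(1)] and G = is_functorD[OF assms(2)]
  show "category C" "category E" using F G by auto
  show "\<And>x. x \<in> Ob C \<Longrightarrow> fob G (fob F x) \<in> Ob E" using F G by auto
  show "far G (far F f) \<in> hom E (fob G (fob F x)) (fob G (fob F y))" if "f \<in> hom C x y" for f x y
    using F(4) G(4) that by blast
  show "far G (far F (Id C x)) = Id E (fob G (fob F x))" if "x \<in> Ob C" for x
    using F G that by simp
  show "far G (far F (g \<cdot>\<^bsub>C\<^esub> f)) = far G (far F g) \<cdot>\<^bsub>E\<^esub> far G (far F f)"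
    if "f \<in> hom C x y" "g \<in> hom C y z" for x y z f g
    using F(4)[OF that(1)] F(4)[OF that(2)] F(6)[OF that] G(6) by simp
qed

lemma is_functor_id: "category C \<Longrightarrow> is_functor C C (id_functor C)"
  unfolding id_functor_def by (rule functorI) auto

lemma is_ntransD:
  assumes "is_ntrans C D \<eta>"
  shows "is_functor C D (nsrc \<eta>)" "is_functor C D (ntgt \<eta>)"
    "x \<in> Ob C \<Longrightarrow> ncmp \<eta> x \<in> hom D (fob (nsrc \<eta>) x) (fob (ntgt \<eta>) x)"
    "f \<in> hom C x y \<Longrightarrow> ncmp \<eta> y \<cdot>\<^bsub>D\<^esub> far (nsrc \<eta>) f = far (ntgt \<eta>) f \<cdot>\<^bsub>D\<^esub> ncmp \<eta> x"
  using assms unfolding is_ntrans_def hom_def by (auto simp: PiE_iff)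

lemma ntransI:
  assumes "is_functor C D F" "is_functor C D G"
    "\<And>x. x \<in> Ob C \<Longrightarrow> \<tau> x \<in> hom D (fob F x) (fob G x)"
    "\<And>f x y. f \<in> hom C x y \<Longrightarrow> \<tau> y \<cdot>\<^bsub>D\<^esub> far F f = far G f \<cdot>\<^bsub>D\<^esub> \<tau> x"
  shows "is_ntrans C D \<lparr>nsrc = F, ntgt = G, ncmp = restrict \<tau> (Ob C)\<rparr>"
proof -
  interpret category C using is_functorD(1)[OF assms(1)] .
  show ?thesis
    using assms dom_in_Ob cod_in_Ob hom_self[of _ C] unfolding is_ntrans_def by (auto simp: PiE_iff)
qed

lemma ntrans_eqI:
  assumes "is_ntrans C D \<eta>" "is_ntrans C D \<theta>" "nsrc \<eta> = nsrc \<theta>" "ntgt \<eta> = ntgt \<theta>"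
    "\<And>x. x \<in> Ob C \<Longrightarrow> ncmp \<eta> x = ncmp \<theta> x"
  shows "\<eta> = \<theta>"
proof -
  have "ncmp \<eta> = ncmp \<theta>"
    using assms unfolding is_ntrans_def by (intro extensionalityI[of _ "Ob C"]) (auto simp: PiE_iff)
  then show ?thesis using assms by simp
qed

section \<open>The functor category and its isomorphisms\<close>

lemma functor_cat_simps [simp]:
  "Ob (functor_cat C D) = {F. is_functor C D F}" "Arr (functor_cat C D) = {\<eta>. is_ntrans C D \<eta>}"
  "Dom (functor_cat C D) = nsrc" "Cod (functor_cat C D) = ntgt"
  by (simp_all add: functor_cat_def)

lemma functor_cat_Comp:
  assumes "is_ntrans C D \<eta>" "is_ntrans C D \<theta>" "ntgt \<eta> = nsrc \<theta>"
  shows "is_ntrans C D (\<theta> \<cdot>\<^bsub>functor_cat C D\<^esub> \<eta>)"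
proof -
  note \<eta> = is_ntransD[OF assms(1)] and \<theta> = is_ntransD[OF assms(2)]
  interpret D: category D using is_functorD(2)[OF \<eta>(1)] .
  interpret C: category C using is_functorD(1)[OF \<eta>(1)] .
  show ?thesis
    unfolding functor_cat_def cat.simps
  proof (rule ntransI)
    show "is_functor C D (nsrc \<eta>)" "is_functor C D (ntgt \<theta>)" by (rule \<eta> \<theta>)+
    show "ncmp \<theta> x \<cdot>\<^bsub>D\<^esub> ncmp \<eta> x \<in> hom D (fob (nsrc \<eta>) x) (fob (ntgt \<theta>) x)" if "x \<in> Ob C" for x
      using \<eta>(3)[OF that] \<theta>(3)[OF that] assms(3) D.Comp_in_hom by simp
    fix f x y assume f: "f \<in> hom C x y"
    then have xy: "x \<in> Ob C" "y \<in> Ob C" using C.hom_Ob by auto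
    note h = \<eta>(3)[OF xy(1)] \<eta>(3)[OF xy(2)] \<theta>(3)[OF xy(1), folded assms(3)] \<theta>(3)[OF xy(2), folded assms(3)]
      is_functorD(4)[OF \<eta>(1) f] is_functorD(4)[OF \<eta>(2) f] is_functorD(4)[OF \<theta>(2) f]
    have "(ncmp \<theta> y \<cdot>\<^bsub>D\<^esub> ncmp \<eta> y) \<cdot>\<^bsub>D\<^esub> far (nsrc \<eta>) f = ncmp \<theta> y \<cdot>\<^bsub>D\<^esub> (ncmp \<eta> y \<cdot>\<^bsub>D\<^esub> far (nsrc \<eta>) f)"
      using h D.Comp_assoc by blast
    also have "\<dots> = ncmp \<theta> y \<cdot>\<^bsub>D\<^esub> (far (nsrc \<theta>) f \<cdot>\<^bsub>D\<^esub> ncmp \<eta> x)" by (simp add: \<eta>(4)[OF f] assms(3))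
    also have "\<dots> = (ncmp \<theta> y \<cdot>\<^bsub>D\<^esub> far (nsrc \<theta>) f) \<cdot>\<^bsub>D\<^esub> ncmp \<eta> x"
      using h D.Comp_assoc unfolding assms(3) by metis
    also have "\<dots> = (far (ntgt \<theta>) f \<cdot>\<^bsub>D\<^esub> ncmp \<theta> x) \<cdot>\<^bsub>D\<^esub> ncmp \<eta> x" by (simp add: \<theta>(4)[OF f])
    also have "\<dots> = far (ntgt \<theta>) f \<cdot>\<^bsub>D\<^esub> (ncmp \<theta> x \<cdot>\<^bsub>D\<^esub> ncmp \<eta> x)"
      using h D.Comp_assoc by blast
    finally show "(ncmp \<theta> y \<cdot>\<^bsub>D\<^esub> ncmp \<eta> y) \<cdot>\<^bsub>D\<^esub> far (nsrc \<eta>) f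
        = far (ntgt \<theta>) f \<cdot>\<^bsub>D\<^esub> (ncmp \<theta> x \<cdot>\<^bsub>D\<^esub> ncmp \<eta> x)" .
  qed
qed

lemma functor_cat_Id:
  assumes "is_functor C D F"
  shows "is_ntrans C D (Id (functor_cat C D) F)"
  unfolding functor_cat_def cat.simps
proof (rule ntransI)
  interpret D: category D using is_functorD(2)[OF assms] .
  show "is_functor C D F" "is_functor C D F" by fact+
  show "Id D (fob F x) \<in> hom D (fob F x) (fob F x)" if "x \<in> Ob C" for x
    using that is_functorD(3)[OF assms] D.Id_in_hom by blast
  show "Id D (fob F y) \<cdot>\<^bsub>D\<^esub> far F f = far F f \<cdot>\<^bsub>D\<^esub> Id D (fob F x)" if "f \<in> hom C x y" for f x y
    using is_functorD(4)[OF assms that] D.Id_Comp D.Comp_Id by metis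
qed

lemma category_functor_cat: "category (functor_cat C D)"
proof
  let ?K = "functor_cat C D"
  have src: "nsrc (g \<cdot>\<^bsub>?K\<^esub> f) = nsrc f" "ntgt (g \<cdot>\<^bsub>?K\<^esub> f) = ntgt g"
    "x \<in> Ob C \<Longrightarrow> ncmp (g \<cdot>\<^bsub>?K\<^esub> f) x = ncmp g x \<cdot>\<^bsub>D\<^esub> ncmp f x"
    "nsrc (Id ?K F) = F" "ntgt (Id ?K F) = F"
    "x \<in> Ob C \<Longrightarrow> ncmp (Id ?K F) x = Id D (fob F x)" for f g x F
    by (simp_all add: functor_cat_def)
  show "Dom ?K f \<in> Ob ?K" "Cod ?K f \<in> Ob ?K" if "f \<in> Arr ?K" for f
    using that is_ntransD by auto
  show "Id ?K F \<in> hom ?K F F" if "F \<in> Ob ?K" for F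
    using that functor_cat_Id[of C D F] by (simp add: hom_def src)
  show comp: "g \<cdot>\<^bsub>?K\<^esub> f \<in> hom ?K x z" if "f \<in> hom ?K x y" "g \<in> hom ?K y z" for x y z f g
    using that functor_cat_Comp[of C D f g] by (simp add: hom_def src)
  show "f \<cdot>\<^bsub>?K\<^esub> Id ?K x = f" if f: "f \<in> hom ?K x y" for f x y
  proof -
    have n: "is_ntrans C D f" "nsrc f = x" "ntgt f = y" using f by (auto simp: hom_def)
    have "is_functor C D x" using is_ntransD(1)[OF n(1)] n by simp
    note D = is_functorD(2)[OF this]
    show ?thesis
    proof (rule ntrans_eqI[OF _ n(1)])
      show "is_ntrans C D (f \<cdot>\<^bsub>?K\<^esub> Id ?K x)"
        using n functor_cat_Comp functor_cat_Id[OF \<open>is_functor C D x\<close>] src(5) by blast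
      fix a assume "a \<in> Ob C"
      then show "ncmp (f \<cdot>\<^bsub>?K\<^esub> Id ?K x) a = ncmp f a"
        using is_ntransD(3)[OF n(1), of a] category.Comp_Id[OF D, of _ "fob x a" "fob y a"] n by (simp add: src)
    qed (simp_all add: src n)
  qed
  show "Id ?K y \<cdot>\<^bsub>?K\<^esub> f = f" if f: "f \<in> hom ?K x y" for f x y
  proof -
    have n: "is_ntrans C D f" "nsrc f = x" "ntgt f = y" using f by (auto simp: hom_def)
    have "is_functor C D y" using is_ntransD(2)[OF n(1)] n by simp
    note D = is_functorD(2)[OF this]
    show ?thesis
    proof (rule ntrans_eqI[OF _ n(1)])
      show "is_ntrans C D (Id ?K y \<cdot>\<^bsub>?K\<^esub> f)"
        using n functor_cat_Comp functor_cat_Id[OF \<open>is_functor C D y\<close>] src(4) by metis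
      fix a assume "a \<in> Ob C"
      then show "ncmp (Id ?K y \<cdot>\<^bsub>?K\<^esub> f) a = ncmp f a"
        using is_ntransD(3)[OF n(1), of a] category.Id_Comp[OF D, of _ "fob x a" "fob y a"] n by (simp add: src)
    qed (simp_all add: src n)
  qed
  show "(h \<cdot>\<^bsub>?K\<^esub> g) \<cdot>\<^bsub>?K\<^esub> f = h \<cdot>\<^bsub>?K\<^esub> (g \<cdot>\<^bsub>?K\<^esub> f)"
    if "f \<in> hom ?K x y" "g \<in> hom ?K y z" "h \<in> hom ?K z w" for f g h x y z w
  proof (rule ntrans_eqI[of C D])
    show "is_ntrans C D ((h \<cdot>\<^bsub>?K\<^esub> g) \<cdot>\<^bsub>?K\<^esub> f)" "is_ntrans C D (h \<cdot>\<^bsub>?K\<^esub> (g \<cdot>\<^bsub>?K\<^esub> f))"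
      using comp[OF comp[OF that(1,2)] that(3)] comp[OF that(1) comp[OF that(2,3)]]
      by (simp_all add: hom_def)
    have n: "is_ntrans C D f" "is_ntrans C D g" "is_ntrans C D h" "nsrc f = x" "ntgt f = y"
      "nsrc g = y" "ntgt g = z" "nsrc h = z" "ntgt h = w"
      using that by (auto simp: hom_def)
    note D = is_functorD(2)[OF is_ntransD(1)[OF n(1)]]
    fix a assume a: "a \<in> Ob C"
    show "ncmp ((h \<cdot>\<^bsub>?K\<^esub> g) \<cdot>\<^bsub>?K\<^esub> f) a = ncmp (h \<cdot>\<^bsub>?K\<^esub> (g \<cdot>\<^bsub>?K\<^esub> f)) a"
      unfolding src(3)[OF a]
      using is_ntransD(3)[OF n(1) a] is_ntransD(3)[OF n(2) a] is_ntransD(3)[OF n(3) a] n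
        category.Comp_assoc[OF D] by simp
  qed (simp_all add: src)
qed

text \<open>Pointwise inverses are automatically natural: composing the naturality square of \<eta>
  with them on both sides gives the square for the inverses.\<close>

lemma is_iso_functor_catI:
  assumes "is_ntrans C D \<eta>" "\<And>x. x \<in> Ob C \<Longrightarrow> is_iso D (ncmp \<eta> x)"
  shows "is_iso (functor_cat C D) \<eta>"
proof -
  let ?K = "functor_cat C D"
  note \<eta> = is_ntransD[OF assms(1)]
  interpret D: category D using is_functorD(2)[OF \<eta>(1)] .
  interpret C: category C using is_functorD(1)[OF \<eta>(1)] .
  have "\<exists>g. g \<in> hom D (fob (ntgt \<eta>) x) (fob (nsrc \<eta>) x) \<and> g \<cdot>\<^bsub>D\<^esub> ncmp \<eta> x = Id D (fob (nsrc \<eta>) x)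
      \<and> ncmp \<eta> x \<cdot>\<^bsub>D\<^esub> g = Id D (fob (ntgt \<eta>) x)" if "x \<in> Ob C" for x
    using assms(2)[OF that] homD[OF \<eta>(3)[OF that]] unfolding is_iso_def by auto
  then obtain \<tau> where t: "\<And>x. x \<in> Ob C \<Longrightarrow> \<tau> x \<in> hom D (fob (ntgt \<eta>) x) (fob (nsrc \<eta>) x)"
      "\<And>x. x \<in> Ob C \<Longrightarrow> \<tau> x \<cdot>\<^bsub>D\<^esub> ncmp \<eta> x = Id D (fob (nsrc \<eta>) x)"
      "\<And>x. x \<in> Ob C \<Longrightarrow> ncmp \<eta> x \<cdot>\<^bsub>D\<^esub> \<tau> x = Id D (fob (ntgt \<eta>) x)"
    by metis
  let ?t = "\<lparr>nsrc = ntgt \<eta>, ntgt = nsrc \<eta>, ncmp = restrict \<tau> (Ob C)\<rparr>"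
  have nt: "is_ntrans C D ?t"
  proof (rule ntransI[OF \<eta>(2,1) t(1)])
    fix f x y assume f: "f \<in> hom C x y"
    then have xy: "x \<in> Ob C" "y \<in> Ob C" using C.hom_Ob by auto
    note h = is_functorD(4)[OF \<eta>(1) f] is_functorD(4)[OF \<eta>(2) f] \<eta>(3)[OF xy(1)] \<eta>(3)[OF xy(2)]
      t(1)[OF xy(1)] t(1)[OF xy(2)]
    have "\<tau> y \<cdot>\<^bsub>D\<^esub> far (ntgt \<eta>) f = \<tau> y \<cdot>\<^bsub>D\<^esub> (far (ntgt \<eta>) f \<cdot>\<^bsub>D\<^esub> (ncmp \<eta> x \<cdot>\<^bsub>D\<^esub> \<tau> x))"
      using t(3)[OF xy(1)] D.Comp_Id[OF h(2)] by simp
    also have "\<dots> = \<tau> y \<cdot>\<^bsub>D\<^esub> ((ncmp \<eta> y \<cdot>\<^bsub>D\<^esub> far (nsrc \<eta>) f) \<cdot>\<^bsub>D\<^esub> \<tau> x)"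
      using h D.seq_simps(4)[of "\<tau> x" "ncmp \<eta> x" "far (ntgt \<eta>) f"] \<eta>(4)[OF f] by (simp add: hom_def)
    also have "\<dots> = ((\<tau> y \<cdot>\<^bsub>D\<^esub> ncmp \<eta> y) \<cdot>\<^bsub>D\<^esub> far (nsrc \<eta>) f) \<cdot>\<^bsub>D\<^esub> \<tau> x"
      using h by (simp add: hom_def D.seq_simps)
    also have "\<dots> = far (nsrc \<eta>) f \<cdot>\<^bsub>D\<^esub> \<tau> x"
      using t(2)[OF xy(2)] D.Id_Comp[OF h(1)] by simp
    finally show "\<tau> y \<cdot>\<^bsub>D\<^esub> far (ntgt \<eta>) f = far (nsrc \<eta>) f \<cdot>\<^bsub>D\<^esub> \<tau> x" .
  qed
  have "?t \<cdot>\<^bsub>?K\<^esub> \<eta> = Id ?K (nsrc \<eta>)" "\<eta> \<cdot>\<^bsub>?K\<^esub> ?t = Id ?K (ntgt \<eta>)"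
    using t by (auto simp: functor_cat_def)
  then show ?thesis
    unfolding is_iso_def using nt assms(1) by (auto simp: hom_def intro!: bexI[of _ ?t])
qed

text \<open>Since an equivalence is defined by a quasi-inverse, one has to be constructed. Objects
  \<open>g z\<close> and isomorphisms \<open>e z\<close> from F (g z) to z are chosen; an arrow h is
  sent to the lift of its conjugate by these isomorphisms. Every equation in C is proved by applying
  F and using faithfulness.\<close>

lemma is_equivalenceI:
  assumes F: "is_functor C D F"
    and faithful: "\<And>x y f g. f \<in> hom C x y \<Longrightarrow> g \<in> hom C x y \<Longrightarrow> far F f = far F g \<Longrightarrow> f = g"
    and full: "\<And>x y h. x \<in> Ob C \<Longrightarrow> y \<in> Ob C \<Longrightarrow> h \<in> hom D (fob F x) (fob F y) \<Longrightarrow>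
      \<exists>f \<in> hom C x y. far F f = h"
    and ess: "\<And>z. z \<in> Ob D \<Longrightarrow> \<exists>x \<in> Ob C. isomorphic D (fob F x) z"
  shows "is_equivalence C D F"
proof -
  interpret C: category C using is_functorD(1)[OF F] .
  interpret D: category D using is_functorD(2)[OF F] .
  note Fh = is_functorD(4)[OF F] and FId = is_functorD(5)[OF F] and FC = is_functorD(6)[OF F]
    and FO = is_functorD(3)[OF F]
  have "\<exists>x e e'. x \<in> Ob C \<and> e \<in> hom D (fob F x) z \<and> e' \<in> hom D z (fob F x) \<and>
      e' \<cdot>\<^bsub>D\<^esub> e = Id D (fob F x) \<and> e \<cdot>\<^bsub>D\<^esub> e' = Id D z" if z: "z \<in> Ob D" for z
  proof -
    obtain x e where x: "x \<in> Ob C" "e \<in> hom D (fob F x) z" "is_iso D e"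
      using ess[OF z] unfolding isomorphic_def by blast
    then show ?thesis using homD[OF x(2)] unfolding is_iso_def by auto
  qed
  then obtain g e e' where g: "\<And>z. z \<in> Ob D \<Longrightarrow> g z \<in> Ob C"
    and e: "\<And>z. z \<in> Ob D \<Longrightarrow> e z \<in> hom D (fob F (g z)) z"
    and e': "\<And>z. z \<in> Ob D \<Longrightarrow> e' z \<in> hom D z (fob F (g z))"
    and ee: "\<And>z. z \<in> Ob D \<Longrightarrow> e' z \<cdot>\<^bsub>D\<^esub> e z = Id D (fob F (g z))"
    and ee': "\<And>z. z \<in> Ob D \<Longrightarrow> e z \<cdot>\<^bsub>D\<^esub> e' z = Id D z"
    by metis
  \<comment> \<open>Conjugating h by the chosen isomorphisms gives an arrow between values of F, so
    fullness applies.\<close>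
  have "\<exists>k. k \<in> hom C (g (Dom D h)) (g (Cod D h)) \<and> far F k = e' (Cod D h) \<cdot>\<^bsub>D\<^esub> (h \<cdot>\<^bsub>D\<^esub> e (Dom D h))"
    if h: "h \<in> Arr D" for h
  proof -
    have "e' (Cod D h) \<cdot>\<^bsub>D\<^esub> (h \<cdot>\<^bsub>D\<^esub> e (Dom D h)) \<in> hom D (fob F (g (Dom D h))) (fob F (g (Cod D h)))"
      using D.Comp_in_hom e e' D.dom_in_Ob[OF h] D.cod_in_Ob[OF h] hom_self[OF h] by metis
    then show ?thesis using full g D.dom_in_Ob[OF h] D.cod_in_Ob[OF h] by metis
  qed
  then obtain k where k0: "\<And>h. h \<in> Arr D \<Longrightarrow> k h \<in> hom C (g (Dom D h)) (g (Cod D h))"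
     "\<And>h. h \<in> Arr D \<Longrightarrow> far F (k h) = e' (Cod D h) \<cdot>\<^bsub>D\<^esub> (h \<cdot>\<^bsub>D\<^esub> e (Dom D h))"
    by metis
  have k: "k h \<in> hom C (g x) (g y)" "far F (k h) = e' y \<cdot>\<^bsub>D\<^esub> (h \<cdot>\<^bsub>D\<^esub> e x)" if "h \<in> hom D x y" for h x y
    using k0[OF homD(1)[OF that]] homD(2,3)[OF that] by auto
  \<comment> \<open>This is the naturality square of \<open>e\<close>; compatibility of
    \<open>k\<close> with composition and both natural isomorphisms below come from it.\<close>
  have ek: "e y \<cdot>\<^bsub>D\<^esub> far F (k h) = h \<cdot>\<^bsub>D\<^esub> e x" if h: "h \<in> hom D x y" for h x y
  proof -
    have xy: "x \<in> Ob D" "y \<in> Ob D" using D.hom_Ob[OF h] by auto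
    have he: "h \<cdot>\<^bsub>D\<^esub> e x \<in> hom D (fob F (g x)) y" using D.Comp_in_hom e xy h by blast
    then show ?thesis
      using k(2)[OF h] D.Comp_assoc[OF he e'[OF xy(2)] e[OF xy(2)]] ee'[OF xy(2)] D.Id_Comp[OF he] by simp
  qed
  define G where "G = \<lparr>fob = restrict g (Ob D), far = restrict k (Arr D)\<rparr>"
  have G: "is_functor D C G"
    unfolding G_def
  proof (rule functorI)
    show "k (Id D z) = Id C (g z)" if z: "z \<in> Ob D" for z
    proof (rule faithful)
      show "k (Id D z) \<in> hom C (g z) (g z)" "Id C (g z) \<in> hom C (g z) (g z)"
        using z k(1)[OF D.Id_in_hom] C.Id_in_hom g by auto
      show "far F (k (Id D z)) = far F (Id C (g z))"
        using k(2)[OF D.Id_in_hom[OF z]] FId[OF g[OF z]] ee[OF z] D.Id_Comp[OF e[OF z]] by simp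
    qed
    show "k (h' \<cdot>\<^bsub>D\<^esub> h) = k h' \<cdot>\<^bsub>C\<^esub> k h" if h: "h \<in> hom D x y" "h' \<in> hom D y z" for x y z h h'
    proof (rule faithful)
      have ob: "x \<in> Ob D" "y \<in> Ob D" "z \<in> Ob D" using h D.hom_Ob by blast+
      note hh = D.Comp_in_hom[OF h]
      show "k (h' \<cdot>\<^bsub>D\<^esub> h) \<in> hom C (g x) (g z)" "k h' \<cdot>\<^bsub>C\<^esub> k h \<in> hom C (g x) (g z)"
        using k(1)[OF hh] C.Comp_in_hom[OF k(1)[OF h(1)] k(1)[OF h(2)]] by auto
      have he: "h' \<cdot>\<^bsub>D\<^esub> e y \<in> hom D (fob F (g y)) z" using D.Comp_in_hom e ob h by blast
      note kh = Fh[OF k(1)[OF h(1)]]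
      have "far F (k h' \<cdot>\<^bsub>C\<^esub> k h) = (e' z \<cdot>\<^bsub>D\<^esub> (h' \<cdot>\<^bsub>D\<^esub> e y)) \<cdot>\<^bsub>D\<^esub> far F (k h)"
        using FC[OF k(1)[OF h(1)] k(1)[OF h(2)]] k(2)[OF h(2)] by simp
      also have "\<dots> = e' z \<cdot>\<^bsub>D\<^esub> (h' \<cdot>\<^bsub>D\<^esub> (e y \<cdot>\<^bsub>D\<^esub> far F (k h)))"
        using D.Comp_assoc[OF kh he e'[OF ob(3)]] D.Comp_assoc[OF kh e[OF ob(2)] h(2)] by simp
      also have "\<dots> = e' z \<cdot>\<^bsub>D\<^esub> ((h' \<cdot>\<^bsub>D\<^esub> h) \<cdot>\<^bsub>D\<^esub> e x)"
        using ek[OF h(1)] D.Comp_assoc[OF e[OF ob(1)] h] by simp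
      finally show "far F (k (h' \<cdot>\<^bsub>D\<^esub> h)) = far F (k h' \<cdot>\<^bsub>C\<^esub> k h)" using k(2)[OF hh] by simp
    qed
  qed (use C.category_axioms D.category_axioms g k in auto)
  \<comment> \<open>Fullness lifts the inverse and faithfulness lifts its two equations. It is
    applied to the components \<open>u x\<close> below.\<close>
  have reflects: "is_iso C f" if f: "f \<in> hom C x y" and h: "h \<in> hom D (fob F y) (fob F x)"
    "h \<cdot>\<^bsub>D\<^esub> far F f = Id D (fob F x)" "far F f \<cdot>\<^bsub>D\<^esub> h = Id D (fob F y)" for f x y h
  proof -
    have xy: "x \<in> Ob C" "y \<in> Ob C" using C.hom_Ob[OF f] by auto
    obtain f' where f': "f' \<in> hom C y x" "far F f' = h" using full[OF xy(2,1) h(1)] by blast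
    have "f' \<cdot>\<^bsub>C\<^esub> f = Id C x"
      by (rule faithful[OF C.Comp_in_hom[OF f f'(1)] C.Id_in_hom[OF xy(1)]])
        (simp add: FC[OF f f'(1)] FId xy f' h)
    moreover have "f \<cdot>\<^bsub>C\<^esub> f' = Id C y"
      by (rule faithful[OF C.Comp_in_hom[OF f'(1) f] C.Id_in_hom[OF xy(2)]])
        (simp add: FC[OF f'(1) f] FId xy f' h)
    ultimately show ?thesis using f f' homD[OF f] unfolding is_iso_def by auto
  qed
  have "isomorphic (functor_cat D D) (comp_functor D F G) (id_functor D)"
  proof -
    let ?\<eta> = "\<lparr>nsrc = comp_functor D F G, ntgt = id_functor D, ncmp = restrict e (Ob D)\<rparr>"
    have "is_ntrans D D ?\<eta>"
    proof (rule ntransI[OF is_functor_comp[OF G F] is_functor_id[OF D.category_axioms]])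
      show "e x \<in> hom D (fob (comp_functor D F G) x) (fob (id_functor D) x)" if "x \<in> Ob D" for x
        using that e by (simp add: comp_functor_def id_functor_def compose_def G_def)
      show "e y \<cdot>\<^bsub>D\<^esub> far (comp_functor D F G) h = far (id_functor D) h \<cdot>\<^bsub>D\<^esub> e x" if "h \<in> hom D x y" for h x y
        using ek[OF that] homD(1)[OF that] by (simp add: comp_functor_def id_functor_def compose_def G_def)
    qed
    moreover have "is_iso D (e x)" if "x \<in> Ob D" for x
      using e[OF that] e'[OF that] ee[OF that] ee'[OF that] homD[OF e[OF that]] unfolding is_iso_def by auto
    ultimately have "is_iso (functor_cat D D) ?\<eta>" by (intro is_iso_functor_catI) auto
    then show ?thesis unfolding isomorphic_def
      using \<open>is_ntrans D D ?\<eta>\<close> by (intro bexI[of _ ?\<eta>]) (auto simp: hom_def)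
  qed
  moreover have "isomorphic (functor_cat C C) (comp_functor C G F) (id_functor C)"
  proof -
    \<comment> \<open>The isomorphism \<open>e\<close> at F x lies between values of F, so it lifts
      to an arrow from the object chosen for F x to x itself.\<close>
    have "\<exists>u. u \<in> hom C (g (fob F x)) x \<and> far F u = e (fob F x)" if "x \<in> Ob C" for x
      using full[OF g[OF FO[OF that]] that e[OF FO[OF that]]] by blast
    then obtain u where u: "\<And>x. x \<in> Ob C \<Longrightarrow> u x \<in> hom C (g (fob F x)) x"
      "\<And>x. x \<in> Ob C \<Longrightarrow> far F (u x) = e (fob F x)" by metis
    let ?\<eta> = "\<lparr>nsrc = comp_functor C G F, ntgt = id_functor C, ncmp = restrict u (Ob C)\<rparr>"
    have "is_ntrans C C ?\<eta>"
    proof (rule ntransI[OF is_functor_comp[OF F G] is_functor_id[OF C.category_axioms]])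
      show "u x \<in> hom C (fob (comp_functor C G F) x) (fob (id_functor C) x)" if "x \<in> Ob C" for x
        using that u(1) FO by (simp add: comp_functor_def id_functor_def compose_def G_def)
      fix f x y assume f: "f \<in> hom C x y"
      have xy: "x \<in> Ob C" "y \<in> Ob C" using C.hom_Ob[OF f] by auto
      note kf = k(1)[OF Fh[OF f]]
      have "u y \<cdot>\<^bsub>C\<^esub> k (far F f) = f \<cdot>\<^bsub>C\<^esub> u x"
        by (rule faithful[OF C.Comp_in_hom[OF kf u(1)[OF xy(2)]] C.Comp_in_hom[OF u(1)[OF xy(1)] f]])
          (simp add: FC[OF kf u(1)[OF xy(2)]] FC[OF u(1)[OF xy(1)] f] u(2) xy ek[OF Fh[OF f]])
      then show "u y \<cdot>\<^bsub>C\<^esub> far (comp_functor C G F) f = far (id_functor C) f \<cdot>\<^bsub>C\<^esub> u x"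
        using homD(1)[OF f] homD(1)[OF Fh[OF f]] by (simp add: comp_functor_def id_functor_def compose_def G_def)
    qed
    moreover have "is_iso C (u x)" if "x \<in> Ob C" for x
      using that u FO e' ee ee' by (intro reflects[of _ "g (fob F x)" x "e' (fob F x)"]) auto
    ultimately have "is_iso (functor_cat C C) ?\<eta>" by (intro is_iso_functor_catI) auto
    then show ?thesis unfolding isomorphic_def
      using \<open>is_ntrans C C ?\<eta>\<close> by (intro bexI[of _ ?\<eta>]) (auto simp: hom_def)
  qed
  ultimately show ?thesis unfolding is_equivalence_def using F G by blast
qed

section \<open>Finite sets\<close>

definition fin_map :: "'u set \<Rightarrow> 'u set \<Rightarrow> ('u \<Rightarrow> 'u) \<Rightarrow> 'u set_map" where
  "fin_map S T h = \<lparr>msrc = S, mtgt = T, mfun = restrict h S\<rparr>"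

lemma hom_Fin_iff:
  "f \<in> hom Fin S T \<longleftrightarrow> finite S \<and> finite T \<and> msrc f = S \<and> mtgt f = T \<and> mfun f \<in> S \<rightarrow>\<^sub>E T"
  by (auto simp: hom_def Fin_def)

lemma hom_FinD:
  assumes "f \<in> hom Fin S T"
  shows "finite S" "finite T" "msrc f = S" "mtgt f = T" "x \<in> S \<Longrightarrow> mfun f x \<in> T"
  using assms by (auto simp: hom_Fin_iff)

lemma Fin_simps [simp]: "Dom Fin = msrc" "Cod Fin = mtgt" "Ob Fin = {S. finite S}"
  by (simp_all add: Fin_def)

lemma Fin_Comp_app:
  "x \<in> msrc f \<Longrightarrow> mfun (g \<cdot>\<^bsub>Fin\<^esub> f) x = mfun g (mfun f x)"
  "mfun (g \<cdot>\<^bsub>Fin\<^esub> f) = compose (msrc f) (mfun g) (mfun f)"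
  "msrc (g \<cdot>\<^bsub>Fin\<^esub> f) = msrc f" "mtgt (g \<cdot>\<^bsub>Fin\<^esub> f) = mtgt g"
  by (simp_all add: Fin_def compose_def)

declare Fin_Comp_app(1,3,4) [simp]

lemma Fin_Id_app [simp]: "mfun (Id Fin S) = (\<lambda>a \<in> S. a)" "x \<in> S \<Longrightarrow> mfun (Id Fin S) x = x" "msrc (Id Fin S) = S" "mtgt (Id Fin S) = S"
  by (simp_all add: Fin_def)

lemma fin_map_hom: "finite S \<Longrightarrow> finite T \<Longrightarrow> h \<in> S \<rightarrow> T \<Longrightarrow> fin_map S T h \<in> hom Fin S T"
  by (simp add: hom_Fin_iff fin_map_def)

lemma fin_map_simps [simp]: "x \<in> S \<Longrightarrow> mfun (fin_map S T h) x = h x"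
    "msrc (fin_map S T h) = S" "mtgt (fin_map S T h) = T"
  by (simp_all add: fin_map_def)

lemma Fin_eqI:
  assumes "f \<in> hom Fin S T" "g \<in> hom Fin S T" "\<And>x. x \<in> S \<Longrightarrow> mfun f x = mfun g x"
  shows "f = g"
proof -
  have "mfun f = mfun g"
    using assms by (intro PiE_ext[of _ S "\<lambda>_. T"]) (auto simp: hom_Fin_iff)
  then show ?thesis using assms by (simp add: hom_Fin_iff)
qed

lemma Fin_Comp_hom: "f \<in> hom Fin S T \<Longrightarrow> g \<in> hom Fin T U \<Longrightarrow> g \<cdot>\<^bsub>Fin\<^esub> f \<in> hom Fin S U"
  by (auto simp: hom_Fin_iff Fin_Comp_app(2) compose_def)

lemma Fin_Id_hom: "finite S \<Longrightarrow> Id Fin S \<in> hom Fin S S"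
  by (auto simp: hom_Fin_iff)

lemma category_Fin: "category (Fin :: ('u :: infinite set, 'u set_map) cat)"
proof
  let ?F = "Fin :: ('u set, 'u set_map) cat"
  fix f assume "f \<in> Arr ?F"
  then show "Dom ?F f \<in> Ob ?F" "Cod ?F f \<in> Ob ?F"
    by (simp_all add: Fin_def)
next
  let ?F = "Fin :: ('u set, 'u set_map) cat"
  show "Id ?F S \<in> hom ?F S S" if "S \<in> Ob ?F" for S using that Fin_Id_hom by simp
  show "g \<cdot>\<^bsub>?F\<^esub> f \<in> hom ?F S U" if "f \<in> hom ?F S T" "g \<in> hom ?F T U" for f g S T U
    using Fin_Comp_hom that .
  show "f \<cdot>\<^bsub>?F\<^esub> Id ?F S = f" "Id ?F T \<cdot>\<^bsub>?F\<^esub> f = f" if "f \<in> hom ?F S T" for f S T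
    using that hom_FinD[OF that] by (auto intro!: Fin_eqI[of _ S T] Fin_Comp_hom Fin_Id_hom)
  show "(h \<cdot>\<^bsub>?F\<^esub> g) \<cdot>\<^bsub>?F\<^esub> f = h \<cdot>\<^bsub>?F\<^esub> (g \<cdot>\<^bsub>?F\<^esub> f)"
    if f: "f \<in> hom ?F S T" and g: "g \<in> hom ?F T U" and h: "h \<in> hom ?F U V" for f g h S T U V
    by (rule Fin_eqI[OF Fin_Comp_hom[OF f Fin_Comp_hom[OF g h]] Fin_Comp_hom[OF Fin_Comp_hom[OF f g] h]])
      (use hom_FinD[OF f] hom_FinD[OF g] in simp)
qed

lemma is_iso_Fin:
  assumes f: "f \<in> hom Fin S T"
  shows "is_iso Fin f \<longleftrightarrow> bij_betw (mfun f) S T"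
proof
  assume "is_iso Fin f"
  then obtain g where g: "g \<in> hom Fin T S" "g \<cdot>\<^bsub>Fin\<^esub> f = Id Fin S" "f \<cdot>\<^bsub>Fin\<^esub> g = Id Fin T"
    using hom_FinD[OF f] by (auto simp: is_iso_def)
  have "mfun g (mfun f x) = x" if "x \<in> S" for x
    using that g(2) Fin_Comp_app(1)[of x f g] hom_FinD[OF f] by simp
  moreover have "mfun f (mfun g x) = x" if "x \<in> T" for x
    using that g(3) Fin_Comp_app(1)[of x g f] hom_FinD[OF g(1)] by simp
  ultimately show "bij_betw (mfun f) S T"
    using hom_FinD[OF f] hom_FinD[OF g(1)] by (intro bij_betwI[where g = "mfun g"]) auto
next
  assume b: "bij_betw (mfun f) S T"
  let ?g = "fin_map T S (the_inv_into S (mfun f))"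
  have g: "?g \<in> hom Fin T S"
    using hom_FinD[OF f] bij_betwE[OF bij_betw_the_inv_into[OF b]] by (intro fin_map_hom) auto
  have "?g \<cdot>\<^bsub>Fin\<^esub> f = Id Fin S"
    using hom_FinD[OF f] b
    by (intro Fin_eqI[OF Fin_Comp_hom[OF f g] Fin_Id_hom]) (auto simp: the_inv_into_f_f bij_betw_def)
  moreover have "f \<cdot>\<^bsub>Fin\<^esub> ?g = Id Fin T"
    using hom_FinD[OF f] b
    by (intro Fin_eqI[OF Fin_Comp_hom[OF g f] Fin_Id_hom]) (auto simp: f_the_inv_into_f_bij_betw)
  ultimately show "is_iso Fin f"
    using g homD[OF f] unfolding is_iso_def by (auto intro!: bexI[of _ ?g])
qed

text \<open>Makes every factor of the product that carries the topology of natural transformations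
  compact.\<close>

lemma finite_hom_Fin: "finite (hom Fin S T)"
proof (cases "finite S \<and> finite T")
  case True
  then have "finite ((\<lambda>h. \<lparr>msrc = S, mtgt = T, mfun = h\<rparr>) ` (S \<rightarrow>\<^sub>E T))"
    by (intro finite_imageI finite_PiE) auto
  moreover have "f \<in> (\<lambda>h. \<lparr>msrc = S, mtgt = T, mfun = h\<rparr>) ` (S \<rightarrow>\<^sub>E T)" if "f \<in> hom Fin S T" for f
    using that by (intro image_eqI[of _ _ "mfun f"]) (auto simp: hom_Fin_iff)
  ultimately show ?thesis by (meson finite_subset subsetI)
next
  case False
  then have "hom Fin S T = {}" by (auto simp: hom_Fin_iff)
  then show ?thesis by simp
qed

lemma ex_two_points: obtains a b :: "'u :: infinite" where "a \<noteq> b"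
proof -
  obtain a :: 'u where "a \<in> UNIV" by blast
  have "infinite (UNIV - {a})" using infinite_UNIV by (simp add: infinite_remove)
  then obtain b where "b \<in> UNIV - {a}" using infinite_imp_nonempty by blast
  then show ?thesis using that by auto
qed

text \<open>A constant map and the indicator of U, both into a two-point set, agree on U; if they
  must coincide, no point of S lies outside U. Infinitude of the type supplies the two points. The
  lemma extracts surjectivity from the uniqueness clauses of coequalisers and of coproducts.\<close>

lemma Fin_jointly_epic_imp_cover:
  fixes S :: "'u :: infinite set"
  assumes "finite S" "U \<subseteq> S"
    "\<And>T h k. h \<in> hom Fin S T \<Longrightarrow> k \<in> hom Fin S T \<Longrightarrow> (\<And>x. x \<in> U \<Longrightarrow> mfun h x = mfun k x) \<Longrightarrow> h = k"
  shows "U = S"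
proof -
  obtain a b :: 'u where ab: "a \<noteq> b" by (rule ex_two_points)
  let ?h = "fin_map S {a, b} (\<lambda>_. a)"
  let ?k = "fin_map S {a, b} (\<lambda>x. if x \<in> U then a else b)"
  have "?h = ?k"
    using assms(1,2) by (intro assms(3)[where T = "{a, b}"] fin_map_hom) auto
  then have "mfun ?h x = mfun ?k x" for x by (rule arg_cong)
  then have U: "a = (if x \<in> U then a else b)" if "x \<in> S" for x
    using that fin_map_simps(1)[OF that, of "{a, b}" "\<lambda>_. a"]
      fin_map_simps(1)[OF that, of "{a, b}" "\<lambda>x. if x \<in> U then a else b"] by presburger
  have "x \<in> U" if "x \<in> S" for x
    using U[OF that] ab by (simp split: if_splits)
  then show ?thesis using assms(2) by blast
qed

text \<open>Elements are maps out of a one-point set, so the universal property tested on that set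
  is the usual description of a fibre product by pairs.\<close>

lemma Fin_pullbackD:
  fixes f :: "'u :: infinite set_map"
  assumes pb: "is_pullback Fin f g p q" and "a \<in> msrc f" "b \<in> msrc g" "mfun f a = mfun g b"
  shows "\<exists>!c. c \<in> msrc p \<and> mfun p c = a \<and> mfun q c = b"
proof -
  have h: "f \<in> Arr Fin" "g \<in> Arr Fin" "mtgt f = mtgt g" "p \<in> Arr Fin" "q \<in> Arr Fin"
    "msrc p = msrc q" "mtgt p = msrc f" "mtgt q = msrc g"
    using pb by (simp_all add: is_pullback_def)
  have U: "\<exists>!h. h \<in> hom Fin T (msrc p) \<and> p \<cdot>\<^bsub>Fin\<^esub> h = u \<and> q \<cdot>\<^bsub>Fin\<^esub> h = v"
    if "u \<in> hom Fin T (msrc f)" "v \<in> hom Fin T (msrc g)" "f \<cdot>\<^bsub>Fin\<^esub> u = g \<cdot>\<^bsub>Fin\<^esub> v" for u v T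
    using pb that unfolding is_pullback_def Fin_simps by blast
  \<comment> \<open>Any point will do: \<open>{e}\<close> is the one-point set on which elements are
    represented.\<close>
  obtain e :: 'u where True by blast
  let ?p = "\<lambda>A x. fin_map {e} A (\<lambda>_. x)"
  have pt: "?p A x \<in> hom Fin {e} A" if "x \<in> A" "finite A" for x and A :: "'u set"
    using that by (intro fin_map_hom) auto
  have fh: "f \<in> hom Fin (msrc f) (mtgt f)" "g \<in> hom Fin (msrc g) (mtgt f)"
    "p \<in> hom Fin (msrc p) (msrc f)" "q \<in> hom Fin (msrc p) (msrc g)" using h by (auto simp: hom_def)
  note fin = hom_FinD(1,2)[OF fh(1)] hom_FinD(1,2)[OF fh(2)] hom_FinD(1,2)[OF fh(3)]
  have pa: "?p (msrc f) a \<in> hom Fin {e} (msrc f)" and pb': "?p (msrc g) b \<in> hom Fin {e} (msrc g)"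
    using assms fin by (auto intro!: pt)
  have "f \<cdot>\<^bsub>Fin\<^esub> ?p (msrc f) a = g \<cdot>\<^bsub>Fin\<^esub> ?p (msrc g) b"
    by (rule Fin_eqI[OF Fin_Comp_hom[OF pa fh(1)] Fin_Comp_hom[OF pb' fh(2)]]) (use assms in auto)
  note ex1 = U[OF pa pb' this]
  then obtain k where k: "k \<in> hom Fin {e} (msrc p)" "p \<cdot>\<^bsub>Fin\<^esub> k = ?p (msrc f) a" "q \<cdot>\<^bsub>Fin\<^esub> k = ?p (msrc g) b"
    by blast
  have me: "e \<in> msrc k" using hom_FinD(3)[OF k(1)] by simp
  show ?thesis
  proof (rule ex1I[of _ "mfun k e"])
    show "mfun k e \<in> msrc p \<and> mfun p (mfun k e) = a \<and> mfun q (mfun k e) = b"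
      using hom_FinD(5)[OF k(1), of e] Fin_Comp_app(1)[OF me, of p] Fin_Comp_app(1)[OF me, of q] k by simp
    fix c assume c: "c \<in> msrc p \<and> mfun p c = a \<and> mfun q c = b"
    then have pc: "?p (msrc p) c \<in> hom Fin {e} (msrc p)" using fin by (intro pt) auto
    have "p \<cdot>\<^bsub>Fin\<^esub> ?p (msrc p) c = ?p (msrc f) a"
      by (rule Fin_eqI[OF Fin_Comp_hom[OF pc fh(3)] pa]) (use c in auto)
    moreover have "q \<cdot>\<^bsub>Fin\<^esub> ?p (msrc p) c = ?p (msrc g) b"
      by (rule Fin_eqI[OF Fin_Comp_hom[OF pc fh(4)] pb']) (use c in auto)
    ultimately have "k = ?p (msrc p) c" using ex1 k pc by blast
    then show "c = mfun k e" by simp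
  qed
qed

section \<open>Functors to finite sets and their transformations on elements\<close>

lemma fin_functorD:
  assumes "is_functor C Fin G"
  shows "A \<in> Ob C \<Longrightarrow> finite (fob G A)"
    "f \<in> hom C A B \<Longrightarrow> x \<in> fob G A \<Longrightarrow> mfun (far G f) x \<in> fob G B"
    "f \<in> hom C A B \<Longrightarrow> g \<in> hom C B D \<Longrightarrow> x \<in> fob G A \<Longrightarrow>
      mfun (far G (g \<cdot>\<^bsub>C\<^esub> f)) x = mfun (far G g) (mfun (far G f) x)"
    "A \<in> Ob C \<Longrightarrow> x \<in> fob G A \<Longrightarrow> mfun (far G (Id C A)) x = x"
proof -
  note G = is_functorD[OF assms]
  show "A \<in> Ob C \<Longrightarrow> finite (fob G A)" using G(3)[of A] by simp
  show "f \<in> hom C A B \<Longrightarrow> x \<in> fob G A \<Longrightarrow> mfun (far G f) x \<in> fob G B"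
    using hom_FinD(5)[OF G(4)] .
  show "A \<in> Ob C \<Longrightarrow> x \<in> fob G A \<Longrightarrow> mfun (far G (Id C A)) x = x"
    using G(5)[of A] by simp
  assume f: "f \<in> hom C A B" "g \<in> hom C B D" and x: "x \<in> fob G A"
  have "x \<in> msrc (far G f)" using hom_FinD(3)[OF G(4)[OF f(1)]] x by simp
  then show "mfun (far G (g \<cdot>\<^bsub>C\<^esub> f)) x = mfun (far G g) (mfun (far G f) x)"
    using G(6)[OF f] by simp
qed

lemma fin_ntransD:
  assumes "is_ntrans C Fin \<eta>"
  shows "A \<in> Ob C \<Longrightarrow> x \<in> fob (nsrc \<eta>) A \<Longrightarrow> mfun (ncmp \<eta> A) x \<in> fob (ntgt \<eta>) A"
    "f \<in> hom C A B \<Longrightarrow> x \<in> fob (nsrc \<eta>) A \<Longrightarrow>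
      mfun (ncmp \<eta> B) (mfun (far (nsrc \<eta>) f) x) = mfun (far (ntgt \<eta>) f) (mfun (ncmp \<eta> A) x)"
proof -
  note \<eta> = is_ntransD[OF assms]
  interpret category C using is_functorD(1)[OF \<eta>(1)] .
  show "A \<in> Ob C \<Longrightarrow> x \<in> fob (nsrc \<eta>) A \<Longrightarrow> mfun (ncmp \<eta> A) x \<in> fob (ntgt \<eta>) A"
    using hom_FinD(5)[OF \<eta>(3)] .
  assume f: "f \<in> hom C A B" and x: "x \<in> fob (nsrc \<eta>) A"
  then have "A \<in> Ob C" using hom_Ob by blast
  then have "x \<in> msrc (ncmp \<eta> A)" "x \<in> msrc (far (nsrc \<eta>) f)"
    using x hom_FinD(3)[OF \<eta>(3)] hom_FinD(3)[OF is_functorD(4)[OF \<eta>(1) f]] by auto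
  then show "mfun (ncmp \<eta> B) (mfun (far (nsrc \<eta>) f) x) = mfun (far (ntgt \<eta>) f) (mfun (ncmp \<eta> A) x)"
    using \<eta>(4)[OF f] Fin_Comp_app(1) by metis
qed

lemma fin_ntransI:
  assumes "is_functor C Fin G" "is_functor C Fin H"
    "\<And>A x. A \<in> Ob C \<Longrightarrow> x \<in> fob G A \<Longrightarrow> \<tau> A x \<in> fob H A"
    "\<And>A B f x. f \<in> hom C A B \<Longrightarrow> x \<in> fob G A \<Longrightarrow>
      \<tau> B (mfun (far G f) x) = mfun (far H f) (\<tau> A x)"
  shows "is_ntrans C Fin \<lparr>nsrc = G, ntgt = H, ncmp = (\<lambda>A \<in> Ob C. fin_map (fob G A) (fob H A) (\<tau> A))\<rparr>"
proof (rule ntransI[OF assms(1,2)])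
  interpret category C using is_functorD(1)[OF assms(1)] .
  show th: "fin_map (fob G A) (fob H A) (\<tau> A) \<in> hom Fin (fob G A) (fob H A)" if "A \<in> Ob C" for A
    using that assms fin_functorD(1) by (intro fin_map_hom) auto
  fix f A B assume f: "f \<in> hom C A B"
  then have AB: "A \<in> Ob C" "B \<in> Ob C" using hom_Ob by auto
  note G = is_functorD(4)[OF assms(1) f] and H = is_functorD(4)[OF assms(2) f]
  show "fin_map (fob G B) (fob H B) (\<tau> B) \<cdot>\<^bsub>Fin\<^esub> far G f = far H f \<cdot>\<^bsub>Fin\<^esub> fin_map (fob G A) (fob H A) (\<tau> A)"
    by (rule Fin_eqI[OF Fin_Comp_hom[OF G th[OF AB(2)]] Fin_Comp_hom[OF th[OF AB(1)] H]])
      (use assms(4)[OF f] hom_FinD[OF G] in simp)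
qed

section \<open>Terminal objects and pullbacks as finite limits\<close>

definition empty_cat :: "(nat, nat) cat" where
  "empty_cat = \<lparr>Ob = {}, Arr = {}, Dom = id, Cod = id, Id = id, Comp = (\<lambda>g f. f)\<rparr>"

lemma finite_category_empty: "finite_category empty_cat"
  by (auto simp: finite_category_def empty_cat_def category_def hom_def)

lemma is_limit_empty:
  "is_limit C empty_cat X l p \<longleftrightarrow> l \<in> Ob C \<and> (\<forall>t \<in> Ob C. \<exists>!h. h \<in> hom C t l)"
  by (auto simp: is_limit_def is_cone_def empty_cat_def)

text \<open>The arrows 3 and 4 are the legs of the cospan; the others are identities.\<close>

definition cospan_cat :: "(nat, nat) cat" where
  "cospan_cat = \<lparr>Ob = {0, 1, 2}, Arr = {0, 1, 2, 3, 4},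
     Dom = (\<lambda>u. if u = 3 then 0 else if u = 4 then 1 else u),
     Cod = (\<lambda>u. if 3 \<le> u then 2 else u), Id = id, Comp = (\<lambda>g f. if g < 3 then f else g)\<rparr>"

text \<open>Identities of \<open>cospan_cat\<close> carry the number of their object, so for an
  arrow u other than 3 and 4 the expression \<open>X u\<close> is the object assigned to its source
  and target.\<close>

definition cospan :: "('o, 'a, 'm) cat_scheme \<Rightarrow> 'a \<Rightarrow> 'a \<Rightarrow> (nat, nat, 'o, 'a) ftor" where
  "cospan C f g = (let X = (\<lambda>x. if x = 0 then Dom C f else if x = 1 then Dom C g else Cod C f) in
     \<lparr>fob = restrict X (Ob cospan_cat),
      far = (\<lambda>u \<in> Arr cospan_cat. if u = 3 then f else if u = 4 then g else Id C (X u))\<rparr>)"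

lemma hom_cospan: "u \<in> hom cospan_cat x y \<longleftrightarrow>
    u = x \<and> x = y \<and> x \<in> {0, 1, 2} \<or> u = 3 \<and> x = 0 \<and> y = 2 \<or> u = 4 \<and> x = 1 \<and> y = 2"
  unfolding hom_def cospan_cat_def cat.simps by (simp; fastforce)

lemma cospan_simps [simp]: "Id cospan_cat = id" "v \<cdot>\<^bsub>cospan_cat\<^esub> u = (if v < 3 then u else v)"
  by (simp_all add: cospan_cat_def)

lemma category_cospan: "category cospan_cat"
proof
  show "v \<cdot>\<^bsub>cospan_cat\<^esub> u \<in> hom cospan_cat x z" if "u \<in> hom cospan_cat x y" "v \<in> hom cospan_cat y z" for u v x y z
    using that unfolding hom_cospan by auto
  show "(w \<cdot>\<^bsub>cospan_cat\<^esub> v) \<cdot>\<^bsub>cospan_cat\<^esub> u = w \<cdot>\<^bsub>cospan_cat\<^esub> (v \<cdot>\<^bsub>cospan_cat\<^esub> u)"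
    if "u \<in> hom cospan_cat x y" "v \<in> hom cospan_cat y z" "w \<in> hom cospan_cat z t" for u v w x y z t
    using that unfolding hom_cospan by auto
  show "Dom cospan_cat u \<in> Ob cospan_cat" "Cod cospan_cat u \<in> Ob cospan_cat" if "u \<in> Arr cospan_cat" for u
    using that by (auto simp: cospan_cat_def)
  show "Id cospan_cat x \<in> hom cospan_cat x x" if "x \<in> Ob cospan_cat" for x
    using that unfolding hom_cospan by (simp add: cospan_cat_def)
  show "u \<cdot>\<^bsub>cospan_cat\<^esub> Id cospan_cat x = u" "Id cospan_cat y \<cdot>\<^bsub>cospan_cat\<^esub> u = u"
    if "u \<in> hom cospan_cat x y" for u x y
    using that unfolding hom_cospan by auto
qed

lemma is_functor_cospan:
  assumes "category C" "f \<in> Arr C" "g \<in> Arr C" "Cod C f = Cod C g"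
  shows "is_functor cospan_cat C (cospan C f g)"
proof -
  interpret category C by fact
  let ?X = "\<lambda>x::nat. if x = 0 then Dom C f else if x = 1 then Dom C g else Cod C f"
  let ?Y = "\<lambda>u::nat. if u = 3 then f else if u = 4 then g else Id C (?X u)"
  have ob: "?X x \<in> Ob C" for x using assms dom_in_Ob cod_in_Ob by auto
  have fg: "f \<in> hom C (Dom C f) (Cod C f)" "g \<in> hom C (Dom C g) (Cod C f)"
    using assms by (auto simp: hom_def)
  show ?thesis
    unfolding cospan_def Let_def
  proof (rule functorI[OF category_cospan \<open>category C\<close> ob])
    show "?Y u \<in> hom C (?X x) (?X y)" if "u \<in> hom cospan_cat x y" for u x y
      using that fg Id_in_hom ob[of 0] ob[of 1] ob[of 2]
      by (auto simp: hom_cospan)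
    show "?Y (Id cospan_cat x) = Id C (?X x)" if "x \<in> Ob cospan_cat" for x
      using that by (auto simp: cospan_cat_def)
    show "?Y (v \<cdot>\<^bsub>cospan_cat\<^esub> u) = ?Y v \<cdot>\<^bsub>C\<^esub> ?Y u" if "u \<in> hom cospan_cat x y" "v \<in> hom cospan_cat y z" for u v x y z
    proof -
      note e = Comp_Id[OF fg(1)] Comp_Id[OF fg(2)] Id_Comp[OF fg(1)] Id_Comp[OF fg(2)]
        Comp_Id[OF Id_in_hom, OF dom_in_Ob[OF assms(2)]] Comp_Id[OF Id_in_hom, OF dom_in_Ob[OF assms(3)]]
        Comp_Id[OF Id_in_hom, OF cod_in_Ob[OF assms(2)]]
      show ?thesis
        using that unfolding hom_cospan by (elim disjE conjE; simp add: e; elim disjE; simp add: e)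
    qed
  qed
qed

lemma is_cone_cospan:
  assumes "category C" "f \<in> Arr C" "g \<in> Arr C" "Cod C f = Cod C g"
  shows "is_cone C cospan_cat (cospan C f g) t q \<longleftrightarrow> q 0 \<in> hom C t (Dom C f) \<and> q 1 \<in> hom C t (Dom C g)
    \<and> q 2 = f \<cdot>\<^bsub>C\<^esub> q 0 \<and> f \<cdot>\<^bsub>C\<^esub> q 0 = g \<cdot>\<^bsub>C\<^esub> q 1"
proof -
  interpret category C by fact
  have fg: "f \<in> hom C (Dom C f) (Cod C f)" "g \<in> hom C (Dom C g) (Cod C f)"
    using assms by (auto simp: hom_def)
  show ?thesis
    using Id_Comp[of "q _" t] Id_Comp[OF Comp_in_hom[OF _ fg(1)], of "q 0" t] Comp_in_hom[OF _ fg(1), of "q 0" t] hom_Ob[of "q 0" t]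
    by (auto simp: is_cone_def cospan_def cospan_cat_def Let_def)
qed

text \<open>A cone has a third leg, to the common codomain, which is forced to be f composed with
  the leg at 0. Apart from the equation for \<open>p 2\<close>, cones are therefore the commuting
  squares in the definition of a pullback, and \<open>A\<close> matches the two mediating
  conditions.\<close>

lemma is_limit_cospan:
  assumes "category C" "f \<in> Arr C" "g \<in> Arr C" "Cod C f = Cod C g"
  shows "is_limit C cospan_cat (cospan C f g) l p \<longleftrightarrow>
    is_pullback C f g (p 0) (p 1) \<and> Dom C (p 0) = l \<and> p 2 = f \<cdot>\<^bsub>C\<^esub> p 0"
proof -
  interpret category C by fact
  note cone = is_cone_cospan[OF assms]
  have fg: "f \<in> hom C (Dom C f) (Cod C f)" "g \<in> hom C (Dom C g) (Cod C f)"
    using assms by (auto simp: hom_def)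
  have A: "(h \<in> hom C t l \<and> (\<forall>j \<in> Ob cospan_cat. p j \<cdot>\<^bsub>C\<^esub> h = q j)) \<longleftrightarrow>
      (h \<in> hom C t l \<and> p 0 \<cdot>\<^bsub>C\<^esub> h = q 0 \<and> p 1 \<cdot>\<^bsub>C\<^esub> h = q 1)"
    if "p 0 \<in> hom C l (Dom C f)" "p 2 = f \<cdot>\<^bsub>C\<^esub> p 0" "q 2 = f \<cdot>\<^bsub>C\<^esub> q 0" for t h and q :: "nat \<Rightarrow> _"
    using that Comp_assoc[OF _ that(1) fg(1)] by (auto simp: cospan_cat_def)
  show ?thesis
  proof
    assume lim: "is_limit C cospan_cat (cospan C f g) l p"
    then have p: "p 0 \<in> hom C l (Dom C f)" "p 1 \<in> hom C l (Dom C g)" "p 2 = f \<cdot>\<^bsub>C\<^esub> p 0" "f \<cdot>\<^bsub>C\<^esub> p 0 = g \<cdot>\<^bsub>C\<^esub> p 1"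
      by (auto simp: is_limit_def cone)
    have "\<exists>!h. h \<in> hom C t l \<and> p 0 \<cdot>\<^bsub>C\<^esub> h = a \<and> p 1 \<cdot>\<^bsub>C\<^esub> h = b"
      if "a \<in> hom C t (Dom C f)" "b \<in> hom C t (Dom C g)" "f \<cdot>\<^bsub>C\<^esub> a = g \<cdot>\<^bsub>C\<^esub> b" for t a b
    proof -
      let ?q = "\<lambda>j::nat. if j = 0 then a else if j = 1 then b else f \<cdot>\<^bsub>C\<^esub> a"
      have "is_cone C cospan_cat (cospan C f g) t ?q" using that by (simp add: cone)
      then have "\<exists>!h. h \<in> hom C t l \<and> (\<forall>j \<in> Ob cospan_cat. p j \<cdot>\<^bsub>C\<^esub> h = ?q j)"
        using lim unfolding is_limit_def by blast
      then show ?thesis by (simp add: A[OF p(1,3)])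
    qed
    then show "is_pullback C f g (p 0) (p 1) \<and> Dom C (p 0) = l \<and> p 2 = f \<cdot>\<^bsub>C\<^esub> p 0"
      using assms p homD[OF p(1)] homD[OF p(2)] by (simp add: is_pullback_def)
  next
    assume pb: "is_pullback C f g (p 0) (p 1) \<and> Dom C (p 0) = l \<and> p 2 = f \<cdot>\<^bsub>C\<^esub> p 0"
    then have p: "p 0 \<in> hom C l (Dom C f)" "p 1 \<in> hom C l (Dom C g)" "p 2 = f \<cdot>\<^bsub>C\<^esub> p 0" "f \<cdot>\<^bsub>C\<^esub> p 0 = g \<cdot>\<^bsub>C\<^esub> p 1"
      by (auto simp: is_pullback_def hom_def)
    have "\<exists>!h. h \<in> hom C t l \<and> (\<forall>j \<in> Ob cospan_cat. p j \<cdot>\<^bsub>C\<^esub> h = q j)"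
      if "is_cone C cospan_cat (cospan C f g) t q" for t q
    proof -
      have q: "q 0 \<in> hom C t (Dom C f)" "q 1 \<in> hom C t (Dom C g)" "q 2 = f \<cdot>\<^bsub>C\<^esub> q 0" "f \<cdot>\<^bsub>C\<^esub> q 0 = g \<cdot>\<^bsub>C\<^esub> q 1"
        using that by (auto simp: cone)
      then have "\<exists>!h. h \<in> hom C t l \<and> p 0 \<cdot>\<^bsub>C\<^esub> h = q 0 \<and> p 1 \<cdot>\<^bsub>C\<^esub> h = q 1"
        using pb unfolding is_pullback_def by blast
      then show ?thesis unfolding A[OF p(1,3) q(3)] .
    qed
    then show "is_limit C cospan_cat (cospan C f g) l p"
      unfolding is_limit_def cone using p by blast
  qed
qed

lemma finite_category_cospan: "finite_category cospan_cat"
  unfolding finite_category_def using category_cospan by (auto simp: cospan_cat_def)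

lemma has_pullbacks:
  assumes "category C" "has_finite_limits C" "f \<in> Arr C" "g \<in> Arr C" "Cod C f = Cod C g"
  obtains p q where "is_pullback C f g p q"
proof -
  obtain l p where "is_limit C cospan_cat (cospan C f g) l p"
    using assms(2) is_functor_cospan[OF assms(1,3-)] finite_category_cospan
    unfolding has_finite_limits_def by blast
  then show ?thesis using that unfolding is_limit_cospan[OF assms(1,3-)] by blast
qed

lemma preserves_pullback:
  assumes F: "is_functor C D F" "preserves_finite_limits C D F" and pb: "is_pullback C f g p q"
  shows "is_pullback D (far F f) (far F g) (far F p) (far F q)"
proof -
  note CD = is_functorD(1,2)[OF F(1)]
  interpret category C using CD by blast
  have fg: "f \<in> Arr C" "g \<in> Arr C" "Cod C f = Cod C g" using pb by (simp_all add: is_pullback_def)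
  have h: "f \<in> hom C (Dom C f) (Cod C f)" "g \<in> hom C (Dom C g) (Cod C f)" using fg by (auto simp: hom_def)
  note Fh = is_functorD(4)[OF F(1) h(1)] is_functorD(4)[OF F(1) h(2)]
  have Ffg: "far F f \<in> Arr D" "far F g \<in> Arr D" "Cod D (far F f) = Cod D (far F g)"
    using Fh by (auto simp: hom_def)
  let ?p = "\<lambda>j::nat. if j = 0 then p else if j = 1 then q else f \<cdot>\<^bsub>C\<^esub> p"
  have "is_limit C cospan_cat (cospan C f g) (Dom C p) ?p"
    using pb by (simp add: is_limit_cospan[OF CD(1) fg])
  then have "is_limit D cospan_cat (comp_functor cospan_cat F (cospan C f g)) (fob F (Dom C p)) (\<lambda>j. far F (?p j))"
    using F(2) finite_category_cospan is_functor_cospan[OF CD(1) fg] unfolding preserves_finite_limits_def by blast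
  \<comment> \<open>Functors are extensional, so agreement on the three objects and five arrows of
    the cospan makes the image diagram literally the cospan of the images.\<close>
  moreover have "comp_functor cospan_cat F (cospan C f g) = cospan D (far F f) (far F g)"
    using homD[OF Fh(1)] homD[OF Fh(2)] is_functorD(5)[OF F(1)] dom_in_Ob cod_in_Ob fg
    by (intro functor_eqI[OF is_functor_comp[OF is_functor_cospan[OF CD(1) fg] F(1)] is_functor_cospan[OF CD(2) Ffg]])
      (auto simp: comp_functor_def compose_def cospan_def cospan_cat_def Let_def)
  ultimately show ?thesis by (simp add: is_limit_cospan[OF CD(2) Ffg])
qed

section \<open>Pretopoi with enough finite fibres\<close>

abbreviation act :: "('o, 'a, 'u) fin_ftor \<Rightarrow> 'a \<Rightarrow> 'u \<Rightarrow> 'u" where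
  "act G f \<equiv> mfun (far G f)"

text \<open>The family is taken as a set of functors rather than an indexed one, since the objects
  of the fundamental category are the functors themselves and repeated members contribute nothing
  new.\<close>

locale fibre_family = pretopos C
  for C :: "('o, 'a, 'm) cat_scheme" (structure) +
  fixes \<Phi> :: "('o, 'a, 'u :: infinite) fin_ftor set"
  assumes finite_family: "finite \<Phi>"
    and fibre: "G \<in> \<Phi> \<Longrightarrow> fibre_functor C G"
    and conservative: "f \<in> Arr C \<Longrightarrow> (\<And>G. G \<in> \<Phi> \<Longrightarrow> is_iso Fin (far G f)) \<Longrightarrow> is_iso C f"
begin

lemma fibreD:
  assumes "G \<in> \<Phi>"
  shows "is_functor C Fin G" "preserves_finite_limits C Fin G" "preserves_finite_coproducts C Fin G"
    "is_effective_epi C f \<Longrightarrow> is_effective_epi Fin (far G f)"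
  using fibre[OF assms] by (simp_all add: fibre_functor_def pretopos_morphism_def)

lemmas finite_fibre = fin_functorD(1)[OF fibreD(1)]
  and act_in = fin_functorD(2)[OF fibreD(1)]
  and act_Comp = fin_functorD(3)[OF fibreD(1)]
  and act_Id = fin_functorD(4)[OF fibreD(1)]

lemma iso_if_bij:
  assumes f: "f \<in> hom C A B" and bij: "\<And>G. G \<in> \<Phi> \<Longrightarrow> bij_betw (act G f) (fob G A) (fob G B)"
  obtains g where "g \<in> hom C B A" "g \<cdot> f = Id C A" "f \<cdot> g = Id C B"
proof -
  have "is_iso Fin (far G f)" if "G \<in> \<Phi>" for G
    using bij[OF that] is_iso_Fin[OF is_functorD(4)[OF fibreD(1)[OF that] f]] by simp
  then have "is_iso C f" using conservative homD[OF f] by blast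
  then show ?thesis using homD[OF f] that by (auto simp: is_iso_def)
qed

section \<open>Finite limits read on fibres, and arrows detected by fibres\<close>

lemma terminal_object:
  obtains T where "T \<in> Ob C" "\<And>A. A \<in> Ob C \<Longrightarrow> \<exists>h. h \<in> hom C A T"
    "\<And>A h k. h \<in> hom C A T \<Longrightarrow> k \<in> hom C A T \<Longrightarrow> h = k"
    "\<And>G. G \<in> \<Phi> \<Longrightarrow> \<exists>t. fob G T = {t}"
proof -
  \<comment> \<open>The empty diagram, whose limit is a terminal object; the values
    \<open>undefined\<close> only make it extensional.\<close>
  let ?X = "\<lparr>fob = restrict (\<lambda>_. undefined) (Ob empty_cat), far = restrict (\<lambda>_. undefined) (Arr empty_cat)\<rparr>
    :: (nat, nat, 'o, 'a) ftor"
  have X: "is_functor empty_cat C ?X"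
    using finite_category_empty
    by (intro functorI category_axioms) (auto simp: finite_category_def empty_cat_def hom_def)
  then obtain T p where T: "is_limit C empty_cat ?X T p"
    using finite_limits finite_category_empty unfolding has_finite_limits_def by blast
  have T1: "T \<in> Ob C" and TU: "\<And>A. A \<in> Ob C \<Longrightarrow> \<exists>!h. h \<in> hom C A T"
    using T unfolding is_limit_empty by auto
  show ?thesis
  proof (rule that[OF T1])
    show "\<exists>h. h \<in> hom C A T" if "A \<in> Ob C" for A using TU[OF that] by blast
    show "h = k" if "h \<in> hom C A T" "k \<in> hom C A T" for A h k
      using TU[of A] hom_Ob[OF that(1)] that by blast
    fix G assume G: "G \<in> \<Phi>"
    have "is_limit Fin empty_cat (comp_functor empty_cat G ?X) (fob G T) (\<lambda>j. far G (p j))"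
      using fibreD(2)[OF G] X T finite_category_empty unfolding preserves_finite_limits_def by blast
    then have S: "\<exists>!h. h \<in> hom Fin S (fob G T)" if "finite S" for S
      using that unfolding is_limit_empty by simp
    obtain e :: 'u where True by blast
    obtain h where h: "h \<in> hom Fin {e} (fob G T)" using S[of "{e}"] by auto
    \<comment> \<open>Each element of the fibre is the value of a map from the one-point set, and
      there is only one such map because the fibre is terminal in \<open>Fin\<close>.\<close>
    have "y = mfun h e" if "y \<in> fob G T" for y
    proof -
      have "fin_map {e} (fob G T) (\<lambda>_. y) \<in> hom Fin {e} (fob G T)"
        using that finite_fibre[OF G T1] by (intro fin_map_hom) auto
      then have "fin_map {e} (fob G T) (\<lambda>_. y) = h" using S[of "{e}"] h by blast
      then show ?thesis using fin_map_simps(1)[of e "{e}" "fob G T" "\<lambda>_. y"] by simp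
    qed
    then show "\<exists>t. fob G T = {t}" using hom_FinD(5)[OF h, of e] by auto
  qed
qed

lemma pullback_fibre:
  assumes "is_pullback C f g p q" "G \<in> \<Phi>" "x \<in> fob G (Dom C f)" "y \<in> fob G (Dom C g)" "act G f x = act G g y"
  shows "\<exists>!z. z \<in> fob G (Dom C p) \<and> act G p z = x \<and> act G q z = y"
proof -
  have "is_pullback Fin (far G f) (far G g) (far G p) (far G q)"
    using preserves_pullback[OF fibreD(1,2)] assms(1,2) by blast
  moreover have "msrc (far G k) = fob G (Dom C k)" if "k \<in> Arr C" for k
    using hom_FinD(3)[OF is_functorD(4)[OF fibreD(1)[OF assms(2)] hom_self[OF that]]] .
  then have "msrc (far G f) = fob G (Dom C f)" "msrc (far G g) = fob G (Dom C g)"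
     "msrc (far G p) = fob G (Dom C p)"
    using assms(1) by (simp_all add: is_pullback_def)
  ultimately show ?thesis using Fin_pullbackD[of "far G f" "far G g" "far G p" "far G q" x y] assms by simp
qed

lemma pullback_homs:
  assumes "is_pullback C f g p q" "f \<in> hom C A Z" "g \<in> hom C B Z"
  shows "p \<in> hom C (Dom C p) A" "q \<in> hom C (Dom C p) B" "f \<cdot> p = g \<cdot> q"
  using assms by (auto simp: is_pullback_def hom_def)

text \<open>The product is the pullback over the terminal object: any two arrows to it agree, and on
  fibres the compatibility condition holds because the fibre of the terminal object is a point. The
  last two clauses say that fibres turn this product into the product of sets.\<close>

lemma binary_product:
  assumes "A \<in> Ob C" "B \<in> Ob C"
  obtains P p q where "p \<in> hom C P A" "q \<in> hom C P B"
    "\<And>T a b. a \<in> hom C T A \<Longrightarrow> b \<in> hom C T B \<Longrightarrow> \<exists>h. h \<in> hom C T P \<and> p \<cdot> h = a \<and> q \<cdot> h = b"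
    "\<And>G x y. G \<in> \<Phi> \<Longrightarrow> x \<in> fob G A \<Longrightarrow> y \<in> fob G B \<Longrightarrow> \<exists>z. z \<in> fob G P \<and> act G p z = x \<and> act G q z = y"
    "\<And>G z w. G \<in> \<Phi> \<Longrightarrow> z \<in> fob G P \<Longrightarrow> w \<in> fob G P \<Longrightarrow> act G p z = act G p w \<Longrightarrow> act G q z = act G q w \<Longrightarrow> z = w"
proof -
  obtain T where T: "T \<in> Ob C" "\<And>A. A \<in> Ob C \<Longrightarrow> \<exists>h. h \<in> hom C A T"
    "\<And>A h k. h \<in> hom C A T \<Longrightarrow> k \<in> hom C A T \<Longrightarrow> h = k" "\<And>G. G \<in> \<Phi> \<Longrightarrow> \<exists>t. fob G T = {t}"
    by (rule terminal_object) blast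
  obtain f g where f: "f \<in> hom C A T" and g: "g \<in> hom C B T" using T(2) assms by blast
  obtain p q where pb: "is_pullback C f g p q"
    using has_pullbacks[OF category_axioms finite_limits, of f g] homD[OF f] homD[OF g] by auto
  note h = pullback_homs[OF pb f g]
  have eq: "act G f x = act G g y" if "G \<in> \<Phi>" "x \<in> fob G A" "y \<in> fob G B" for G x y
    using act_in[OF that(1) f that(2)] act_in[OF that(1) g that(3)] T(4)[OF that(1)] by auto
  show ?thesis
  proof (rule that[OF h(1,2)])
    show "\<exists>h. h \<in> hom C U (Dom C p) \<and> p \<cdot> h = a \<and> q \<cdot> h = b" if "a \<in> hom C U A" "b \<in> hom C U B" for U a b
    proof -
      have "f \<cdot> a = g \<cdot> b" using T(3) Comp_in_hom f g that by meson
      then show ?thesis using pb that homD[OF f] homD[OF g] unfolding is_pullback_def by blast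
    qed
    show "\<exists>z. z \<in> fob G (Dom C p) \<and> act G p z = x \<and> act G q z = y"
      if "G \<in> \<Phi>" "x \<in> fob G A" "y \<in> fob G B" for G x y
      using pullback_fibre[OF pb that(1)] eq[OF that] that homD[OF f] homD[OF g] by blast
    show "z = w" if "G \<in> \<Phi>" "z \<in> fob G (Dom C p)" "w \<in> fob G (Dom C p)" "act G p z = act G p w" "act G q z = act G q w"
      for G z w
    proof -
      have "act G p w \<in> fob G A" "act G q w \<in> fob G B"
        using act_in[OF that(1) h(1) that(3)] act_in[OF that(1) h(2) that(3)] by auto
      then have "\<exists>!v. v \<in> fob G (Dom C p) \<and> act G p v = act G p w \<and> act G q v = act G q w"
        using pullback_fibre[OF pb that(1), of "act G p w" "act G q w"] eq[OF that(1)]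
          homD(2)[OF f] homD(2)[OF g] by blast
      then show ?thesis using that by blast
    qed
  qed
qed

text \<open>The equaliser is the pullback of the two graphs (1, g) and (1, h) from A to the product
  of A and B. On fibres it consists of the points where both graphs agree.\<close>

lemma equaliser:
  assumes g: "g \<in> hom C A B" and h: "h \<in> hom C A B"
  obtains E e where "e \<in> hom C E A" "g \<cdot> e = h \<cdot> e" "\<And>G. G \<in> \<Phi> \<Longrightarrow> inj_on (act G e) (fob G E)"
    "\<And>G x. G \<in> \<Phi> \<Longrightarrow> x \<in> fob G A \<Longrightarrow> act G g x = act G h x \<Longrightarrow> \<exists>z \<in> fob G E. act G e z = x"
proof -
  have ob: "A \<in> Ob C" "B \<in> Ob C" using hom_Ob[OF g] by auto
  obtain P p q where p: "p \<in> hom C P A" and q: "q \<in> hom C P B"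
    and pair: "\<And>T a b. a \<in> hom C T A \<Longrightarrow> b \<in> hom C T B \<Longrightarrow> \<exists>h. h \<in> hom C T P \<and> p \<cdot> h = a \<and> q \<cdot> h = b"
    and uniq: "\<And>G z w. G \<in> \<Phi> \<Longrightarrow> z \<in> fob G P \<Longrightarrow> w \<in> fob G P \<Longrightarrow> act G p z = act G p w \<Longrightarrow> act G q z = act G q w \<Longrightarrow> z = w"
    by (rule binary_product[OF ob]) blast
  note I = Id_in_hom[OF ob(1)]
  obtain a where a: "a \<in> hom C A P" "p \<cdot> a = Id C A" "q \<cdot> a = g" using pair[OF I g] by blast
  obtain b where b: "b \<in> hom C A P" "p \<cdot> b = Id C A" "q \<cdot> b = h" using pair[OF I h] by blast
  obtain r s where pb: "is_pullback C a b r s"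
    using has_pullbacks[OF category_axioms finite_limits, of a b] homD[OF a(1)] homD[OF b(1)] by auto
  note rs = pullback_homs[OF pb a(1) b(1)]
  \<comment> \<open>The first projection is a left inverse of both graphs, so the two legs of the
    pullback coincide and give one arrow into A.\<close>
  have "r = p \<cdot> (a \<cdot> r)" using Comp_assoc[OF rs(1) a(1) p] a(2) Id_Comp[OF rs(1)] by simp
  also have "\<dots> = s" using rs(3) Comp_assoc[OF rs(2) b(1) p] b(2) Id_Comp[OF rs(2)] by simp
  finally have rs_eq: "r = s" .
  show ?thesis
  proof (rule that[OF rs(1)])
    show "g \<cdot> r = h \<cdot> r"
      using Comp_assoc[OF rs(1) a(1) q] Comp_assoc[OF rs(2) b(1) q] rs(3) a b rs_eq by simp
    fix G assume G: "G \<in> \<Phi>"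
    have eq: "act G p (act G a x) = x" "act G q (act G a x) = act G g x"
       "act G p (act G b x) = x" "act G q (act G b x) = act G h x" if "x \<in> fob G A" for x
      using act_Comp[OF G a(1) p that] act_Comp[OF G a(1) q that] act_Comp[OF G b(1) p that]
       act_Comp[OF G b(1) q that] a b act_Id[OF G ob(1) that] by simp_all
    have D: "Dom C a = A" "Dom C b = A" using a b by (auto simp: hom_def)
    have ab: "act G a x = act G b x" if x: "x \<in> fob G A" "act G g x = act G h x" for x
      by (rule uniq[OF G act_in[OF G a(1) x(1)] act_in[OF G b(1) x(1)]]) (use eq x in auto)
    show "\<exists>z \<in> fob G (Dom C r). act G r z = x" if x: "x \<in> fob G A" "act G g x = act G h x" for x
      using pullback_fibre[OF pb G, of x x] ab[OF x] x D by auto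
    show "inj_on (act G r) (fob G (Dom C r))"
    proof
      fix z w assume zw: "z \<in> fob G (Dom C r)" "w \<in> fob G (Dom C r)" "act G r z = act G r w"
      have "act G a (act G r w) = act G b (act G s w)"
        using act_Comp[OF G rs(1) a(1) zw(2)] act_Comp[OF G rs(2) b(1) zw(2)] rs(3) by simp
      then show "z = w"
        using pullback_fibre[OF pb G, of "act G r w" "act G s w"] zw D act_in[OF G rs(1) zw(2)] rs_eq by auto
    qed
  qed
qed

text \<open>The equaliser of f and g is bijective on fibres, hence an isomorphism by conservativity,
  and it can be cancelled.\<close>

lemma arr_eqI:
  assumes f: "f \<in> hom C A B" and g: "g \<in> hom C A B"
    and eq: "\<And>G x. G \<in> \<Phi> \<Longrightarrow> x \<in> fob G A \<Longrightarrow> act G f x = act G g x"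
  shows "f = g"
proof -
  obtain E e where e: "e \<in> hom C E A" "f \<cdot> e = g \<cdot> e" "\<And>G. G \<in> \<Phi> \<Longrightarrow> inj_on (act G e) (fob G E)"
    "\<And>G x. G \<in> \<Phi> \<Longrightarrow> x \<in> fob G A \<Longrightarrow> act G f x = act G g x \<Longrightarrow> \<exists>z \<in> fob G E. act G e z = x"
    by (rule equaliser[OF f g]) blast
  have "bij_betw (act G e) (fob G E) (fob G A)" if G: "G \<in> \<Phi>" for G
    unfolding bij_betw_def using e(3)[OF G] e(4)[OF G _ eq[OF G]] act_in[OF G e(1)] by (force simp: image_iff)
  then obtain k where k: "k \<in> hom C A E" "e \<cdot> k = Id C A"
    by (rule iso_if_bij[OF e(1)])
  have "f = (f \<cdot> e) \<cdot> k" using Comp_assoc[OF k(1) e(1) f] k(2) Comp_Id[OF f] by simp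
  also have "\<dots> = g" using Comp_assoc[OF k(1) e(1) g] k(2) Comp_Id[OF g] e(2) by simp
  finally show ?thesis .
qed

text \<open>The base change of m along g is bijective on fibres: injective because m is, surjective
  because the image of g lies in that of m. Hence it is invertible, and its inverse followed by the
  other projection is the factorisation.\<close>

lemma factor_through_injective:
  assumes m: "m \<in> hom C B A" and inj: "\<And>G. G \<in> \<Phi> \<Longrightarrow> inj_on (act G m) (fob G B)" and g: "g \<in> hom C T A"
    and im: "\<And>G x. G \<in> \<Phi> \<Longrightarrow> x \<in> fob G T \<Longrightarrow> act G g x \<in> act G m ` fob G B"
  obtains h where "h \<in> hom C T B" "m \<cdot> h = g"
proof -
  obtain p q where pb: "is_pullback C m g p q"
    using has_pullbacks[OF category_axioms finite_limits, of m g] homD[OF m] homD[OF g] by auto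
  note pq = pullback_homs[OF pb m g]
  have D: "Dom C m = B" "Dom C g = T" using homD(2)[OF m] homD(2)[OF g] by auto
  have "bij_betw (act G q) (fob G (Dom C p)) (fob G T)" if G: "G \<in> \<Phi>" for G
    unfolding bij_betw_def
  proof
    show "inj_on (act G q) (fob G (Dom C p))"
    proof
      fix z w assume zw: "z \<in> fob G (Dom C p)" "w \<in> fob G (Dom C p)" "act G q z = act G q w"
      have eq: "act G m (act G p v) = act G g (act G q v)" if "v \<in> fob G (Dom C p)" for v
        using act_Comp[OF G pq(1) m that] act_Comp[OF G pq(2) g that] pq(3) by simp
      then have "act G p z = act G p w"
        using zw inj_onD[OF inj[OF G], of "act G p z" "act G p w"] act_in[OF G pq(1)] by simp
      then show "z = w"
        using pullback_fibre[OF pb G, of "act G p w" "act G q w"] zw D act_in[OF G pq(1) zw(2)]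
          act_in[OF G pq(2) zw(2)] eq by auto
    qed
    show "act G q ` fob G (Dom C p) = fob G T"
    proof
      show "act G q ` fob G (Dom C p) \<subseteq> fob G T" using act_in[OF G pq(2)] by auto
      show "fob G T \<subseteq> act G q ` fob G (Dom C p)"
      proof
        fix x assume x: "x \<in> fob G T"
        then obtain y where "y \<in> fob G B" "act G m y = act G g x" using im[OF G] by (metis imageE)
        then show "x \<in> act G q ` fob G (Dom C p)" using pullback_fibre[OF pb G, of y x] D x by auto
      qed
    qed
  qed
  then obtain k where k: "k \<in> hom C T (Dom C p)" "q \<cdot> k = Id C T"
    by (rule iso_if_bij[OF pq(2)])
  have "m \<cdot> (p \<cdot> k) = g"
    using Comp_assoc[OF k(1) pq(1) m] Comp_assoc[OF k(1) pq(2) g] pq(3) k(2) Comp_Id[OF g] by simp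
  then show ?thesis using that Comp_in_hom[OF k(1) pq(1)] by blast
qed

section \<open>Effective quotients and images\<close>

text \<open>A fibre functor sends q to a coequaliser in \<open>Fin\<close>, which is right
  cancellable by uniqueness of factorisations; cancellability in \<open>Fin\<close> forces
  surjectivity.\<close>

lemma effective_epi_surj:
  assumes "is_effective_epi C q" "q \<in> hom C A B" "G \<in> \<Phi>"
  shows "act G q ` fob G A = fob G B"
proof -
  obtain r s where c: "is_coequaliser Fin r s (far G q)"
    using fibreD(4)[OF assms(3,1)] by (auto simp: is_effective_epi_def)
  have q: "far G q \<in> hom Fin (fob G A) (fob G B)"
    using is_functorD(4)[OF fibreD(1)] assms by blast
  note qD = hom_FinD[OF q]
  have rs: "r \<in> hom Fin (msrc r) (fob G A)" "s \<in> hom Fin (msrc r) (fob G A)" "far G q \<cdot>\<^bsub>Fin\<^esub> r = far G q \<cdot>\<^bsub>Fin\<^esub> s"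
    using c qD by (auto simp: is_coequaliser_def hom_def)
  show ?thesis
  proof (rule Fin_jointly_epic_imp_cover[OF qD(2)])
    show "act G q ` fob G A \<subseteq> fob G B" using qD(5) by blast
    fix T h k assume hk: "h \<in> hom Fin (fob G B) T" "k \<in> hom Fin (fob G B) T"
      and eq: "\<And>x. x \<in> act G q ` fob G A \<Longrightarrow> mfun h x = mfun k x"
    note hq = Fin_Comp_hom[OF q hk(1)]
    have hkq: "k \<cdot>\<^bsub>Fin\<^esub> far G q = h \<cdot>\<^bsub>Fin\<^esub> far G q"
      by (rule Fin_eqI[OF Fin_Comp_hom[OF q hk(2)] hq]) (use eq qD(3) in auto)
    have "(h \<cdot>\<^bsub>Fin\<^esub> far G q) \<cdot>\<^bsub>Fin\<^esub> r = (h \<cdot>\<^bsub>Fin\<^esub> far G q) \<cdot>\<^bsub>Fin\<^esub> s"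
      using category.Comp_assoc[OF category_Fin rs(1) q hk(1)]
        category.Comp_assoc[OF category_Fin rs(2) q hk(1)] rs(3) by simp
    moreover have "Cod Fin r = fob G A" "Cod Fin (far G q) = fob G B"
      using rs qD by (auto simp: hom_def)
    ultimately have "\<exists>!l. l \<in> hom Fin (fob G B) T \<and> l \<cdot>\<^bsub>Fin\<^esub> far G q = h \<cdot>\<^bsub>Fin\<^esub> far G q"
      using c hq unfolding is_coequaliser_def by metis
    then show "h = k" using hk hkq by blast
  qed
qed

text \<open>By conservativity, a pair of arrows factors through \<open>(r, s)\<close> as soon as it does so on fibres.\<close>

lemma quotient:
  assumes r: "r \<in> hom C R E" and s: "s \<in> hom C R E"
    and equiv: "\<And>G. G \<in> \<Phi> \<Longrightarrow> equiv (fob G E) (rel G)"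
    and inj: "\<And>G z w. G \<in> \<Phi> \<Longrightarrow> z \<in> fob G R \<Longrightarrow> w \<in> fob G R \<Longrightarrow> act G r z = act G r w \<Longrightarrow> act G s z = act G s w \<Longrightarrow> z = w"
    and im: "\<And>G. G \<in> \<Phi> \<Longrightarrow> (\<lambda>z. (act G r z, act G s z)) ` fob G R = rel G"
  obtains Q q where "q \<in> hom C E Q" "\<And>G. G \<in> \<Phi> \<Longrightarrow> act G q ` fob G E = fob G Q"
    "\<And>G x y. G \<in> \<Phi> \<Longrightarrow> x \<in> fob G E \<Longrightarrow> y \<in> fob G E \<Longrightarrow> act G q x = act G q y \<longleftrightarrow> (x, y) \<in> rel G"
    "\<And>T k. k \<in> hom C E T \<Longrightarrow> k \<cdot> r = k \<cdot> s \<Longrightarrow> \<exists>h. h \<in> hom C Q T \<and> h \<cdot> q = k"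
proof -
  have RE: "R \<in> Ob C" "E \<in> Ob C" using hom_Ob[OF r] by auto
  obtain P a b where a: "a \<in> hom C P E" and b: "b \<in> hom C P E"
    and pair: "\<And>T f g. f \<in> hom C T E \<Longrightarrow> g \<in> hom C T E \<Longrightarrow> \<exists>h. h \<in> hom C T P \<and> a \<cdot> h = f \<and> b \<cdot> h = g"
    and uniq: "\<And>G z w. G \<in> \<Phi> \<Longrightarrow> z \<in> fob G P \<Longrightarrow> w \<in> fob G P \<Longrightarrow> act G a z = act G a w \<Longrightarrow> act G b z = act G b w \<Longrightarrow> z = w"
    by (rule binary_product[OF RE(2,2)]) blast
  \<comment> \<open>The pair (r, s) is packed into one arrow to the product of E with itself,
    injective on fibres, so that factoring a pair of arrows becomes factoring a single one.\<close>
  obtain m where m: "m \<in> hom C R P" "a \<cdot> m = r" "b \<cdot> m = s" using pair[OF r s] by blast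
  have am: "act G a (act G m z) = act G r z" "act G b (act G m z) = act G s z" if "G \<in> \<Phi>" "z \<in> fob G R" for G z
    using act_Comp[OF that(1) m(1) a that(2)] act_Comp[OF that(1) m(1) b that(2)] m by simp_all
  have m_inj: "inj_on (act G m) (fob G R)" if "G \<in> \<Phi>" for G
    by (rule inj_onI) (use inj[OF that] am[OF that] in metis)
  \<comment> \<open>The relation on generalised elements with any domain T consists of the pairs of
    arrows that are related at every point of every fibre of T. The axioms of an equivalence
    relation then pass from the fibres to all T.\<close>
  have rels: "(\<lambda>u. (r \<cdot> u, s \<cdot> u)) ` hom C T R =
      {(f, g). f \<in> hom C T E \<and> g \<in> hom C T E \<and> (\<forall>G \<in> \<Phi>. \<forall>x \<in> fob G T. (act G f x, act G g x) \<in> rel G)}" (is "?L = ?R") for T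
  proof
    show "?L \<subseteq> ?R"
    proof clarify
      fix u assume u: "u \<in> hom C T R"
      have "(act G (r \<cdot> u) x, act G (s \<cdot> u) x) \<in> rel G" if G: "G \<in> \<Phi>" and x: "x \<in> fob G T" for G x
        using im[OF G] act_in[OF G u x] act_Comp[OF G u r x] act_Comp[OF G u s x] by auto
      then show "r \<cdot> u \<in> hom C T E \<and> s \<cdot> u \<in> hom C T E \<and>
          (\<forall>G \<in> \<Phi>. \<forall>x \<in> fob G T. (act G (r \<cdot> u) x, act G (s \<cdot> u) x) \<in> rel G)"
        using Comp_in_hom[OF u] r s by blast
    qed
    show "?R \<subseteq> ?L"
    proof clarify
      fix f g assume f: "f \<in> hom C T E" and g: "g \<in> hom C T E"
        and fg: "\<forall>G \<in> \<Phi>. \<forall>x \<in> fob G T. (act G f x, act G g x) \<in> rel G"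
      obtain h where h: "h \<in> hom C T P" "a \<cdot> h = f" "b \<cdot> h = g" using pair[OF f g] by blast
      have "act G h x \<in> act G m ` fob G R" if G: "G \<in> \<Phi>" and x: "x \<in> fob G T" for G x
      proof -
        have "(act G f x, act G g x) \<in> (\<lambda>z. (act G r z, act G s z)) ` fob G R" using fg G x im[OF G] by auto
        then obtain z where z: "z \<in> fob G R" "act G f x = act G r z" "act G g x = act G s z" by blast
        have "act G h x = act G m z"
          by (rule uniq[OF G act_in[OF G h(1) x] act_in[OF G m(1) z(1)]])
            (use act_Comp[OF G h(1) a x] act_Comp[OF G h(1) b x] h z am[OF G z(1)] in auto)
        then show ?thesis using z by blast
      qed
      then obtain u where u: "u \<in> hom C T R" "m \<cdot> u = h"
        using factor_through_injective[OF m(1) m_inj h(1)] by blast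
      have "r \<cdot> u = f" "s \<cdot> u = g"
        using Comp_assoc[OF u(1) m(1) a] Comp_assoc[OF u(1) m(1) b] u m h by simp_all
      then show "(f, g) \<in> ?L" using u by blast
    qed
  qed
  have refl: "(x, x) \<in> rel G" if "G \<in> \<Phi>" "x \<in> fob G E" for G x
    using equivE[OF equiv[OF that(1)]] that(2) refl_onD by metis
  have sym: "(y, x) \<in> rel G" if "G \<in> \<Phi>" "(x, y) \<in> rel G" for G x y
    using equivE[OF equiv[OF that(1)]] that(2) symD by metis
  have trans: "(x, z) \<in> rel G" if "G \<in> \<Phi>" "(x, y) \<in> rel G" "(y, z) \<in> rel G" for G x y z
    using equivE[OF equiv[OF that(1)]] that(2,3) transD by metis
  have "is_equivalence_relation C r s"
    unfolding is_equivalence_relation_def homD(2,3)[OF r] homD(2,3)[OF s] rels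
  proof (intro conjI ballI HOL.refl homD(1)[OF r] homD(1)[OF s])
    fix T assume T: "T \<in> Ob C"
    show "inj_on (\<lambda>u. (r \<cdot> u, s \<cdot> u)) (hom C T R)"
    proof (rule inj_onI)
      fix u v assume u: "u \<in> hom C T R" and v: "v \<in> hom C T R" and "(r \<cdot> u, s \<cdot> u) = (r \<cdot> v, s \<cdot> v)"
      then have eq: "r \<cdot> u = r \<cdot> v" "s \<cdot> u = s \<cdot> v" by auto
      show "u = v"
      proof (rule arr_eqI[OF u v])
        fix G x assume G: "G \<in> \<Phi>" and x: "x \<in> fob G T"
        show "act G u x = act G v x"
          by (rule inj[OF G act_in[OF G u x] act_in[OF G v x]])
            (use eq act_Comp[OF G u r x] act_Comp[OF G v r x] act_Comp[OF G u s x] act_Comp[OF G v s x] in auto)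
      qed
    qed
    show "equiv (hom C T E)
      {(f, g). f \<in> hom C T E \<and> g \<in> hom C T E \<and> (\<forall>G \<in> \<Phi>. \<forall>x \<in> fob G T. (act G f x, act G g x) \<in> rel G)}"
    proof (rule equivI)
      have "(act G f x, act G f x) \<in> rel G" if "f \<in> hom C T E" "G \<in> \<Phi>" "x \<in> fob G T" for f G x
        using refl[OF that(2) act_in[OF that(2,1,3)]] .
      then show "refl_on (hom C T E) {(f, g). f \<in> hom C T E \<and> g \<in> hom C T E \<and> (\<forall>G \<in> \<Phi>. \<forall>x \<in> fob G T. (act G f x, act G g x) \<in> rel G)}"
        by (intro refl_onI) blast
      show "sym {(f, g). f \<in> hom C T E \<and> g \<in> hom C T E \<and> (\<forall>G \<in> \<Phi>. \<forall>x \<in> fob G T. (act G f x, act G g x) \<in> rel G)}"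
        by (rule symI) (use sym in blast)
      show "trans {(f, g). f \<in> hom C T E \<and> g \<in> hom C T E \<and> (\<forall>G \<in> \<Phi>. \<forall>x \<in> fob G T. (act G f x, act G g x) \<in> rel G)}"
        by (rule transI) (use trans in blast)
    qed blast
  qed
  \<comment> \<open>Effectiveness gives both halves: the coequaliser provides factorisations and
    surjectivity on fibres, the pullback shows that q identifies on fibres exactly the related
    points.\<close>
  then obtain q where q: "is_coequaliser C r s q" "is_pullback C q q r s"
    using relations_effective by (auto simp: is_effective_relation_def)
  have qh: "q \<in> hom C E (Cod C q)" and qrs: "q \<cdot> r = q \<cdot> s"
    using q(1) homD[OF r] by (auto simp: is_coequaliser_def hom_def)
  show ?thesis
  proof (rule that[OF qh])
    show "act G q ` fob G E = fob G (Cod C q)" if "G \<in> \<Phi>" for G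
      using effective_epi_surj[OF _ qh that] q unfolding is_effective_epi_def by blast
    show "\<exists>h. h \<in> hom C (Cod C q) T \<and> h \<cdot> q = k" if "k \<in> hom C E T" "k \<cdot> r = k \<cdot> s" for T k
      using q(1) that homD[OF r] unfolding is_coequaliser_def by blast
    fix G x y assume G: "G \<in> \<Phi>" and x: "x \<in> fob G E" and y: "y \<in> fob G E"
    show "act G q x = act G q y \<longleftrightarrow> (x, y) \<in> rel G"
    proof
      assume "act G q x = act G q y"
      then have "\<exists>z. z \<in> fob G R \<and> act G r z = x \<and> act G s z = y"
        using pullback_fibre[OF q(2) G, of x y] x y homD[OF qh] homD[OF r] by auto
      then show "(x, y) \<in> rel G" using im[OF G] by blast
    next
      assume "(x, y) \<in> rel G"
      then have "(x, y) \<in> (\<lambda>z. (act G r z, act G s z)) ` fob G R" unfolding im[OF G] .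
      then obtain z where "z \<in> fob G R" "act G r z = x" "act G s z = y" by blast
      then show "act G q x = act G q y"
        using act_Comp[OF G r qh, of z] act_Comp[OF G s qh, of z] qrs by simp
    qed
  qed
qed

text \<open>The quotient of A by the kernel pair of f. The induced arrow m is injective on fibres
  because q identifies two points exactly when f does.\<close>

lemma image_factorisation:
  assumes f: "f \<in> hom C A B"
  obtains Q q m where "q \<in> hom C A Q" "m \<in> hom C Q B" "m \<cdot> q = f"
    "\<And>G. G \<in> \<Phi> \<Longrightarrow> act G q ` fob G A = fob G Q" "\<And>G. G \<in> \<Phi> \<Longrightarrow> inj_on (act G m) (fob G Q)"
proof -
  let ?rel = "\<lambda>G. {(x, y). x \<in> fob G A \<and> y \<in> fob G A \<and> act G f x = act G f y}"
  obtain r s where pb: "is_pullback C f f r s"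
    using has_pullbacks[OF category_axioms finite_limits, of f f] homD[OF f] by auto
  note rs = pullback_homs[OF pb f f]
  have eq: "act G f (act G r z) = act G f (act G s z)" if "G \<in> \<Phi>" "z \<in> fob G (Dom C r)" for G z
    using act_Comp[OF that(1) rs(1) f that(2)] act_Comp[OF that(1) rs(2) f that(2)] rs(3) by simp
  have D: "Dom C f = A" using homD[OF f] by simp
  obtain Q q where q: "q \<in> hom C A Q" "\<And>G. G \<in> \<Phi> \<Longrightarrow> act G q ` fob G A = fob G Q"
    "\<And>G x y. G \<in> \<Phi> \<Longrightarrow> x \<in> fob G A \<Longrightarrow> y \<in> fob G A \<Longrightarrow> act G q x = act G q y \<longleftrightarrow> (x, y) \<in> ?rel G"
    "\<And>T k. k \<in> hom C A T \<Longrightarrow> k \<cdot> r = k \<cdot> s \<Longrightarrow> \<exists>h. h \<in> hom C Q T \<and> h \<cdot> q = k"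
  proof (rule quotient[OF rs(1,2), of ?rel])
    show "equiv (fob G A) (?rel G)" for G
      by (auto intro!: equivI simp: refl_on_def sym_def trans_def)
    show "z = w" if "G \<in> \<Phi>" "z \<in> fob G (Dom C r)" "w \<in> fob G (Dom C r)" "act G r z = act G r w" "act G s z = act G s w" for G z w
      using pullback_fibre[OF pb that(1), of "act G r w" "act G s w"] eq[OF that(1,3)] that D
        act_in[OF that(1) rs(1)] act_in[OF that(1) rs(2)] by auto
    show "(\<lambda>z. (act G r z, act G s z)) ` fob G (Dom C r) = ?rel G" if G: "G \<in> \<Phi>" for G
    proof
      show "(\<lambda>z. (act G r z, act G s z)) ` fob G (Dom C r) \<subseteq> ?rel G"
        using eq[OF G] act_in[OF G rs(1)] act_in[OF G rs(2)] by auto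
      show "?rel G \<subseteq> (\<lambda>z. (act G r z, act G s z)) ` fob G (Dom C r)"
        using pullback_fibre[OF pb G] D by fast
    qed
  qed blast
  obtain m where m: "m \<in> hom C Q B" "m \<cdot> q = f" using q(4)[OF f rs(3)] by blast
  have "inj_on (act G m) (fob G Q)" if G: "G \<in> \<Phi>" for G
  proof (rule inj_onI)
    fix u v assume "u \<in> fob G Q" "v \<in> fob G Q" and uv: "act G m u = act G m v"
    then obtain x y where x: "x \<in> fob G A" "u = act G q x" and y: "y \<in> fob G A" "v = act G q y"
      using q(2)[OF G] by blast
    have "act G f x = act G f y"
      using act_Comp[OF G q(1) m(1) x(1)] act_Comp[OF G q(1) m(1) y(1)] uv x y m by simp
    then show "u = v" using q(3)[OF G x(1) y(1)] x y by auto
  qed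
  then show ?thesis using that[OF q(1) m q(2)] by blast
qed


section \<open>Minimal elements and natural transformations between fibre functors\<close>

text \<open>Subobjects are presented by arrows that are injective on all fibres. The element lives
  in the fibre of G alone, but the conclusion is about every fibre in the family, which lets one
  element control all of them.\<close>

definition minimal :: "('o, 'a, 'u) fin_ftor \<Rightarrow> 'o \<Rightarrow> 'u \<Rightarrow> bool" where
  "minimal G D d \<longleftrightarrow> D \<in> Ob C \<and> d \<in> fob G D \<and>
     (\<forall>B m. m \<in> hom C B D \<and> (\<forall>H \<in> \<Phi>. inj_on (act H m) (fob H B)) \<and> d \<in> act G m ` fob G B \<longrightarrow>
        (\<forall>H \<in> \<Phi>. act H m ` fob H B = fob H D))"

text \<open>Among the subobjects of A whose G-fibre contains x, one with least total number of
  points in all fibres is chosen. A subobject of it that still contains the element is again a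
  candidate, so no fibre can have become smaller.\<close>

lemma ex_minimal:
  assumes G: "G \<in> \<Phi>" and A: "A \<in> Ob C" and x: "x \<in> fob G A"
  obtains D d m where "minimal G D d" "m \<in> hom C D A" "act G m d = x"
proof -
  define S where "S = {(B, m). m \<in> hom C B A \<and> (\<forall>H \<in> \<Phi>. inj_on (act H m) (fob H B)) \<and> x \<in> act G m ` fob G B}"
  \<comment> \<open>The sum runs over the whole family, so that its minimality forces surjectivity
    on every fibre and not only on that of G.\<close>
  define \<mu> where "\<mu> = (\<lambda>(B, m :: 'a). \<Sum>H \<in> \<Phi>. card (fob H B))"
  have "inj_on (act H (Id C A)) (fob H A)" if "H \<in> \<Phi>" for H
    using act_Id[OF that A] by (simp add: inj_on_def)
  moreover have "x \<in> act G (Id C A) ` fob G A" using act_Id[OF G A x] x by force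
  ultimately have "(A, Id C A) \<in> S" unfolding S_def using Id_in_hom[OF A] by blast
  then obtain Dm where Dm: "Dm \<in> S" and least: "\<And>p. p \<in> S \<Longrightarrow> \<mu> Dm \<le> \<mu> p"
    using ex_has_least_nat[of "\<lambda>p. p \<in> S" _ \<mu>] by blast
  obtain D m where "Dm = (D, m)" by (cases Dm)
  then have m: "m \<in> hom C D A" and m_inj: "\<And>H. H \<in> \<Phi> \<Longrightarrow> inj_on (act H m) (fob H D)"
    and hit: "x \<in> act G m ` fob G D" and least: "\<And>B n. (B, n) \<in> S \<Longrightarrow> (\<Sum>H \<in> \<Phi>. card (fob H D)) \<le> (\<Sum>H \<in> \<Phi>. card (fob H B))"
    using Dm least unfolding S_def \<mu>_def by auto
  obtain d where d: "d \<in> fob G D" "act G m d = x" using hit by blast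
  have D: "D \<in> Ob C" using hom_Ob[OF m] by blast
  have "act H n ` fob H B = fob H D"
    if n: "n \<in> hom C B D" and n_inj: "\<forall>H \<in> \<Phi>. inj_on (act H n) (fob H B)"
      and hit: "d \<in> act G n ` fob G B" and H: "H \<in> \<Phi>" for B n H
  proof -
    have B: "B \<in> Ob C" using hom_Ob[OF n] by blast
    have sub: "act K n ` fob K B \<subseteq> fob K D" if "K \<in> \<Phi>" for K using act_in[OF that n] by blast
    have card: "card (act K n ` fob K B) = card (fob K B)" if "K \<in> \<Phi>" for K
      using n_inj that by (simp add: card_image)
    have le: "card (fob K B) \<le> card (fob K D)" if "K \<in> \<Phi>" for K
      using card_mono[OF finite_fibre[OF that D] sub[OF that]] card[OF that] by simp
    have "(B, m \<cdot> n) \<in> S"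
    proof -
      have "inj_on (act K (m \<cdot> n)) (fob K B)" if K: "K \<in> \<Phi>" for K
      proof (rule inj_onI)
        fix u v assume uv: "u \<in> fob K B" "v \<in> fob K B" "act K (m \<cdot> n) u = act K (m \<cdot> n) v"
        then have "act K n u = act K n v"
          using inj_onD[OF m_inj[OF K]] act_Comp[OF K n m] act_in[OF K n] by metis
        then show "u = v" using inj_onD n_inj K uv by metis
      qed
      moreover have "x \<in> act G (m \<cdot> n) ` fob G B"
        using hit d act_Comp[OF G n m] by (metis (no_types, lifting) image_iff)
      ultimately show ?thesis unfolding S_def using Comp_in_hom[OF n m] by blast
    qed
    then have sum: "(\<Sum>K \<in> \<Phi>. card (fob K D)) \<le> (\<Sum>K \<in> \<Phi>. card (fob K B))" by (rule least)
    \<comment> \<open>Each fibre of B is at most as large as that of D, so a strict inequality in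
      one fibre would make the total strictly smaller.\<close>
    have "card (fob H B) = card (fob H D)"
    proof (rule ccontr)
      assume "card (fob H B) \<noteq> card (fob H D)"
      then have "card (fob H B) < card (fob H D)" using le[OF H] by simp
      then have "(\<Sum>K \<in> \<Phi>. card (fob K B)) < (\<Sum>K \<in> \<Phi>. card (fob K D))"
        using le H by (intro sum_strict_mono_ex1[OF finite_family]) auto
      then show False using sum by simp
    qed
    then show ?thesis
      using card_subset_eq[OF finite_fibre[OF H D] sub[OF H]] card[OF H] by simp
  qed
  then have "minimal G D d" unfolding minimal_def using D d by blast
  then show ?thesis using that m d by blast
qed

text \<open>The image of f is a subobject of D containing d, hence all of D on fibres, and E covers
  its image.\<close>

lemma minimal_surj:
  assumes min: "minimal G D d" and G: "G \<in> \<Phi>" and H: "H \<in> \<Phi>"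
    and f: "f \<in> hom C E D" and e: "e \<in> fob G E" "act G f e = d" and y: "y \<in> fob H D"
  obtains z where "z \<in> fob H E" "act H f z = y"
proof -
  obtain Q q m where q: "q \<in> hom C E Q" "m \<in> hom C Q D" "m \<cdot> q = f"
    "\<And>G. G \<in> \<Phi> \<Longrightarrow> act G q ` fob G E = fob G Q" "\<And>G. G \<in> \<Phi> \<Longrightarrow> inj_on (act G m) (fob G Q)"
    by (rule image_factorisation[OF f]) blast
  have "d = act G m (act G q e)" using act_Comp[OF G q(1,2) e(1)] e q by simp
  then have "d \<in> act G m ` fob G Q" using act_in[OF G q(1) e(1)] by blast
  then have "act H m ` fob H Q = fob H D" using min q(2,5) H unfolding minimal_def by blast
  moreover have "act H f ` fob H E = act H m ` (act H q ` fob H E)"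
    using act_Comp[OF H q(1,2)] q(3) by (auto simp: image_image)
  ultimately have "y \<in> act H f ` fob H E" using q(4)[OF H] y by simp
  then show ?thesis using that by blast
qed

text \<open>The equaliser of g and h is a subobject of D containing d, so every fibre of D lies in
  it.\<close>

lemma minimal_eq:
  assumes min: "minimal G D d" and G: "G \<in> \<Phi>" and H: "H \<in> \<Phi>"
    and g: "g \<in> hom C D B" and h: "h \<in> hom C D B" and eq: "act G g d = act G h d"
    and y: "y \<in> fob H D"
  shows "act H g y = act H h y"
proof -
  obtain E e where e: "e \<in> hom C E D" "g \<cdot> e = h \<cdot> e" "\<And>G. G \<in> \<Phi> \<Longrightarrow> inj_on (act G e) (fob G E)"
    "\<And>G x. G \<in> \<Phi> \<Longrightarrow> x \<in> fob G D \<Longrightarrow> act G g x = act G h x \<Longrightarrow> \<exists>z \<in> fob G E. act G e z = x"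
    by (rule equaliser[OF g h]) blast
  have d: "d \<in> fob G D" using min by (simp add: minimal_def)
  have "d \<in> act G e ` fob G E" using e(4)[OF G d eq] by blast
  then have "act H e ` fob H E = fob H D" using min e(1,3) H unfolding minimal_def by blast
  then have "y \<in> act H e ` fob H E" using y by simp
  then obtain z where z: "z \<in> fob H E" "act H e z = y" by blast
  then show ?thesis using act_Comp[OF H e(1) g z(1)] act_Comp[OF H e(1) h z(1)] e(2) by simp
qed

section \<open>Refining finitely many pointed objects\<close>

text \<open>Existence of an arrow from (V, v) to (B, b) in the category of elements of G.\<close>

definition reaches :: "('o, 'a, 'u) fin_ftor \<Rightarrow> 'o \<Rightarrow> 'u \<Rightarrow> 'o \<Rightarrow> 'u \<Rightarrow> bool" where
  "reaches G V v B b \<longleftrightarrow> (\<exists>p \<in> hom C V B. act G p v = b)"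

lemma reaches_trans:
  assumes "G \<in> \<Phi>" "v \<in> fob G V" "reaches G V v B b" "reaches G B b D d"
  shows "reaches G V v D d"
proof -
  obtain p q where "p \<in> hom C V B" "act G p v = b" "q \<in> hom C B D" "act G q b = d"
    using assms unfolding reaches_def by blast
  then have "q \<cdot> p \<in> hom C V D" "act G (q \<cdot> p) v = d"
    using Comp_in_hom act_Comp[OF assms(1) _ _ assms(2)] by auto
  then show ?thesis unfolding reaches_def by blast
qed

text \<open>The category of elements of G is codirected: the point with coordinates v and b in the
  fibre of the product of V and B lies over both pairs, and a minimal pair can be taken above it.
  The pair (D, d) is the seed that covers empty X.\<close>

lemma ex_refinement:
  assumes G: "G \<in> \<Phi>" and D: "D \<in> Ob C" "d \<in> fob G D"
    and "finite X" and "\<And>B b. (B, b) \<in> X \<Longrightarrow> B \<in> Ob C \<and> b \<in> fob G B"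
  shows "\<exists>V v. minimal G V v \<and> reaches G V v D d \<and> (\<forall>(B, b) \<in> X. reaches G V v B b)"
  using assms(4,5)
proof (induction X)
  case empty
  obtain V v m where "minimal G V v" "m \<in> hom C V D" "act G m v = d" by (rule ex_minimal[OF G D])
  then show ?case unfolding reaches_def by blast
next
  case (insert Bb X)
  obtain B b where Bb: "Bb = (B, b)" by (cases Bb)
  have B: "B \<in> Ob C" "b \<in> fob G B" using insert.prems Bb by auto
  obtain V v where V: "minimal G V v" "reaches G V v D d" "\<forall>(B, b) \<in> X. reaches G V v B b"
    using insert.IH insert.prems by blast
  have V1: "V \<in> Ob C" "v \<in> fob G V" using V(1) by (auto simp: minimal_def)
  obtain P p q where p: "p \<in> hom C P V" and q: "q \<in> hom C P B"
    and el: "\<And>G x y. G \<in> \<Phi> \<Longrightarrow> x \<in> fob G V \<Longrightarrow> y \<in> fob G B \<Longrightarrow> \<exists>z. z \<in> fob G P \<and> act G p z = x \<and> act G q z = y"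
    by (rule binary_product[OF V1(1) B(1)]) blast
  obtain z where z: "z \<in> fob G P" "act G p z = v" "act G q z = b" using el[OF G V1(2) B(2)] by blast
  obtain W w m where W: "minimal G W w" "m \<in> hom C W P" "act G m w = z"
    using ex_minimal[OF G _ z(1)] hom_Ob[OF p] by metis
  have w: "w \<in> fob G W" using W(1) by (simp add: minimal_def)
  have "reaches G W w P z" "reaches G P z V v" "reaches G P z B b"
    using W z p q unfolding reaches_def by blast+
  then have "reaches G W w V v" "reaches G W w B b" using reaches_trans[OF G w] by blast+
  moreover from this have "reaches G W w D d" "\<forall>(B, b) \<in> X. reaches G W w B b"
    using reaches_trans[OF G w] V by blast+
  ultimately show ?case using W(1) Bb by blast
qed

section \<open>The compact space of families of maps between fibres\<close>

text \<open>The points are all families of maps, natural or not; the topology of the fundamental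
  category is pulled back from this space along \<open>ncmp\<close>.\<close>

definition hom_topology :: "('o, 'a, 'u) fin_ftor \<Rightarrow> ('o, 'a, 'u) fin_ftor \<Rightarrow> ('o \<Rightarrow> 'u set_map) topology" where
  "hom_topology G H = product_topology (\<lambda>A. discrete_topology (hom Fin (fob G A) (fob H A))) (Ob C)"

lemma topspace_hom_topology: "topspace (hom_topology G H) = (\<Pi>\<^sub>E A \<in> Ob C. hom Fin (fob G A) (fob H A))"
  by (simp add: hom_topology_def)

lemma compact_hom_topology: "compact_space (hom_topology G H)"
  by (simp add: hom_topology_def compact_space_product_topology compact_space_discrete_topology finite_hom_Fin)

text \<open>The factors are finite and discrete, so any condition on two coordinates is a finite
  union, over the values k of the first, of intersections of two closed cylinders.\<close>

lemma closedin_coordinates: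
  assumes "A \<in> Ob C" "B \<in> Ob C"
  shows "closedin (hom_topology G H) {\<eta> \<in> topspace (hom_topology G H). P (\<eta> A) (\<eta> B)}"
proof -
  let ?T = "hom_topology G H"
  have c: "closedin ?T {\<eta> \<in> topspace ?T. \<eta> X \<in> S}" if "X \<in> Ob C" "S \<subseteq> hom Fin (fob G X) (fob H X)" for X S
  proof (rule closedin_continuous_map_preimage)
    show "continuous_map ?T (discrete_topology (hom Fin (fob G X) (fob H X))) (\<lambda>\<eta>. \<eta> X)"
      unfolding hom_topology_def by (rule continuous_map_product_projection[OF that(1)])
    show "closedin (discrete_topology (hom Fin (fob G X) (fob H X))) S" using that(2) by simp
  qed
  have "{\<eta> \<in> topspace ?T. P (\<eta> A) (\<eta> B)} =
      (\<Union>k \<in> hom Fin (fob G A) (fob H A). {\<eta> \<in> topspace ?T. \<eta> A \<in> {k}} \<inter>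
        {\<eta> \<in> topspace ?T. \<eta> B \<in> {l \<in> hom Fin (fob G B) (fob H B). P k l}})"
    using assms by (auto simp: topspace_hom_topology PiE_iff)
  also have "closedin ?T \<dots>"
  proof (rule closedin_Union)
    show "finite ((\<lambda>k. {\<eta> \<in> topspace ?T. \<eta> A \<in> {k}} \<inter>
        {\<eta> \<in> topspace ?T. \<eta> B \<in> {l \<in> hom Fin (fob G B) (fob H B). P k l}}) ` hom Fin (fob G A) (fob H A))"
      using finite_hom_Fin by (rule finite_imageI)
    fix Z assume "Z \<in> (\<lambda>k. {\<eta> \<in> topspace ?T. \<eta> A \<in> {k}} \<inter>
        {\<eta> \<in> topspace ?T. \<eta> B \<in> {l \<in> hom Fin (fob G B) (fob H B). P k l}}) ` hom Fin (fob G A) (fob H A)"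
    then obtain k where k: "k \<in> hom Fin (fob G A) (fob H A)" "Z = {\<eta> \<in> topspace ?T. \<eta> A \<in> {k}} \<inter>
        {\<eta> \<in> topspace ?T. \<eta> B \<in> {l \<in> hom Fin (fob G B) (fob H B). P k l}}" by blast
    show "closedin ?T Z"
      unfolding k(2) using assms k(1) by (intro closedin_Int c) auto
  qed
  finally show ?thesis .
qed

lemma closedin_Collect_ball:
  assumes "\<And>i. i \<in> J \<Longrightarrow> closedin T {x \<in> topspace T. P i x}"
  shows "closedin T {x \<in> topspace T. \<forall>i \<in> J. P i x}"
proof -
  \<comment> \<open>The whole space is inserted so that the intersection is also correct for empty
    J.\<close>
  have "{x \<in> topspace T. \<forall>i \<in> J. P i x} = \<Inter>(insert (topspace T) ((\<lambda>i. {x \<in> topspace T. P i x}) ` J))"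
    by auto
  also have "closedin T \<dots>" using assms by (intro closedin_Inter) auto
  finally show ?thesis .
qed

text \<open>Along minimal elements the fibre maps are surjective, so a compatible family of values
  can be prescribed at any finite stage; compactness of the product of the finite sets
  \<open>hom Fin (G A) (H A)\<close> then provides a family that is compatible everywhere.\<close>

lemma ex_ntrans:
  assumes G: "G \<in> \<Phi>" and H: "H \<in> \<Phi>" and min: "minimal G D d" and y: "y \<in> fob H D"
  shows "\<exists>\<phi>. is_ntrans C Fin \<phi> \<and> nsrc \<phi> = G \<and> ntgt \<phi> = H \<and> mfun (ncmp \<phi> D) d = y"
proof -
  let ?T = "hom_topology G H"
  \<comment> \<open>Taking g to be the identity, membership says that \<eta> sends w to z; the other
    g say that \<eta> is compatible at w with all arrows out of W. The condition at d stands inside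
    the quantifier, so that each conjunct involves only the coordinates B and D.\<close>
  define N where "N = (\<lambda>(W, w) z. {\<eta> \<in> topspace ?T. \<forall>(B, g) \<in> {(B, g). g \<in> hom C W B}.
      mfun (\<eta> B) (act G g w) = act H g z \<and> mfun (\<eta> D) d = y})"
  \<comment> \<open>The value z at w is left open. As it ranges over a finite fibre,
    \<open>K\<close> is a finite union of closed sets. A point in all of these sets is a natural
    transformation sending d to y.\<close>
  define K where "K = (\<lambda>Ww. \<Union>z \<in> fob H (fst Ww). N Ww z)"
  define S where "S = {(W, w). W \<in> Ob C \<and> w \<in> fob G W}"
  have D: "D \<in> Ob C" "d \<in> fob G D" using min by (auto simp: minimal_def)
  have memK: "\<eta> \<in> K (W, w)" if "\<eta> \<in> topspace ?T" "z \<in> fob H W" "mfun (\<eta> D) d = y"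
    "\<And>B g. g \<in> hom C W B \<Longrightarrow> mfun (\<eta> B) (act G g w) = act H g z" for \<eta> W w z
    using that unfolding K_def N_def by auto
  have K_D: "\<exists>z \<in> fob H W. mfun (\<eta> D) d = y \<and> (\<forall>B g. g \<in> hom C W B \<longrightarrow> mfun (\<eta> B) (act G g w) = act H g z)"
    if "\<eta> \<in> K (W, w)" "W \<in> Ob C" for \<eta> W w
    using that Id_in_hom[OF that(2)] unfolding K_def N_def by fastforce
  have "\<Inter>(K ` S) \<noteq> {}"
  proof (rule compact_space_fip[THEN iffD1, OF compact_hom_topology[of G H], rule_format], intro conjI ballI allI impI)
    fix Z assume "Z \<in> K ` S"
    then obtain W w where Z: "Z = K (W, w)" and W: "W \<in> Ob C" by (auto simp: S_def)
    have "closedin ?T (N (W, w) z)" for z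
      unfolding N_def prod.case
    proof (rule closedin_Collect_ball)
      fix Bg assume "Bg \<in> {(B, g). g \<in> hom C W B}"
      then obtain B g where Bg: "Bg = (B, g)" "B \<in> Ob C" using hom_Ob by blast
      show "closedin ?T {\<eta> \<in> topspace ?T. case Bg of (B, g) \<Rightarrow> mfun (\<eta> B) (act G g w) = act H g z \<and> mfun (\<eta> D) d = y}"
        unfolding Bg prod.case using closedin_coordinates[OF Bg(2) D(1)] .
    qed
    then show "closedin ?T Z"
      unfolding Z K_def using finite_fibre[OF H W] by (intro closedin_Union) auto
  next
    fix \<F> assume "finite \<F> \<and> \<F> \<subseteq> K ` S"
    then obtain X where X: "X \<subseteq> S" "finite X" "\<F> = K ` X" by (meson finite_subset_image)
    \<comment> \<open>One minimal pair lies over (D, d) and over all pairs of the finite subfamily,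
      so compatibility at v handles them all.\<close>
    obtain V v where V: "minimal G V v" "reaches G V v D d" "\<forall>(B, b) \<in> X. reaches G V v B b"
      using ex_refinement[OF G D X(2)] X(1) unfolding S_def by blast
    have V1: "V \<in> Ob C" "v \<in> fob G V" using V(1) by (auto simp: minimal_def)
    obtain p where p: "p \<in> hom C V D" "act G p v = d" using V(2) unfolding reaches_def by blast
    obtain z where z: "z \<in> fob H V" "act H p z = y"
      by (rule minimal_surj[OF min G H p(1) V1(2) p(2) y])
    \<comment> \<open>Choosing z as the value at v forces the value at every element reached from v.
      The remaining elements get an arbitrary value, because naturality at this finite stage is
      demanded only along arrows out of V.\<close>
    define \<theta> where "\<theta> = (\<lambda>B b. if reaches G V v B b then act H (SOME g. g \<in> hom C V B \<and> act G g v = b) z else (SOME c. c \<in> fob H B))"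
    \<comment> \<open>Two arrows with the same value at v have the same value at z, by minimality of
      v; hence the choice of arrow is harmless.\<close>
    have \<theta>: "\<theta> B (act G g v) = act H g z" if g: "g \<in> hom C V B" for B g
    proof -
      let ?g = "SOME g'. g' \<in> hom C V B \<and> act G g' v = act G g v"
      have "?g \<in> hom C V B \<and> act G ?g v = act G g v" by (rule someI[of _ g]) (use g in blast)
      moreover have "reaches G V v B (act G g v)" using g unfolding reaches_def by blast
      ultimately show ?thesis unfolding \<theta>_def using minimal_eq[OF V(1) G H _ g _ z(1)] by simp
    qed
    have \<theta>_in: "\<theta> B b \<in> fob H B" if B: "B \<in> Ob C" "b \<in> fob G B" for B b
    proof (cases "reaches G V v B b")
      case True
      then obtain g where "g \<in> hom C V B" "act G g v = b" unfolding reaches_def by blast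
      then show ?thesis using \<theta> act_in[OF H _ z(1)] by metis
    next
      case False
      \<comment> \<open>The arbitrary value needs the H-fibre of B to be nonempty. A pair over both
        (V, v) and (B, b) has a point over z in its H-fibre, and that point can be pushed to
        B.\<close>
      obtain W w where W: "minimal G W w" "reaches G W w V v" "reaches G W w B b"
        using ex_refinement[OF G V1, of "{(B, b)}"] B by auto
      then obtain q r where q: "q \<in> hom C W V" "act G q w = v" and r: "r \<in> hom C W B"
        unfolding reaches_def by blast
      have "w \<in> fob G W" using W(1) by (simp add: minimal_def)
      then obtain c where "c \<in> fob H W" by (rule minimal_surj[OF V(1) G H q(1) _ q(2) z(1)])
      then have "\<exists>c. c \<in> fob H B" using act_in[OF H r] by blast
      then show ?thesis using False someI_ex[of "\<lambda>c. c \<in> fob H B"] unfolding \<theta>_def by simp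
    qed
    define \<eta> where "\<eta> = (\<lambda>B \<in> Ob C. fin_map (fob G B) (fob H B) (\<theta> B))"
    have \<eta>_top: "\<eta> \<in> topspace ?T"
      unfolding topspace_hom_topology \<eta>_def
      using \<theta>_in finite_fibre G H by (auto intro!: fin_map_hom)
    have \<eta>: "mfun (\<eta> B) (act G g v) = act H g z" if g: "g \<in> hom C V B" for B g
      unfolding \<eta>_def using hom_Ob[OF g] act_in[OF G g V1(2)] \<theta>[OF g] by simp
    have "\<eta> \<in> K (W, w)" if Ww: "(W, w) \<in> X" for W w
    proof -
      obtain q where q: "q \<in> hom C V W" "act G q v = w" using V(3) Ww unfolding reaches_def by fastforce
      show ?thesis
      proof (rule memK[OF \<eta>_top])
        \<comment> \<open>The witness for the union defining \<open>K (W, w)\<close> is the image of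
          z under the arrow that carries v to w.\<close>
        show "act H q z \<in> fob H W" using act_in[OF H q(1) z(1)] .
        show "mfun (\<eta> D) d = y" using \<eta>[OF p(1)] p z by simp
        show "mfun (\<eta> B) (act G g w) = act H g (act H q z)" if g: "g \<in> hom C W B" for B g
          using \<eta>[OF Comp_in_hom[OF q(1) g]] act_Comp[OF G q(1) g V1(2)] act_Comp[OF H q(1) g z(1)] q(2) by simp
      qed
    qed
    then show "\<Inter>\<F> \<noteq> {}" unfolding X(3) by fast
  qed
  then obtain \<eta> where \<eta>: "\<And>W w. W \<in> Ob C \<Longrightarrow> w \<in> fob G W \<Longrightarrow> \<eta> \<in> K (W, w)" unfolding S_def by blast
  have top: "\<eta> \<in> topspace ?T" using \<eta>[OF D] unfolding K_def N_def by auto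
  have \<eta>h: "\<eta> A \<in> hom Fin (fob G A) (fob H A)" if "A \<in> Ob C" for A
    using top that unfolding topspace_hom_topology by auto
  have "is_ntrans C Fin \<lparr>nsrc = G, ntgt = H, ncmp = restrict \<eta> (Ob C)\<rparr>"
  proof (rule ntransI[OF fibreD(1)[OF G] fibreD(1)[OF H] \<eta>h])
    fix f A B assume f: "f \<in> hom C A B"
    have AB: "A \<in> Ob C" "B \<in> Ob C" using hom_Ob[OF f] by auto
    note hG = is_functorD(4)[OF fibreD(1)[OF G] f] and hH = is_functorD(4)[OF fibreD(1)[OF H] f]
    show "\<eta> B \<cdot>\<^bsub>Fin\<^esub> far G f = far H f \<cdot>\<^bsub>Fin\<^esub> \<eta> A"
    proof (rule Fin_eqI[OF Fin_Comp_hom[OF hG \<eta>h[OF AB(2)]] Fin_Comp_hom[OF \<eta>h[OF AB(1)] hH]])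
      fix x assume x: "x \<in> fob G A"
      \<comment> \<open>A single z serves for all arrows out of A: the identity shows that it is the
        value of \<eta> at x, and f then gives the naturality square.\<close>
      obtain z where z: "\<And>B g. g \<in> hom C A B \<Longrightarrow> mfun (\<eta> B) (act G g x) = act H g z" "z \<in> fob H A"
        using K_D[OF \<eta>[OF AB(1) x] AB(1)] by blast
      have "mfun (\<eta> A) x = z"
        using z(1)[OF Id_in_hom[OF AB(1)]] act_Id[OF G AB(1) x] act_Id[OF H AB(1) z(2)] by simp
      then show "mfun (\<eta> B \<cdot>\<^bsub>Fin\<^esub> far G f) x = mfun (far H f \<cdot>\<^bsub>Fin\<^esub> \<eta> A) x"
        using z(1)[OF f] hom_FinD(3)[OF hG] hom_FinD(3)[OF \<eta>h[OF AB(1)]] x by simp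
    qed
  qed
  moreover have "mfun (\<eta> D) d = y" using K_D[OF \<eta>[OF D] D(1)] by blast
  ultimately show ?thesis using D(1) by (intro exI[of _ "\<lparr>nsrc = G, ntgt = H, ncmp = restrict \<eta> (Ob C)\<rparr>"]) simp
qed


section \<open>Realising stable subsets and continuous functors\<close>

text \<open>For members of \<Phi> these are the hom-sets of the fundamental category, available here
  without its topology.\<close>

definition nat_trans :: "('o, 'a, 'u) fin_ftor \<Rightarrow> ('o, 'a, 'u) fin_ftor \<Rightarrow> ('o, 'a, 'u) fin_ntrans set" where
  "nat_trans G H = {\<phi>. is_ntrans C Fin \<phi> \<and> nsrc \<phi> = G \<and> ntgt \<phi> = H}"

lemma nat_trans_in: "\<phi> \<in> nat_trans G H \<Longrightarrow> A \<in> Ob C \<Longrightarrow> x \<in> fob G A \<Longrightarrow> mfun (ncmp \<phi> A) x \<in> fob H A"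
  using fin_ntransD(1)[of C \<phi> A x] by (simp add: nat_trans_def)

lemma nat_trans_act: "\<phi> \<in> nat_trans G H \<Longrightarrow> f \<in> hom C A B \<Longrightarrow> x \<in> fob G A \<Longrightarrow>
    mfun (ncmp \<phi> B) (act G f x) = act H f (mfun (ncmp \<phi> A) x)"
  using fin_ntransD(2)[of C \<phi> f A B x] by (simp add: nat_trans_def)

lemma nat_trans_hom: "\<phi> \<in> nat_trans G H \<Longrightarrow> A \<in> Ob C \<Longrightarrow> ncmp \<phi> A \<in> hom Fin (fob G A) (fob H A)"
  using is_ntransD(3)[of C Fin \<phi> A] by (simp add: nat_trans_def)

lemma nat_trans_Comp:
  assumes "\<phi> \<in> nat_trans G H" "\<psi> \<in> nat_trans H K"
  shows "\<psi> \<cdot>\<^bsub>functor_cat C Fin\<^esub> \<phi> \<in> nat_trans G K"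
    "A \<in> Ob C \<Longrightarrow> x \<in> fob G A \<Longrightarrow>
      mfun (ncmp (\<psi> \<cdot>\<^bsub>functor_cat C Fin\<^esub> \<phi>) A) x = mfun (ncmp \<psi> A) (mfun (ncmp \<phi> A) x)"
proof -
  show "\<psi> \<cdot>\<^bsub>functor_cat C Fin\<^esub> \<phi> \<in> nat_trans G K"
    using assms functor_cat_Comp[of C Fin \<phi> \<psi>] by (simp add: nat_trans_def) (simp add: functor_cat_def)
  assume "A \<in> Ob C" "x \<in> fob G A"
  then show "mfun (ncmp (\<psi> \<cdot>\<^bsub>functor_cat C Fin\<^esub> \<phi>) A) x = mfun (ncmp \<psi> A) (mfun (ncmp \<phi> A) x)"
    using hom_FinD(3)[OF nat_trans_hom[OF assms(1)]] by (simp add: functor_cat_def)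
qed

lemma nat_trans_Id:
  assumes "G \<in> \<Phi>"
  shows "Id (functor_cat C Fin) G \<in> nat_trans G G"
    "A \<in> Ob C \<Longrightarrow> x \<in> fob G A \<Longrightarrow> mfun (ncmp (Id (functor_cat C Fin) G) A) x = x"
  using functor_cat_Id[OF fibreD(1)[OF assms]] by (simp_all add: nat_trans_def) (simp_all add: functor_cat_def)

lemma ex_nat_trans:
  assumes "G \<in> \<Phi>" "H \<in> \<Phi>" "minimal G D d" "y \<in> fob H D"
  obtains \<phi> where "\<phi> \<in> nat_trans G H" "mfun (ncmp \<phi> D) d = y"
  using ex_ntrans[OF assms] that unfolding nat_trans_def by blast

text \<open>Coproducts in the axioms are indexed by natural numbers, so the index set is transported
  along an enumeration. The last two clauses express that each fibre functor preserves the
  coproduct: the inclusions cover the fibre, and functions given on the pieces glue.\<close>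

lemma finite_coproduct:
  assumes "finite K" and X: "\<And>k. k \<in> K \<Longrightarrow> X k \<in> Ob C"
  obtains s \<iota> where "s \<in> Ob C" "\<And>k. k \<in> K \<Longrightarrow> \<iota> k \<in> hom C (X k) s"
    "\<And>t g. t \<in> Ob C \<Longrightarrow> (\<And>k. k \<in> K \<Longrightarrow> g k \<in> hom C (X k) t) \<Longrightarrow> \<exists>h. h \<in> hom C s t \<and> (\<forall>k \<in> K. h \<cdot> \<iota> k = g k)"
    "\<And>G y. G \<in> \<Phi> \<Longrightarrow> y \<in> fob G s \<Longrightarrow> \<exists>k \<in> K. \<exists>x \<in> fob G (X k). act G (\<iota> k) x = y"
    "\<And>G (T :: 'u set) g. G \<in> \<Phi> \<Longrightarrow> finite T \<Longrightarrow> (\<And>k x. k \<in> K \<Longrightarrow> x \<in> fob G (X k) \<Longrightarrow> g k x \<in> T) \<Longrightarrow>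
      \<exists>h. h \<in> fob G s \<rightarrow> T \<and> (\<forall>k \<in> K. \<forall>x \<in> fob G (X k). h (act G (\<iota> k) x) = g k x)"
proof -
  obtain n and e :: "nat \<Rightarrow> _" where e: "bij_betw e {0..<n} K"
    using ex_bij_betw_nat_finite[OF assms(1)] by blast
  define e' where "e' = the_inv_into {0..<n} e"
  have e': "e' k \<in> {0..<n}" "e (e' k) = k" if "k \<in> K" for k
    using that e bij_betwE[OF bij_betw_the_inv_into[OF e]] f_the_inv_into_f_bij_betw[OF e]
    unfolding e'_def by auto
  have eK: "e i \<in> K" if "i \<in> {0..<n}" for i using e that bij_betwE by blast
  have ee: "e' (e i) = i" if "i \<in> {0..<n}" for i
    using that e unfolding e'_def by (simp add: the_inv_into_f_f bij_betw_def)
  obtain s j where c: "is_coproduct C {0..<n} (\<lambda>i. X (e i)) s j"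
  proof -
    have "(\<lambda>i. X (e i)) ` {0..<n} \<subseteq> Ob C" using eK X by blast
    then show ?thesis
      using finite_coproducts finite_atLeastLessThan that unfolding has_finite_coproducts_def by blast
  qed
  have s: "s \<in> Ob C" and j: "\<And>i. i \<in> {0..<n} \<Longrightarrow> j i \<in> hom C (X (e i)) s"
    using c unfolding is_coproduct_def by blast+
  have cU: "\<exists>!h. h \<in> hom C s t \<and> (\<forall>i \<in> {0..<n}. h \<cdot> j i = g i)"
    if "t \<in> Ob C" "\<forall>i \<in> {0..<n}. g i \<in> hom C (X (e i)) t" for t g
    using c that unfolding is_coproduct_def by blast
  have j': "j (e' k) \<in> hom C (X k) s" if "k \<in> K" for k
    using j[OF e'(1)[OF that]] e'(2)[OF that] by simp
  show ?thesis
  proof (rule that[OF s j'])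
    show "\<exists>h. h \<in> hom C s t \<and> (\<forall>k \<in> K. h \<cdot> j (e' k) = g k)"
      if "t \<in> Ob C" "\<And>k. k \<in> K \<Longrightarrow> g k \<in> hom C (X k) t" for t g
    proof -
      have "\<forall>i \<in> {0..<n}. g (e i) \<in> hom C (X (e i)) t" using that eK by blast
      from cU[OF that(1) this] obtain h where h: "h \<in> hom C s t" "\<And>i. i \<in> {0..<n} \<Longrightarrow> h \<cdot> j i = g (e i)" by blast
      have "h \<cdot> j (e' k) = g k" if "k \<in> K" for k using h(2)[OF e'(1)[OF that]] e'(2)[OF that] by simp
      then show ?thesis using h(1) by blast
    qed
    fix G assume G: "G \<in> \<Phi>"
    have cG: "is_coproduct Fin {0..<n} (\<lambda>i. fob G (X (e i))) (fob G s) (\<lambda>i. far G (j i))"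
      using fibreD(3)[OF G] c unfolding preserves_finite_coproducts_def by blast
    have jG: "far G (j i) \<in> hom Fin (fob G (X (e i))) (fob G s)" if "i \<in> {0..<n}" for i
      using is_functorD(4)[OF fibreD(1)[OF G] j[OF that]] .
    have ex1: "\<exists>!h. h \<in> hom Fin (fob G s) T \<and> (\<forall>i \<in> {0..<n}. h \<cdot>\<^bsub>Fin\<^esub> far G (j i) = g i)"
      if "finite T" "\<And>i. i \<in> {0..<n} \<Longrightarrow> g i \<in> hom Fin (fob G (X (e i))) T" for T g
    proof -
      have "T \<in> Ob Fin" "\<forall>i \<in> {0..<n}. g i \<in> hom Fin (fob G (X (e i))) T" using that by auto
      then show ?thesis using cG unfolding is_coproduct_def by blast
    qed
    let ?U = "\<Union>i \<in> {0..<n}. act G (j i) ` fob G (X (e i))"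
    \<comment> \<open>Two maps that agree on the union of the images induce the same maps on the
      summands, and uniqueness in the universal property makes them equal.\<close>
    have "?U = fob G s"
    proof (rule Fin_jointly_epic_imp_cover[OF finite_fibre[OF G s]])
      show "?U \<subseteq> fob G s" using act_in[OF G j] by blast
      fix T h k assume h: "h \<in> hom Fin (fob G s) T" and k: "k \<in> hom Fin (fob G s) T"
        and eq: "\<And>x. x \<in> ?U \<Longrightarrow> mfun h x = mfun k x"
      have "k \<cdot>\<^bsub>Fin\<^esub> far G (j i) = h \<cdot>\<^bsub>Fin\<^esub> far G (j i)" if i: "i \<in> {0..<n}" for i
        by (rule Fin_eqI[OF Fin_Comp_hom[OF jG[OF i] k] Fin_Comp_hom[OF jG[OF i] h]])
          (use eq[OF UN_I[OF i imageI]] hom_FinD(3)[OF jG[OF i]] in simp)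
      moreover have "\<exists>!l. l \<in> hom Fin (fob G s) T \<and> (\<forall>i \<in> {0..<n}. l \<cdot>\<^bsub>Fin\<^esub> far G (j i) = h \<cdot>\<^bsub>Fin\<^esub> far G (j i))"
        by (rule ex1[OF hom_FinD(2)[OF h] Fin_Comp_hom[OF jG h]])
      ultimately show "h = k" using h k by blast
    qed
    then show "\<exists>k \<in> K. \<exists>x \<in> fob G (X k). act G (j (e' k)) x = y" if y: "y \<in> fob G s" for y
    proof -
      have "y \<in> ?U" using \<open>?U = fob G s\<close> y by simp
      then obtain i x where "i \<in> {0..<n}" "x \<in> fob G (X (e i))" "act G (j i) x = y" by blast
      then show ?thesis using eK ee by (intro bexI[of _ "e i"] bexI[of _ x]) auto
    qed
    fix T :: "'u set" and g assume T: "finite T" and g: "\<And>k x. k \<in> K \<Longrightarrow> x \<in> fob G (X k) \<Longrightarrow> g k x \<in> T"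
    have "fin_map (fob G (X (e i))) T (g (e i)) \<in> hom Fin (fob G (X (e i))) T" if "i \<in> {0..<n}" for i
      using finite_fibre[OF G X[OF eK[OF that]]] T g[OF eK[OF that]] by (intro fin_map_hom) auto
    then obtain h where h: "h \<in> hom Fin (fob G s) T"
      "\<And>i. i \<in> {0..<n} \<Longrightarrow> h \<cdot>\<^bsub>Fin\<^esub> far G (j i) = fin_map (fob G (X (e i))) T (g (e i))"
      using ex1[OF T, of "\<lambda>i. fin_map (fob G (X (e i))) T (g (e i))"] by blast
    have "mfun h (act G (j (e' k)) x) = g k x" if k: "k \<in> K" and x: "x \<in> fob G (X k)" for k x
    proof -
      have "x \<in> msrc (far G (j (e' k)))" using hom_FinD(3)[OF jG[OF e'(1)[OF k]]] x e'(2)[OF k] by simp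
      then have "mfun h (act G (j (e' k)) x) = mfun (h \<cdot>\<^bsub>Fin\<^esub> far G (j (e' k))) x" by simp
      then show ?thesis using h(2)[OF e'(1)[OF k]] e'(2)[OF k] x by simp
    qed
    then show "\<exists>h. h \<in> fob G s \<rightarrow> T \<and> (\<forall>k \<in> K. \<forall>x \<in> fob G (X k). h (act G (j (e' k)) x) = g k x)"
      using hom_FinD(5)[OF h(1)] by (intro exI[of _ "mfun h"]) auto
  qed
qed

section \<open>From stable subsets and functors to objects and arrows\<close>

text \<open>One minimal pair is chosen over each point of the finite disjoint union of the sets
  \<open>S G\<close>. The coproduct of these objects maps to A, and the required subobject is the
  image of this map.\<close>

lemma stable_subset:
  assumes A: "A \<in> Ob C" and S: "\<And>G. G \<in> \<Phi> \<Longrightarrow> S G \<subseteq> fob G A"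
    and stable: "\<And>G H \<phi> x. G \<in> \<Phi> \<Longrightarrow> H \<in> \<Phi> \<Longrightarrow> \<phi> \<in> nat_trans G H \<Longrightarrow> x \<in> S G \<Longrightarrow> mfun (ncmp \<phi> A) x \<in> S H"
  obtains B m where "m \<in> hom C B A" "\<And>G. G \<in> \<Phi> \<Longrightarrow> inj_on (act G m) (fob G B)"
    "\<And>G. G \<in> \<Phi> \<Longrightarrow> act G m ` fob G B = S G"
proof -
  let ?K = "Sigma \<Phi> S"
  have fin: "finite ?K" using finite_family finite_subset[OF S finite_fibre[OF _ A]] by blast
  have "\<exists>D d m. minimal (fst k) D d \<and> m \<in> hom C D A \<and> act (fst k) m d = snd k" if "k \<in> ?K" for k
  proof -
    have k: "fst k \<in> \<Phi>" "snd k \<in> fob (fst k) A" using that S[of "fst k"] by auto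
    show ?thesis using ex_minimal[OF k(1) A k(2)] by metis
  qed
  then obtain D d m where D: "\<And>k. k \<in> ?K \<Longrightarrow> minimal (fst k) (D k) (d k)"
    and m: "\<And>k. k \<in> ?K \<Longrightarrow> m k \<in> hom C (D k) A" and d: "\<And>k. k \<in> ?K \<Longrightarrow> act (fst k) (m k) (d k) = snd k"
    by metis
  have Dob: "D k \<in> Ob C" "d k \<in> fob (fst k) (D k)" if "k \<in> ?K" for k using D[OF that] by (auto simp: minimal_def)
  obtain E \<iota> where E: "E \<in> Ob C" and \<iota>: "\<And>k. k \<in> ?K \<Longrightarrow> \<iota> k \<in> hom C (D k) E"
    and copair: "\<And>t g. t \<in> Ob C \<Longrightarrow> (\<And>k. k \<in> ?K \<Longrightarrow> g k \<in> hom C (D k) t) \<Longrightarrow> \<exists>h. h \<in> hom C E t \<and> (\<forall>k \<in> ?K. h \<cdot> \<iota> k = g k)"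
    and cover: "\<And>G y. G \<in> \<Phi> \<Longrightarrow> y \<in> fob G E \<Longrightarrow> \<exists>k \<in> ?K. \<exists>x \<in> fob G (D k). act G (\<iota> k) x = y"
    by (rule finite_coproduct[OF fin, of D, OF Dob(1)]) blast+
  obtain h where h: "h \<in> hom C E A" "\<And>k. k \<in> ?K \<Longrightarrow> h \<cdot> \<iota> k = m k" using copair[OF A m] by blast
  have hi: "act H h (act H (\<iota> k) y) = act H (m k) y" if "H \<in> \<Phi>" "k \<in> ?K" "y \<in> fob H (D k)" for H k y
    using act_Comp[OF that(1) \<iota>[OF that(2)] h(1) that(3)] h(2)[OF that(2)] by simp
  have im: "act H h ` fob H E = S H" if H: "H \<in> \<Phi>" for H
  proof
    \<comment> \<open>Each element y in the H-fibre of a summand is the value at its minimal element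
      of some transformation; naturality moves this to A, where stability puts the image of y in
      \<open>S H\<close>.\<close>
    show "act H h ` fob H E \<subseteq> S H"
    proof
      fix z assume "z \<in> act H h ` fob H E"
      then obtain y where "y \<in> fob H E" "z = act H h y" by blast
      then obtain k y where k: "k \<in> ?K" and y: "y \<in> fob H (D k)" "z = act H h (act H (\<iota> k) y)"
        using cover[OF H] by blast
      have G: "fst k \<in> \<Phi>" "snd k \<in> S (fst k)" using k by auto
      obtain \<phi> where \<phi>: "\<phi> \<in> nat_trans (fst k) H" "mfun (ncmp \<phi> (D k)) (d k) = y"
        by (rule ex_nat_trans[OF G(1) H D[OF k] y(1)])
      have "z = mfun (ncmp \<phi> A) (snd k)"
        using nat_trans_act[OF \<phi>(1) m[OF k] Dob(2)[OF k]] d[OF k] \<phi>(2) y hi[OF H k] by simp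
      then show "z \<in> S H" using stable[OF G(1) H \<phi>(1) G(2)] by simp
    qed
    show "S H \<subseteq> act H h ` fob H E"
    proof
      fix x assume x: "x \<in> S H"
      then have k: "(H, x) \<in> ?K" using H by blast
      have "act H h (act H (\<iota> (H, x)) (d (H, x))) = x" using hi[OF H k] Dob(2)[OF k] d[OF k] by simp
      moreover have "act H (\<iota> (H, x)) (d (H, x)) \<in> fob H E" using act_in[OF H \<iota>[OF k]] Dob(2)[OF k] by simp
      ultimately show "x \<in> act H h ` fob H E" by (metis imageI)
    qed
  qed
  obtain Q q n where q: "q \<in> hom C E Q" "n \<in> hom C Q A" "n \<cdot> q = h"
    "\<And>G. G \<in> \<Phi> \<Longrightarrow> act G q ` fob G E = fob G Q" "\<And>G. G \<in> \<Phi> \<Longrightarrow> inj_on (act G n) (fob G Q)"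
    by (rule image_factorisation[OF h(1)]) blast
  have "act H n ` fob H Q = S H" if H: "H \<in> \<Phi>" for H
  proof -
    have "act H n ` (act H q ` fob H E) = act H h ` fob H E"
      using act_Comp[OF H q(1,2)] q(3) by (simp add: image_image)
    then show ?thesis using q(4)[OF H] im[OF H] by simp
  qed
  then show ?thesis using that[OF q(2,5)] by blast
qed

text \<open>The graph of \<tau> is a stable subset of the fibres of the product of A and B, hence a
  subobject. Its projection to A is bijective on fibres and so invertible; the inverse followed by
  the projection to B is the arrow.\<close>

lemma ex_arrow_of_natural:
  assumes A: "A \<in> Ob C" and B: "B \<in> Ob C"
    and \<tau>: "\<And>G x. G \<in> \<Phi> \<Longrightarrow> x \<in> fob G A \<Longrightarrow> \<tau> G x \<in> fob G B"
    and nat: "\<And>G H \<phi> x. G \<in> \<Phi> \<Longrightarrow> H \<in> \<Phi> \<Longrightarrow> \<phi> \<in> nat_trans G H \<Longrightarrow> x \<in> fob G A \<Longrightarrow>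
      \<tau> H (mfun (ncmp \<phi> A) x) = mfun (ncmp \<phi> B) (\<tau> G x)"
  obtains f where "f \<in> hom C A B" "\<And>G x. G \<in> \<Phi> \<Longrightarrow> x \<in> fob G A \<Longrightarrow> act G f x = \<tau> G x"
proof -
  obtain P p q where p: "p \<in> hom C P A" and q: "q \<in> hom C P B"
    and el: "\<And>G x y. G \<in> \<Phi> \<Longrightarrow> x \<in> fob G A \<Longrightarrow> y \<in> fob G B \<Longrightarrow> \<exists>z. z \<in> fob G P \<and> act G p z = x \<and> act G q z = y"
    and uniq: "\<And>G z w. G \<in> \<Phi> \<Longrightarrow> z \<in> fob G P \<Longrightarrow> w \<in> fob G P \<Longrightarrow> act G p z = act G p w \<Longrightarrow> act G q z = act G q w \<Longrightarrow> z = w"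
    by (rule binary_product[OF A B]) blast
  have P: "P \<in> Ob C" using hom_Ob[OF p] by blast
  let ?S = "\<lambda>G. {z \<in> fob G P. act G q z = \<tau> G (act G p z)}"
  obtain R m where m: "m \<in> hom C R P" and m_inj: "\<And>G. G \<in> \<Phi> \<Longrightarrow> inj_on (act G m) (fob G R)"
    and m_im: "\<And>G. G \<in> \<Phi> \<Longrightarrow> act G m ` fob G R = ?S G"
  proof (rule stable_subset[OF P, of ?S])
    show "?S G \<subseteq> fob G P" for G by blast
    show "mfun (ncmp \<phi> P) z \<in> ?S H" if G: "G \<in> \<Phi>" "H \<in> \<Phi>" and \<phi>: "\<phi> \<in> nat_trans G H" and z: "z \<in> ?S G" for G H \<phi> z
    proof -
      have z': "z \<in> fob G P" "act G q z = \<tau> G (act G p z)" using z by auto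
      show ?thesis
        using nat_trans_in[OF \<phi> P z'(1)] nat_trans_act[OF \<phi> p z'(1)] nat_trans_act[OF \<phi> q z'(1)] z'(2)
          nat[OF G \<phi> act_in[OF G(1) p z'(1)]] by simp
    qed
  qed blast
  have pm: "p \<cdot> m \<in> hom C R A" "q \<cdot> m \<in> hom C R B" using Comp_in_hom m p q by blast+
  have pm_act: "act G (p \<cdot> m) z = act G p (act G m z)" "act G (q \<cdot> m) z = act G q (act G m z)"
     "act G q (act G m z) = \<tau> G (act G p (act G m z))" "act G m z \<in> fob G P" if "G \<in> \<Phi>" "z \<in> fob G R" for G z
    using act_Comp[OF that(1) m p that(2)] act_Comp[OF that(1) m q that(2)] m_im[OF that(1)] that(2) by auto
  have "bij_betw (act G (p \<cdot> m)) (fob G R) (fob G A)" if G: "G \<in> \<Phi>" for G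
  proof -
    have "inj_on (act G (p \<cdot> m)) (fob G R)"
    proof (rule inj_onI)
      fix z w assume zw: "z \<in> fob G R" "w \<in> fob G R" "act G (p \<cdot> m) z = act G (p \<cdot> m) w"
      have "act G m z = act G m w"
        by (rule uniq[OF G]) (use zw pm_act[OF G] in auto)
      then show "z = w" using inj_onD[OF m_inj[OF G]] zw by blast
    qed
    moreover have "x \<in> act G (p \<cdot> m) ` fob G R" if x: "x \<in> fob G A" for x
    proof -
      obtain z where z: "z \<in> fob G P" "act G p z = x" "act G q z = \<tau> G x" using el[OF G x \<tau>[OF G x]] by blast
      then have "z \<in> act G m ` fob G R" using m_im[OF G] by simp
      then obtain w where "w \<in> fob G R" "act G m w = z" by blast
      then show ?thesis using pm_act(1)[OF G] z by (metis imageI)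
    qed
    moreover have "act G (p \<cdot> m) ` fob G R \<subseteq> fob G A" using act_in[OF G pm(1)] by blast
    ultimately show ?thesis unfolding bij_betw_def by blast
  qed
  then obtain k where k: "k \<in> hom C A R" "(p \<cdot> m) \<cdot> k = Id C A" by (rule iso_if_bij[OF pm(1)])
  show ?thesis
  proof (rule that[OF Comp_in_hom[OF k(1) pm(2)]])
    fix G x assume G: "G \<in> \<Phi>" and x: "x \<in> fob G A"
    have kx: "act G k x \<in> fob G R" using act_in[OF G k(1) x] .
    have "act G p (act G m (act G k x)) = x"
      using act_Comp[OF G k(1) pm(1) x] k(2) act_Id[OF G A x] pm_act(1)[OF G kx] by simp
    then show "act G ((q \<cdot> m) \<cdot> k) x = \<tau> G x"
      using act_Comp[OF G k(1) pm(2) x] pm_act[OF G kx] by simp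
  qed
qed

text \<open>Here (\<Gamma>, \<alpha>) is a functor on the fundamental category given by bare sets
  and functions, and \<open>cts\<close> is the form of continuity that the argument consumes.
  Representability is reached by covering \<Gamma> with evaluations and dividing by the
  kernel.\<close>

lemma ex_object_of_functor:
  fixes \<Gamma> :: "('o, 'a, 'u) fin_ftor \<Rightarrow> 'u set" and \<alpha> :: "('o, 'a, 'u) fin_ntrans \<Rightarrow> 'u \<Rightarrow> 'u"
  assumes fin: "\<And>G. G \<in> \<Phi> \<Longrightarrow> finite (\<Gamma> G)"
    and \<alpha>_in: "\<And>G H \<phi> x. G \<in> \<Phi> \<Longrightarrow> H \<in> \<Phi> \<Longrightarrow> \<phi> \<in> nat_trans G H \<Longrightarrow> x \<in> \<Gamma> G \<Longrightarrow> \<alpha> \<phi> x \<in> \<Gamma> H"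
    and \<alpha>_Comp: "\<And>G H K \<phi> \<psi> x. G \<in> \<Phi> \<Longrightarrow> H \<in> \<Phi> \<Longrightarrow> K \<in> \<Phi> \<Longrightarrow> \<phi> \<in> nat_trans G H \<Longrightarrow> \<psi> \<in> nat_trans H K \<Longrightarrow> x \<in> \<Gamma> G \<Longrightarrow>
      \<alpha> (\<psi> \<cdot>\<^bsub>functor_cat C Fin\<^esub> \<phi>) x = \<alpha> \<psi> (\<alpha> \<phi> x)"
    and \<alpha>_Id: "\<And>G x. G \<in> \<Phi> \<Longrightarrow> x \<in> \<Gamma> G \<Longrightarrow> \<alpha> (Id (functor_cat C Fin) G) x = x"
    and cts: "\<And>G H x. G \<in> \<Phi> \<Longrightarrow> H \<in> \<Phi> \<Longrightarrow> x \<in> \<Gamma> G \<Longrightarrow> \<exists>X. finite X \<and> X \<subseteq> Ob C \<and>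
      (\<forall>\<phi> \<in> nat_trans G H. \<forall>\<psi> \<in> nat_trans G H. (\<forall>A \<in> X. ncmp \<phi> A = ncmp \<psi> A) \<longrightarrow> \<alpha> \<phi> x = \<alpha> \<psi> x)"
  obtains Q \<tau> where "Q \<in> Ob C" "\<And>G. G \<in> \<Phi> \<Longrightarrow> bij_betw (\<tau> G) (fob G Q) (\<Gamma> G)"
    "\<And>G H \<phi> x. G \<in> \<Phi> \<Longrightarrow> H \<in> \<Phi> \<Longrightarrow> \<phi> \<in> nat_trans G H \<Longrightarrow> x \<in> fob G Q \<Longrightarrow>
      \<tau> H (mfun (ncmp \<phi> Q) x) = \<alpha> \<phi> (\<tau> G x)"
proof -
  \<comment> \<open>Such a \<sigma> is a natural map from evaluation at D to (\<Gamma>,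
    \<alpha>).\<close>
  define natural where "natural = (\<lambda>D \<sigma>. D \<in> Ob C \<and> (\<forall>H \<in> \<Phi>. \<forall>y \<in> fob H D. \<sigma> H y \<in> \<Gamma> H) \<and>
    (\<forall>H \<in> \<Phi>. \<forall>K \<in> \<Phi>. \<forall>\<psi> \<in> nat_trans H K. \<forall>y \<in> fob H D. \<sigma> K (mfun (ncmp \<psi> D) y) = \<alpha> \<psi> (\<sigma> H y)))"
  \<comment> \<open>In the manner of the Yoneda lemma, x is hit by the map that sends the value of
    \<phi> at d to \<alpha> \<phi> x, provided that this depends on the value at d alone.\<close>
  have piece: "\<exists>D \<sigma> d. natural D \<sigma> \<and> d \<in> fob G D \<and> \<sigma> G d = x" if G: "G \<in> \<Phi>" and x: "x \<in> \<Gamma> G" for G x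
  proof -
    obtain X where X: "\<And>H. H \<in> \<Phi> \<Longrightarrow> finite (X H)" "\<And>H. H \<in> \<Phi> \<Longrightarrow> X H \<subseteq> Ob C"
      "\<And>H \<phi> \<psi>. H \<in> \<Phi> \<Longrightarrow> \<phi> \<in> nat_trans G H \<Longrightarrow> \<psi> \<in> nat_trans G H \<Longrightarrow> (\<forall>A \<in> X H. ncmp \<phi> A = ncmp \<psi> A) \<Longrightarrow> \<alpha> \<phi> x = \<alpha> \<psi> x"
      using cts[OF G _ x] by metis
    \<comment> \<open>The one-point fibre of a terminal object supplies the pair with which the
      refinement starts.\<close>
    obtain T t where T: "T \<in> Ob C" "t \<in> fob G T"
      by (rule terminal_object) (use G in blast)
    \<comment> \<open>All elements of all coordinates that matter, for every target fibre at once.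
      If d reaches each of them, the value of a transformation at d determines those coordinates
      completely.\<close>
    let ?Y = "Sigma (\<Union>H \<in> \<Phi>. X H) (fob G)"
    have Y: "A \<in> Ob C \<and> a \<in> fob G A" if "(A, a) \<in> ?Y" for A a using that X(2) by blast
    have "finite ?Y" using finite_family X finite_fibre[OF G] by (intro finite_SigmaI finite_UN_I) blast+
    then obtain D d where D: "minimal G D d" "\<forall>(A, a) \<in> ?Y. reaches G D d A a"
      using ex_refinement[OF G T, of ?Y] Y by blast
    have D1: "D \<in> Ob C" "d \<in> fob G D" using D(1) by (auto simp: minimal_def)
    have det: "\<alpha> \<phi> x = \<alpha> \<psi> x"
      if H: "H \<in> \<Phi>" and \<phi>: "\<phi> \<in> nat_trans G H" and \<psi>: "\<psi> \<in> nat_trans G H" and eq: "mfun (ncmp \<phi> D) d = mfun (ncmp \<psi> D) d" for H \<phi> \<psi>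
    proof (rule X(3)[OF H \<phi> \<psi>], rule ballI)
      fix A assume A: "A \<in> X H"
      then have A1: "A \<in> Ob C" using X(2)[OF H] by blast
      show "ncmp \<phi> A = ncmp \<psi> A"
      proof (rule Fin_eqI[OF nat_trans_hom[OF \<phi> A1] nat_trans_hom[OF \<psi> A1]])
        fix a assume "a \<in> fob G A"
        then have "(A, a) \<in> ?Y" using A H by blast
        then obtain p where "p \<in> hom C D A" "act G p d = a" using D(2) unfolding reaches_def by fastforce
        then show "mfun (ncmp \<phi> A) a = mfun (ncmp \<psi> A) a"
          using nat_trans_act[OF \<phi> _ D1(2)] nat_trans_act[OF \<psi> _ D1(2)] eq by metis
      qed
    qed
    \<comment> \<open>Every y arises as a value at d because d is minimal, and \<open>det\<close>
      makes the result independent of the transformation chosen.\<close>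
    define \<sigma> where "\<sigma> = (\<lambda>H y. \<alpha> (SOME \<phi>. \<phi> \<in> nat_trans G H \<and> mfun (ncmp \<phi> D) d = y) x)"
    have \<sigma>: "\<sigma> H (mfun (ncmp \<phi> D) d) = \<alpha> \<phi> x" if H: "H \<in> \<Phi>" and \<phi>: "\<phi> \<in> nat_trans G H" for H \<phi>
    proof -
      let ?\<psi> = "SOME \<psi>. \<psi> \<in> nat_trans G H \<and> mfun (ncmp \<psi> D) d = mfun (ncmp \<phi> D) d"
      have "?\<psi> \<in> nat_trans G H \<and> mfun (ncmp ?\<psi> D) d = mfun (ncmp \<phi> D) d" by (rule someI[of _ \<phi>]) (use \<phi> in blast)
      then show ?thesis unfolding \<sigma>_def using det[OF H _ \<phi>] by blast
    qed
    have "natural D \<sigma>"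
      unfolding natural_def
    proof (intro conjI ballI D1(1))
      fix H y assume H: "H \<in> \<Phi>" and y: "y \<in> fob H D"
      obtain \<phi> where \<phi>: "\<phi> \<in> nat_trans G H" "mfun (ncmp \<phi> D) d = y" by (rule ex_nat_trans[OF G H D(1) y])
      show "\<sigma> H y \<in> \<Gamma> H" using \<sigma>[OF H \<phi>(1)] \<phi>(2) \<alpha>_in[OF G H \<phi>(1) x] by simp
      fix K \<psi> assume K: "K \<in> \<Phi>" and \<psi>: "\<psi> \<in> nat_trans H K"
      show "\<sigma> K (mfun (ncmp \<psi> D) y) = \<alpha> \<psi> (\<sigma> H y)"
        using \<sigma>[OF K nat_trans_Comp(1)[OF \<phi>(1) \<psi>]] nat_trans_Comp(2)[OF \<phi>(1) \<psi> D1] \<phi>(2) \<sigma>[OF H \<phi>(1)]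
          \<alpha>_Comp[OF G H K \<phi>(1) \<psi> x] by simp
    qed
    moreover have "\<sigma> G d = x"
      using \<sigma>[OF G nat_trans_Id(1)[OF G]] nat_trans_Id(2)[OF G D1] \<alpha>_Id[OF G x] by simp
    ultimately show ?thesis using D1 by blast
  qed
  have "\<exists>E \<sigma>. natural E \<sigma> \<and> (\<forall>G \<in> \<Phi>. \<forall>x \<in> \<Gamma> G. \<exists>y \<in> fob G E. \<sigma> G y = x)"
  proof -
    let ?K = "Sigma \<Phi> \<Gamma>"
    have finK: "finite ?K" using finite_family fin by blast
    have "\<exists>D \<sigma> d. natural D \<sigma> \<and> d \<in> fob (fst k) D \<and> \<sigma> (fst k) d = snd k" if "k \<in> ?K" for k
      using piece[of "fst k" "snd k"] that by auto
    then obtain D s d where nat: "\<And>k. k \<in> ?K \<Longrightarrow> natural (D k) (s k)"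
      and d: "\<And>k. k \<in> ?K \<Longrightarrow> d k \<in> fob (fst k) (D k)" "\<And>k. k \<in> ?K \<Longrightarrow> s k (fst k) (d k) = snd k"
      by metis
    have D: "D k \<in> Ob C" if "k \<in> ?K" for k using nat[OF that] by (simp add: natural_def)
    obtain E \<iota> where E: "E \<in> Ob C" and \<iota>: "\<And>k. k \<in> ?K \<Longrightarrow> \<iota> k \<in> hom C (D k) E"
      and cover: "\<And>G y. G \<in> \<Phi> \<Longrightarrow> y \<in> fob G E \<Longrightarrow> \<exists>k \<in> ?K. \<exists>x \<in> fob G (D k). act G (\<iota> k) x = y"
      and copair: "\<And>G (T :: 'u set) g. G \<in> \<Phi> \<Longrightarrow> finite T \<Longrightarrow> (\<And>k x. k \<in> ?K \<Longrightarrow> x \<in> fob G (D k) \<Longrightarrow> g k x \<in> T) \<Longrightarrow>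
        \<exists>h. h \<in> fob G E \<rightarrow> T \<and> (\<forall>k \<in> ?K. \<forall>x \<in> fob G (D k). h (act G (\<iota> k) x) = g k x)"
      by (rule finite_coproduct[OF finK, of D, OF D]) blast+
    \<comment> \<open>The maps from the summands are glued on the fibres, where they are mere
      functions with values in \<Gamma>; no arrow of C is involved.\<close>
    have "\<exists>h. h \<in> fob G E \<rightarrow> \<Gamma> G \<and> (\<forall>k \<in> ?K. \<forall>x \<in> fob G (D k). h (act G (\<iota> k) x) = s k G x)" if G: "G \<in> \<Phi>" for G
    proof (rule copair[OF G fin[OF G]])
      show "s k G x \<in> \<Gamma> G" if "k \<in> ?K" "x \<in> fob G (D k)" for k x
        using nat[OF that(1)] that(2) G unfolding natural_def by blast
    qed
    then obtain \<sigma> where \<sigma>: "\<And>G. G \<in> \<Phi> \<Longrightarrow> \<sigma> G \<in> fob G E \<rightarrow> \<Gamma> G"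
      "\<And>G k x. G \<in> \<Phi> \<Longrightarrow> k \<in> ?K \<Longrightarrow> x \<in> fob G (D k) \<Longrightarrow> \<sigma> G (act G (\<iota> k) x) = s k G x"
      by metis
    have "natural E \<sigma>"
      unfolding natural_def
    proof (intro conjI ballI E)
      fix H y assume H: "H \<in> \<Phi>" and y: "y \<in> fob H E"
      show "\<sigma> H y \<in> \<Gamma> H" using \<sigma>(1)[OF H] y by blast
      fix K \<psi> assume K: "K \<in> \<Phi>" and \<psi>: "\<psi> \<in> nat_trans H K"
      obtain k x where k: "k \<in> ?K" and x: "x \<in> fob H (D k)" "act H (\<iota> k) x = y" using cover[OF H y] by blast
      have "s k K (mfun (ncmp \<psi> (D k)) x) = \<alpha> \<psi> (s k H x)"
        using nat[OF k] H K \<psi> x unfolding natural_def by blast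
      then show "\<sigma> K (mfun (ncmp \<psi> E) y) = \<alpha> \<psi> (\<sigma> H y)"
        using nat_trans_act[OF \<psi> \<iota>[OF k] x(1)] \<sigma>(2)[OF H k x(1)] \<sigma>(2)[OF K k nat_trans_in[OF \<psi> D[OF k] x(1)]] x(2) by simp
    qed
    moreover have "\<exists>y \<in> fob G E. \<sigma> G y = x" if G: "G \<in> \<Phi>" and x: "x \<in> \<Gamma> G" for G x
    proof -
      have k: "(G, x) \<in> ?K" using G x by blast
      have d': "d (G, x) \<in> fob G (D (G, x))" "s (G, x) G (d (G, x)) = x" using d[OF k] by simp_all
      then show ?thesis using \<sigma>(2)[OF G k d'(1)] act_in[OF G \<iota>[OF k] d'(1)] by (metis)
    qed
    ultimately show ?thesis by blast
  qed
  then obtain E \<sigma> where nat: "natural E \<sigma>" and surj: "\<And>G x. G \<in> \<Phi> \<Longrightarrow> x \<in> \<Gamma> G \<Longrightarrow> \<exists>y \<in> fob G E. \<sigma> G y = x"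
    by blast
  have E: "E \<in> Ob C" and \<sigma>_in: "\<And>H y. H \<in> \<Phi> \<Longrightarrow> y \<in> fob H E \<Longrightarrow> \<sigma> H y \<in> \<Gamma> H"
    and \<sigma>_nat: "\<And>H K \<psi> y. H \<in> \<Phi> \<Longrightarrow> K \<in> \<Phi> \<Longrightarrow> \<psi> \<in> nat_trans H K \<Longrightarrow> y \<in> fob H E \<Longrightarrow> \<sigma> K (mfun (ncmp \<psi> E) y) = \<alpha> \<psi> (\<sigma> H y)"
    using nat unfolding natural_def by blast+
  obtain P p q where p: "p \<in> hom C P E" and q: "q \<in> hom C P E"
    and el: "\<And>G x y. G \<in> \<Phi> \<Longrightarrow> x \<in> fob G E \<Longrightarrow> y \<in> fob G E \<Longrightarrow> \<exists>z. z \<in> fob G P \<and> act G p z = x \<and> act G q z = y"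
    and uniq: "\<And>G z w. G \<in> \<Phi> \<Longrightarrow> z \<in> fob G P \<Longrightarrow> w \<in> fob G P \<Longrightarrow> act G p z = act G p w \<Longrightarrow> act G q z = act G q w \<Longrightarrow> z = w"
    by (rule binary_product[OF E E]) blast
  have P: "P \<in> Ob C" using hom_Ob[OF p] by blast
  \<comment> \<open>The kernel of the cover, as a subset of the fibres of the product of E with
    itself. It is stable because \<sigma> is natural.\<close>
  let ?S = "\<lambda>G. {z \<in> fob G P. \<sigma> G (act G p z) = \<sigma> G (act G q z)}"
  let ?rel = "\<lambda>G. {(x, y). x \<in> fob G E \<and> y \<in> fob G E \<and> \<sigma> G x = \<sigma> G y}"
  obtain R m where m: "m \<in> hom C R P" and m_inj: "\<And>G. G \<in> \<Phi> \<Longrightarrow> inj_on (act G m) (fob G R)"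
    and m_im: "\<And>G. G \<in> \<Phi> \<Longrightarrow> act G m ` fob G R = ?S G"
  proof (rule stable_subset[OF P, of ?S])
    show "?S G \<subseteq> fob G P" for G by blast
    show "mfun (ncmp \<phi> P) z \<in> ?S H" if G: "G \<in> \<Phi>" "H \<in> \<Phi>" and \<phi>: "\<phi> \<in> nat_trans G H" and z: "z \<in> ?S G" for G H \<phi> z
    proof -
      have z': "z \<in> fob G P" "\<sigma> G (act G p z) = \<sigma> G (act G q z)" using z by auto
      show ?thesis
        using nat_trans_in[OF \<phi> P z'(1)] nat_trans_act[OF \<phi> p z'(1), symmetric] nat_trans_act[OF \<phi> q z'(1), symmetric] z'(2)
          \<sigma>_nat[OF G \<phi> act_in[OF G(1) p z'(1)]] \<sigma>_nat[OF G \<phi> act_in[OF G(1) q z'(1)]] by simp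
    qed
  qed blast
  have pm: "p \<cdot> m \<in> hom C R E" "q \<cdot> m \<in> hom C R E" using Comp_in_hom m p q by blast+
  have pm_act: "act G (p \<cdot> m) z = act G p (act G m z)" "act G (q \<cdot> m) z = act G q (act G m z)"
     "\<sigma> G (act G p (act G m z)) = \<sigma> G (act G q (act G m z))" "act G m z \<in> fob G P" if "G \<in> \<Phi>" "z \<in> fob G R" for G z
    using act_Comp[OF that(1) m p that(2)] act_Comp[OF that(1) m q that(2)] m_im[OF that(1)] that(2) by auto
  obtain Q k where k: "k \<in> hom C E Q" "\<And>G. G \<in> \<Phi> \<Longrightarrow> act G k ` fob G E = fob G Q"
    "\<And>G x y. G \<in> \<Phi> \<Longrightarrow> x \<in> fob G E \<Longrightarrow> y \<in> fob G E \<Longrightarrow> act G k x = act G k y \<longleftrightarrow> (x, y) \<in> ?rel G"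
  proof (rule quotient[OF pm, of ?rel])
    show "equiv (fob G E) (?rel G)" for G
      by (auto intro!: equivI simp: refl_on_def sym_def trans_def)
    show "z = w" if G: "G \<in> \<Phi>" and zw: "z \<in> fob G R" "w \<in> fob G R" "act G (p \<cdot> m) z = act G (p \<cdot> m) w"
      "act G (q \<cdot> m) z = act G (q \<cdot> m) w" for G z w
    proof -
      have "act G m z = act G m w" by (rule uniq[OF G]) (use zw pm_act[OF G] in auto)
      then show ?thesis using inj_onD[OF m_inj[OF G]] zw by blast
    qed
    show "(\<lambda>z. (act G (p \<cdot> m) z, act G (q \<cdot> m) z)) ` fob G R = ?rel G" if G: "G \<in> \<Phi>" for G
    proof
      show "(\<lambda>z. (act G (p \<cdot> m) z, act G (q \<cdot> m) z)) ` fob G R \<subseteq> ?rel G"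
        using pm_act[OF G] act_in[OF G p] act_in[OF G q] by auto
      show "?rel G \<subseteq> (\<lambda>z. (act G (p \<cdot> m) z, act G (q \<cdot> m) z)) ` fob G R"
      proof clarify
        fix x y assume xy: "x \<in> fob G E" "y \<in> fob G E" "\<sigma> G x = \<sigma> G y"
        then obtain z where z: "z \<in> fob G P" "act G p z = x" "act G q z = y" using el[OF G] by blast
        then have "z \<in> act G m ` fob G R" using m_im[OF G] xy by simp
        then obtain w where "w \<in> fob G R" "act G m w = z" by blast
        then show "(x, y) \<in> (\<lambda>z. (act G (p \<cdot> m) z, act G (q \<cdot> m) z)) ` fob G R"
          using pm_act(1,2)[OF G] z by (intro image_eqI[of _ _ w]) auto
      qed
    qed
  qed blast
  have Q: "Q \<in> Ob C" using hom_Ob[OF k(1)] by blast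
  \<comment> \<open>The map \<sigma> descends to the quotient, since points with the same class have
    the same \<sigma>-value; it becomes injective there and stays surjective.\<close>
  define \<tau> where "\<tau> = (\<lambda>G u. \<sigma> G (SOME y. y \<in> fob G E \<and> act G k y = u))"
  have \<tau>: "\<tau> G (act G k y) = \<sigma> G y" if G: "G \<in> \<Phi>" and y: "y \<in> fob G E" for G y
  proof -
    let ?w = "SOME w. w \<in> fob G E \<and> act G k w = act G k y"
    have "?w \<in> fob G E \<and> act G k ?w = act G k y" by (rule someI[of _ y]) (use y in blast)
    then have "(?w, y) \<in> ?rel G" using k(3)[OF G _ y] by blast
    then show ?thesis unfolding \<tau>_def by blast
  qed
  have preim: "\<exists>y \<in> fob G E. act G k y = u" if "G \<in> \<Phi>" "u \<in> fob G Q" for G u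
  proof -
    have "u \<in> act G k ` fob G E" using k(2)[OF that(1)] that(2) by simp
    then show ?thesis by blast
  qed
  show ?thesis
  proof (rule that[OF Q])
    fix G assume G: "G \<in> \<Phi>"
    have "inj_on (\<tau> G) (fob G Q)"
    proof (rule inj_onI)
      fix u v assume u: "u \<in> fob G Q" and v: "v \<in> fob G Q" and eq: "\<tau> G u = \<tau> G v"
      obtain x y where x: "x \<in> fob G E" "act G k x = u" and y: "y \<in> fob G E" "act G k y = v"
        using preim[OF G u] preim[OF G v] by blast
      have "\<sigma> G x = \<sigma> G y" using \<tau>[OF G x(1)] \<tau>[OF G y(1)] x y eq by simp
      then have "(x, y) \<in> ?rel G" using x y by blast
      then show "u = v" using k(3)[OF G x(1) y(1)] x y by simp
    qed
    moreover have "\<tau> G ` fob G Q = \<Gamma> G"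
    proof
      show "\<tau> G ` fob G Q \<subseteq> \<Gamma> G" using preim[OF G] \<tau>[OF G] \<sigma>_in[OF G] by fastforce
      show "\<Gamma> G \<subseteq> \<tau> G ` fob G Q"
      proof
        fix x assume "x \<in> \<Gamma> G"
        then obtain y where y: "y \<in> fob G E" "\<sigma> G y = x" using surj[OF G] by blast
        then show "x \<in> \<tau> G ` fob G Q" using \<tau>[OF G y(1)] act_in[OF G k(1) y(1)] by (intro image_eqI[of _ _ "act G k y"]) auto
      qed
    qed
    ultimately show "bij_betw (\<tau> G) (fob G Q) (\<Gamma> G)" unfolding bij_betw_def by blast
    fix H \<phi> u assume H: "H \<in> \<Phi>" and \<phi>: "\<phi> \<in> nat_trans G H" and u: "u \<in> fob G Q"
    obtain y where y: "y \<in> fob G E" "act G k y = u" using preim[OF G u] by blast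
    show "\<tau> H (mfun (ncmp \<phi> Q) u) = \<alpha> \<phi> (\<tau> G u)"
      using nat_trans_act[OF \<phi> k(1) y(1)] \<tau>[OF H nat_trans_in[OF \<phi> E y(1)]] \<tau>[OF G y(1)] \<sigma>_nat[OF G H \<phi> y(1)] y(2) by simp
  qed
qed

end

section \<open>The fundamental category and the evaluation functor\<close>

lemma is_iso_full_subcat:
  assumes "is_iso C f" "Dom C f \<in> S" "Cod C f \<in> S"
  shows "is_iso (full_subcat C S) f"
  using assms by (auto simp: is_iso_def full_subcat_def hom_def)

text \<open>The map factors through the pair (a, b) into a discrete product, from which every map is
  continuous.\<close>

lemma continuous_map_discrete_factor:
  assumes a: "continuous_map X (discrete_topology S) a" and b: "continuous_map X (discrete_topology T) b"
    and f: "\<And>x. x \<in> topspace X \<Longrightarrow> f x = h (a x) (b x)" and U: "\<And>x. x \<in> topspace X \<Longrightarrow> f x \<in> U"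
  shows "continuous_map X (discrete_topology U) f"
  unfolding continuous_map_def
proof (intro conjI allI impI)
  show "f \<in> topspace X \<rightarrow> topspace (discrete_topology U)" using U by simp
  fix V assume "openin (discrete_topology U) V"
  have "continuous_map X (discrete_topology (S \<times> T)) (\<lambda>x. (a x, b x))"
    unfolding prod_topology_discrete_topology using a b by (simp add: continuous_map_paired)
  then have "openin X {x \<in> topspace X. (a x, b x) \<in> {(s, t) \<in> S \<times> T. h s t \<in> V}}"
    by (rule openin_continuous_map_preimage) auto
  moreover have "a x \<in> S" "b x \<in> T" if "x \<in> topspace X" for x
    using a b that by (auto simp: continuous_map_def)
  then have "{x \<in> topspace X. (a x, b x) \<in> {(s, t) \<in> S \<times> T. h s t \<in> V}} = {x \<in> topspace X. f x \<in> V}"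
    using f by auto
  ultimately show "openin X {x \<in> topspace X. f x \<in> V}" by simp
qed

context fibre_family
begin

text \<open>The family is indexed by itself through the identity; \<open>Pi1\<close> depends on an
  indexed family through its image, so this specialises to any indexing.\<close>

definition fundamental_cat :: "(('o, 'a, 'u) fin_ftor, ('o, 'a, 'u) fin_ntrans) top_cat" where
  "fundamental_cat = Pi1 C \<Phi> (\<lambda>G. G)"

lemma fundamental_cat_simps [simp]:
  "Ob fundamental_cat = \<Phi>" "Dom fundamental_cat = nsrc" "Cod fundamental_cat = ntgt"
  "Id fundamental_cat = Id (functor_cat C Fin)" "Comp fundamental_cat = Comp (functor_cat C Fin)"
  "HomTop fundamental_cat G H = pullback_topology (hom fundamental_cat G H) ncmp (hom_topology G H)"
  using fibreD(1,2) unfolding fundamental_cat_def Pi1_def Fun_lex_def full_subcat_def hom_topology_def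
  by (auto simp: cat.defs hom_def)

text \<open>Both subcategory constructions are full, and fibre functors are left exact, so all
  natural transformations between members of \<Phi> occur.\<close>

lemma hom_fundamental_cat: "hom fundamental_cat G H = (if G \<in> \<Phi> \<and> H \<in> \<Phi> then nat_trans G H else {})"
  using fibreD(2) unfolding fundamental_cat_def Pi1_def Fun_lex_def full_subcat_def nat_trans_def
  by (auto simp: cat.defs hom_def)

lemma category_fundamental_cat: "category fundamental_cat"
proof -
  have "category (full_subcat (Fun_lex C) ((\<lambda>G. G) ` \<Phi>) :: (('o, 'a, 'u) fin_ftor, ('o, 'a, 'u) fin_ntrans) cat)"
    unfolding Fun_lex_def by (intro category_full_subcat category_functor_cat)
  then show ?thesis
    unfolding fundamental_cat_def Pi1_def category_def hom_def by (simp add: cat.defs)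
qed

lemma ncmp_topspace: "\<phi> \<in> nat_trans G H \<Longrightarrow> ncmp \<phi> \<in> topspace (hom_topology G H)"
  unfolding topspace_hom_topology nat_trans_def is_ntrans_def by auto

lemma topspace_fundamental_cat: "topspace (HomTop fundamental_cat G H) = hom fundamental_cat G H"
  using ncmp_topspace by (auto simp: topspace_pullback_topology hom_fundamental_cat)

lemma continuous_ncmp:
  assumes "A \<in> Ob C"
  shows "continuous_map (HomTop fundamental_cat G H) (discrete_topology (hom Fin (fob G A) (fob H A))) (\<lambda>\<phi>. ncmp \<phi> A)"
  using continuous_map_pullback[OF continuous_map_product_projection[OF assms]]
  by (simp add: hom_topology_def o_def)

text \<open>Continuity into a product is tested on coordinates, and the A-component of a composite
  depends only on the two A-components, which vary in discrete sets.\<close>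

lemma top_category_fundamental_cat: "top_category fundamental_cat"
proof (intro top_category.intro category_fundamental_cat top_category_axioms.intro)
  show "topspace (HomTop fundamental_cat x y) = hom fundamental_cat x y" for x y by (rule topspace_fundamental_cat)
  fix x y z assume xyz: "x \<in> Ob fundamental_cat" "y \<in> Ob fundamental_cat" "z \<in> Ob fundamental_cat"
  let ?T = "prod_topology (HomTop fundamental_cat y z) (HomTop fundamental_cat x y)"
  have T: "topspace ?T = nat_trans y z \<times> nat_trans x y" using xyz unfolding topspace_prod_topology topspace_fundamental_cat by (simp add: hom_fundamental_cat)
  have "continuous_map ?T (hom_topology x z) (ncmp \<circ> (\<lambda>(g, f). g \<cdot>\<^bsub>fundamental_cat\<^esub> f))"
    unfolding hom_topology_def continuous_map_componentwise
  proof (intro conjI ballI)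
    show "(ncmp \<circ> (\<lambda>(g, f). g \<cdot>\<^bsub>fundamental_cat\<^esub> f)) ` topspace ?T \<subseteq> extensional (Ob C)"
      by (auto simp: functor_cat_def)
    fix A assume A: "A \<in> Ob C"
    show "continuous_map ?T (discrete_topology (hom Fin (fob x A) (fob z A)))
        (\<lambda>p. (ncmp \<circ> (\<lambda>(g, f). g \<cdot>\<^bsub>fundamental_cat\<^esub> f)) p A)"
    proof (rule continuous_map_discrete_factor[where h = "\<lambda>k l. k \<cdot>\<^bsub>Fin\<^esub> l"])
      show "continuous_map ?T (discrete_topology (hom Fin (fob y A) (fob z A))) (\<lambda>p. ncmp (fst p) A)"
        using continuous_map_compose[OF continuous_map_fst continuous_ncmp[OF A]] by (simp add: o_def)
      show "continuous_map ?T (discrete_topology (hom Fin (fob x A) (fob y A))) (\<lambda>p. ncmp (snd p) A)"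
        using continuous_map_compose[OF continuous_map_snd continuous_ncmp[OF A]] by (simp add: o_def)
      fix p assume "p \<in> topspace ?T"
      then obtain g f where p: "p = (g, f)" "g \<in> nat_trans y z" "f \<in> nat_trans x y" unfolding T by auto
      show "(ncmp \<circ> (\<lambda>(g, f). g \<cdot>\<^bsub>fundamental_cat\<^esub> f)) p A = ncmp (fst p) A \<cdot>\<^bsub>Fin\<^esub> ncmp (snd p) A"
        using p A by (simp add: functor_cat_def)
      show "(ncmp \<circ> (\<lambda>(g, f). g \<cdot>\<^bsub>fundamental_cat\<^esub> f)) p A \<in> hom Fin (fob x A) (fob z A)"
        using nat_trans_hom[OF nat_trans_Comp(1)[OF p(3,2)] A] p(1) by simp
    qed
  qed
  moreover have "topspace ?T \<subseteq> (\<lambda>(g, f). g \<cdot>\<^bsub>fundamental_cat\<^esub> f) -` hom fundamental_cat x z"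
    unfolding T using xyz nat_trans_Comp(1) by (auto simp: hom_fundamental_cat)
  ultimately show "continuous_map ?T (HomTop fundamental_cat x z) (\<lambda>(g, f). g \<cdot>\<^bsub>fundamental_cat\<^esub> f)"
    unfolding fundamental_cat_simps(6)[of x z] by (rule continuous_map_pullback')
qed

lemma is_functor_eval_at:
  assumes A: "A \<in> Ob C"
  shows "is_functor fundamental_cat Fin (eval_at fundamental_cat A)"
  unfolding eval_at_def
proof (rule functorI[OF category_fundamental_cat category_Fin])
  show "fob G A \<in> Ob Fin" if "G \<in> Ob fundamental_cat" for G using that finite_fibre A by simp
  show "ncmp \<phi> A \<in> hom Fin (fob G A) (fob H A)" if "\<phi> \<in> hom fundamental_cat G H" for \<phi> G H
    using that nat_trans_hom A by (auto simp: hom_fundamental_cat split: if_splits)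
  show "ncmp (Id fundamental_cat G) A = Id Fin (fob G A)" for G using A by (simp add: functor_cat_def)
  show "ncmp (\<psi> \<cdot>\<^bsub>fundamental_cat\<^esub> \<phi>) A = ncmp \<psi> A \<cdot>\<^bsub>Fin\<^esub> ncmp \<phi> A" for \<phi> \<psi>
    using A by (simp add: functor_cat_def)
qed

lemma eval_at_simps [simp]:
  "G \<in> \<Phi> \<Longrightarrow> fob (eval_at fundamental_cat A) G = fob G A"
  "\<phi> \<in> hom fundamental_cat G H \<Longrightarrow> far (eval_at fundamental_cat A) \<phi> = ncmp \<phi> A"
  by (auto simp: eval_at_def hom_def)

text \<open>The action of \<phi> on the fibre of A depends only on the coordinate of \<phi> at
  A.\<close>

lemma continuous_eval_at:
  assumes A: "A \<in> Ob C"
  shows "continuous_functor fundamental_cat (eval_at fundamental_cat A)"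
  unfolding continuous_functor_def
proof (intro conjI ballI top_category_fundamental_cat is_functor_eval_at A)
  fix G H assume GH: "G \<in> Ob fundamental_cat" "H \<in> Ob fundamental_cat"
  let ?T = "prod_topology (HomTop fundamental_cat G H) (discrete_topology (fob G A))"
  have "continuous_map ?T (discrete_topology (fob H A)) (\<lambda>(\<phi>, a). mfun (far (eval_at fundamental_cat A) \<phi>) a)"
  proof (rule continuous_map_discrete_factor[where h = mfun])
    show "continuous_map ?T (discrete_topology (hom Fin (fob G A) (fob H A))) (\<lambda>p. ncmp (fst p) A)"
      using continuous_map_compose[OF continuous_map_fst continuous_ncmp[OF A]] by (simp add: o_def)
    show "continuous_map ?T (discrete_topology (fob G A)) snd" by (rule continuous_map_snd)
    fix p assume "p \<in> topspace ?T"
    then obtain \<phi> a where p: "p = (\<phi>, a)" "\<phi> \<in> hom fundamental_cat G H" "a \<in> fob G A"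
      unfolding topspace_prod_topology topspace_fundamental_cat by auto
    show "(case p of (\<phi>, a) \<Rightarrow> mfun (far (eval_at fundamental_cat A) \<phi>) a) = mfun (ncmp (fst p) A) (snd p)"
      using p by simp
    show "(case p of (\<phi>, a) \<Rightarrow> mfun (far (eval_at fundamental_cat A) \<phi>) a) \<in> fob H A"
    proof -
      have "\<phi> \<in> nat_trans G H" using p(2) GH by (simp add: hom_fundamental_cat)
      then show ?thesis using p(1) nat_trans_in[OF _ A p(3)] by (simp add: eval_at_simps(2)[OF p(2)])
    qed
  qed
  then show "continuous_map (prod_topology (HomTop fundamental_cat G H) (discrete_topology (fob (eval_at fundamental_cat A) G)))
      (discrete_topology (fob (eval_at fundamental_cat A) H)) (\<lambda>(\<phi>, a). mfun (far (eval_at fundamental_cat A) \<phi>) a)"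
    using GH by simp
qed

text \<open>Naturality along one arrow is a condition on two coordinates, hence closed; the natural
  families form an intersection of such sets in a compact space.\<close>

lemma compactin_nat_trans: "compactin (hom_topology G H) (ncmp ` nat_trans G H)" if G: "G \<in> \<Phi>" and H: "H \<in> \<Phi>"
proof (rule closedin_compact_space[OF compact_hom_topology])
  let ?T = "hom_topology G H"
  let ?N = "{\<eta> \<in> topspace ?T. \<forall>f \<in> Arr C. \<eta> (Cod C f) \<cdot>\<^bsub>Fin\<^esub> far G f = far H f \<cdot>\<^bsub>Fin\<^esub> \<eta> (Dom C f)}"
  have "closedin ?T ?N"
    by (rule closedin_Collect_ball, rule closedin_coordinates[OF cod_in_Ob dom_in_Ob])
  moreover have "ncmp ` nat_trans G H = ?N"
  proof
    show "ncmp ` nat_trans G H \<subseteq> ?N"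
      using ncmp_topspace by (auto simp: nat_trans_def is_ntrans_def)
    show "?N \<subseteq> ncmp ` nat_trans G H"
    proof
      fix \<eta> assume \<eta>: "\<eta> \<in> ?N"
      then have "\<lparr>nsrc = G, ntgt = H, ncmp = \<eta>\<rparr> \<in> nat_trans G H"
        using fibreD(1)[OF G] fibreD(1)[OF H] by (simp add: nat_trans_def is_ntrans_def topspace_hom_topology)
      then show "\<eta> \<in> ncmp ` nat_trans G H" by (metis imageI ntrans.select_convs(3))
    qed
  qed
  ultimately show "closedin ?T (ncmp ` nat_trans G H)" by simp
qed

text \<open>Near each \<phi> continuity gives finitely many coordinates that determine the value at
  x. Finitely many of the resulting cylinders cover the compact set of transformations, and the
  union of their coordinates works for all.\<close>

lemma continuous_functor_coordinates:
  assumes \<Gamma>: "continuous_functor fundamental_cat \<Gamma>" and G: "G \<in> \<Phi>" and H: "H \<in> \<Phi>" and x: "x \<in> fob \<Gamma> G"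
  shows "\<exists>X. finite X \<and> X \<subseteq> Ob C \<and>
    (\<forall>\<phi> \<in> nat_trans G H. \<forall>\<psi> \<in> nat_trans G H. (\<forall>A \<in> X. ncmp \<phi> A = ncmp \<psi> A) \<longrightarrow> mfun (far \<Gamma> \<phi>) x = mfun (far \<Gamma> \<psi>) x)"
proof -
  let ?T = "hom_topology G H"
  have hom: "hom fundamental_cat G H = nat_trans G H" using G H by (simp add: hom_fundamental_cat)
  have "continuous_map (HomTop fundamental_cat G H) (prod_topology (HomTop fundamental_cat G H) (discrete_topology (fob \<Gamma> G))) (\<lambda>\<phi>. (\<phi>, x))"
    using x by (simp add: continuous_map_paired)
  moreover have "continuous_map (prod_topology (HomTop fundamental_cat G H) (discrete_topology (fob \<Gamma> G)))
      (discrete_topology (fob \<Gamma> H)) (\<lambda>(\<phi>, a). mfun (far \<Gamma> \<phi>) a)"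
    using \<Gamma> G H unfolding continuous_functor_def by simp
  ultimately have cont: "continuous_map (HomTop fundamental_cat G H) (discrete_topology (fob \<Gamma> H)) (\<lambda>\<phi>. mfun (far \<Gamma> \<phi>) x)"
    using continuous_map_compose[of "HomTop fundamental_cat G H" _ "\<lambda>\<phi>. (\<phi>, x)"] by (fastforce simp: o_def)
  have "\<exists>X. finite X \<and> X \<subseteq> Ob C \<and> (\<forall>\<psi> \<in> nat_trans G H. (\<forall>A \<in> X. ncmp \<phi> A = ncmp \<psi> A) \<longrightarrow> mfun (far \<Gamma> \<phi>) x = mfun (far \<Gamma> \<psi>) x)"
    if \<phi>: "\<phi> \<in> nat_trans G H" for \<phi>
  proof -
    have "mfun (far \<Gamma> \<phi>) x \<in> fob \<Gamma> H"
      using cont \<phi> unfolding continuous_map_def topspace_fundamental_cat hom by auto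
    then have "openin (HomTop fundamental_cat G H) {\<psi> \<in> topspace (HomTop fundamental_cat G H). mfun (far \<Gamma> \<psi>) x \<in> {mfun (far \<Gamma> \<phi>) x}}"
      by (intro openin_continuous_map_preimage[OF cont]) simp
    \<comment> \<open>The hom-topology is induced along \<open>ncmp\<close>, so the transformations
      with the same value at x are cut out by an open set of families.\<close>
    then obtain U where U: "openin ?T U" "{\<psi> \<in> nat_trans G H. mfun (far \<Gamma> \<psi>) x = mfun (far \<Gamma> \<phi>) x} = ncmp -` U \<inter> nat_trans G H"
      unfolding topspace_fundamental_cat hom unfolding fundamental_cat_simps(6) openin_pullback_topology hom by auto
    have "\<phi> \<in> ncmp -` U \<inter> nat_trans G H" using \<phi> unfolding U(2)[symmetric] by simp
    then have "ncmp \<phi> \<in> U" by simp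
    then obtain V where V: "finite {A \<in> Ob C. V A \<noteq> hom Fin (fob G A) (fob H A)}"
      "ncmp \<phi> \<in> Pi\<^sub>E (Ob C) V" "Pi\<^sub>E (Ob C) V \<subseteq> U"
      using U(1) unfolding hom_topology_def openin_product_topology_alt by (metis (no_types, lifting) topspace_discrete_topology Collect_cong)
    \<comment> \<open>The finitely many coordinates on which the basic open box around \<phi>
      imposes a condition.\<close>
    let ?X = "{A \<in> Ob C. V A \<noteq> hom Fin (fob G A) (fob H A)}"
    have "mfun (far \<Gamma> \<phi>) x = mfun (far \<Gamma> \<psi>) x" if \<psi>: "\<psi> \<in> nat_trans G H" and eq: "\<forall>A \<in> ?X. ncmp \<phi> A = ncmp \<psi> A" for \<psi>
    proof -
      have "ncmp \<psi> A \<in> V A" if A: "A \<in> Ob C" for A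
      proof (cases "A \<in> ?X")
        case True
        then have "ncmp \<psi> A = ncmp \<phi> A" using eq by simp
        then show ?thesis using V(2) A by (auto simp: PiE_iff)
      next
        case False
        then show ?thesis using nat_trans_hom[OF \<psi> A] A by simp
      qed
      moreover have "ncmp \<psi> \<in> extensional (Ob C)"
        using ncmp_topspace[OF \<psi>] by (simp add: topspace_hom_topology PiE_iff)
      ultimately have "ncmp \<psi> \<in> Pi\<^sub>E (Ob C) V" unfolding PiE_iff by blast
      then have "ncmp \<psi> \<in> U" using V(3) by blast
      then have "\<psi> \<in> {\<psi> \<in> nat_trans G H. mfun (far \<Gamma> \<psi>) x = mfun (far \<Gamma> \<phi>) x}" unfolding U(2) using \<psi> by simp
      then show ?thesis by simp
    qed
    then show ?thesis using V(1) by (intro exI[of _ ?X]) auto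
  qed
  then obtain X where X: "\<And>\<phi>. \<phi> \<in> nat_trans G H \<Longrightarrow> finite (X \<phi>)" "\<And>\<phi>. \<phi> \<in> nat_trans G H \<Longrightarrow> X \<phi> \<subseteq> Ob C"
    "\<And>\<phi> \<psi>. \<phi> \<in> nat_trans G H \<Longrightarrow> \<psi> \<in> nat_trans G H \<Longrightarrow> \<forall>A \<in> X \<phi>. ncmp \<phi> A = ncmp \<psi> A \<Longrightarrow> mfun (far \<Gamma> \<phi>) x = mfun (far \<Gamma> \<psi>) x"
    by metis
  \<comment> \<open>The open cylinder of families that agree with \<phi> on its own
    coordinates.\<close>
  define W where "W = (\<lambda>\<phi>. {\<eta> \<in> topspace ?T. \<forall>A \<in> X \<phi>. ncmp \<phi> A = \<eta> A})"
  have "openin ?T (W \<phi>)" if \<phi>: "\<phi> \<in> nat_trans G H" for \<phi>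
  proof -
    have "closedin ?T {\<eta> \<in> topspace ?T. ncmp \<phi> A \<noteq> \<eta> A}" if "A \<in> X \<phi>" for A
    proof -
      have "A \<in> Ob C" using X(2)[OF \<phi>] that by blast
      then show ?thesis using closedin_coordinates[of A A G H "\<lambda>k _. ncmp \<phi> A \<noteq> k"] by blast
    qed
    then have "closedin ?T (\<Union>A \<in> X \<phi>. {\<eta> \<in> topspace ?T. ncmp \<phi> A \<noteq> \<eta> A})"
      using X(1)[OF \<phi>] by (intro closedin_Union) auto
    then have "openin ?T (topspace ?T - (\<Union>A \<in> X \<phi>. {\<eta> \<in> topspace ?T. ncmp \<phi> A \<noteq> \<eta> A}))"
      by (intro openin_diff openin_topspace)
    moreover have "W \<phi> = topspace ?T - (\<Union>A \<in> X \<phi>. {\<eta> \<in> topspace ?T. ncmp \<phi> A \<noteq> \<eta> A})"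
      unfolding W_def by auto
    ultimately show ?thesis by simp
  qed
  then have "\<forall>U \<in> W ` nat_trans G H. openin ?T U" by blast
  moreover have "ncmp ` nat_trans G H \<subseteq> \<Union>(W ` nat_trans G H)" using ncmp_topspace unfolding W_def by fastforce
  ultimately have "\<exists>\<F>. finite \<F> \<and> \<F> \<subseteq> W ` nat_trans G H \<and> ncmp ` nat_trans G H \<subseteq> \<Union>\<F>"
    using compactin_nat_trans[OF G H, unfolded compactin_def, THEN conjunct2, THEN spec, of "W ` nat_trans G H"] by blast
  then obtain \<F> where \<F>: "finite \<F>" "\<F> \<subseteq> W ` nat_trans G H" "ncmp ` nat_trans G H \<subseteq> \<Union>\<F>" by blast
  obtain \<Psi> where \<Psi>: "\<Psi> \<subseteq> nat_trans G H" "finite \<Psi>" "\<F> = W ` \<Psi>" using finite_subset_image[OF \<F>(1,2)] by blast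
  have "mfun (far \<Gamma> \<phi>) x = mfun (far \<Gamma> \<psi>) x"
    if \<phi>: "\<phi> \<in> nat_trans G H" and \<psi>: "\<psi> \<in> nat_trans G H" and eq: "\<forall>A \<in> (\<Union>\<theta> \<in> \<Psi>. X \<theta>). ncmp \<phi> A = ncmp \<psi> A" for \<phi> \<psi>
  proof -
    \<comment> \<open>If \<phi> lies in the cylinder of \<theta>, then so does \<psi>, since they
      agree on all selected coordinates; both values are then equal to that of \<theta>.\<close>
    obtain \<theta> where \<theta>: "\<theta> \<in> \<Psi>" "ncmp \<phi> \<in> W \<theta>" using \<F>(3) \<phi> unfolding \<Psi>(3) by blast
    then have N: "\<theta> \<in> nat_trans G H" and 1: "\<forall>A \<in> X \<theta>. ncmp \<theta> A = ncmp \<phi> A" using \<Psi>(1) unfolding W_def by auto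
    then have 2: "\<forall>A \<in> X \<theta>. ncmp \<theta> A = ncmp \<psi> A" using eq \<theta>(1) by auto
    show ?thesis using X(3)[OF N \<phi> 1] X(3)[OF N \<psi> 2] by simp
  qed
  then show ?thesis using \<Psi> X(1,2) by (intro exI[of _ "\<Union>\<theta> \<in> \<Psi>. X \<theta>"]) blast
qed

section \<open>Evaluation as a functor and as an equivalence\<close>

lemma Fun_cts_simps [simp]:
  "Ob (Fun_cts fundamental_cat) = {\<Gamma>. continuous_functor fundamental_cat \<Gamma>}"
  "Dom (Fun_cts fundamental_cat) = nsrc" "Cod (Fun_cts fundamental_cat) = ntgt"
  "Id (Fun_cts fundamental_cat) = Id (functor_cat fundamental_cat Fin)" "Comp (Fun_cts fundamental_cat) = Comp (functor_cat fundamental_cat Fin)"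
  by (auto simp: Fun_cts_def full_subcat_def continuous_functor_def)

lemma hom_Fun_cts: "\<eta> \<in> hom (Fun_cts fundamental_cat) \<Gamma> \<Delta> \<longleftrightarrow> is_ntrans fundamental_cat Fin \<eta> \<and> nsrc \<eta> = \<Gamma> \<and> ntgt \<eta> = \<Delta> \<and>
    continuous_functor fundamental_cat \<Gamma> \<and> continuous_functor fundamental_cat \<Delta>"
  by (auto simp: Fun_cts_def full_subcat_def hom_def)

text \<open>The square showing that evaluation of f is natural at \<phi> is the naturality square of
  \<phi> at f, read in the other direction.\<close>

lemma is_functor_ev: "is_functor C (Fun_cts fundamental_cat) (ev C fundamental_cat)"
  unfolding ev_def
proof (rule functorI[OF category_axioms])
  show "category (Fun_cts fundamental_cat)"
    unfolding Fun_cts_def by (intro category_full_subcat category_functor_cat)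
  show "eval_at fundamental_cat A \<in> Ob (Fun_cts fundamental_cat)" if "A \<in> Ob C" for A using continuous_eval_at[OF that] by simp
  let ?e = "\<lambda>f. \<lparr>nsrc = eval_at fundamental_cat (Dom C f), ntgt = eval_at fundamental_cat (Cod C f), ncmp = \<lambda>G \<in> Ob fundamental_cat. far G f\<rparr>"
  show "?e f \<in> hom (Fun_cts fundamental_cat) (eval_at fundamental_cat A) (eval_at fundamental_cat B)" if f: "f \<in> hom C A B" for f A B
  proof -
    have AB: "A \<in> Ob C" "B \<in> Ob C" using hom_Ob[OF f] by auto
    have "is_ntrans fundamental_cat Fin \<lparr>nsrc = eval_at fundamental_cat A, ntgt = eval_at fundamental_cat B, ncmp = \<lambda>G \<in> Ob fundamental_cat. far G f\<rparr>"
    proof (rule ntransI[OF is_functor_eval_at[OF AB(1)] is_functor_eval_at[OF AB(2)]])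
      show "far G f \<in> hom Fin (fob (eval_at fundamental_cat A) G) (fob (eval_at fundamental_cat B) G)" if "G \<in> Ob fundamental_cat" for G
        using that is_functorD(4)[OF fibreD(1) f] by simp
      fix \<phi> G H assume \<phi>: "\<phi> \<in> hom fundamental_cat G H"
      then have "is_ntrans C Fin \<phi>" "nsrc \<phi> = G" "ntgt \<phi> = H" by (auto simp: hom_fundamental_cat nat_trans_def split: if_splits)
      then show "far H f \<cdot>\<^bsub>Fin\<^esub> far (eval_at fundamental_cat A) \<phi> = far (eval_at fundamental_cat B) \<phi> \<cdot>\<^bsub>Fin\<^esub> far G f"
        using is_ntransD(4)[of C Fin \<phi> f A B] f \<phi> by simp
    qed
    then show ?thesis
      using continuous_eval_at AB homD(2,3)[OF f] by (simp add: hom_Fun_cts)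
  qed
  show "?e (Id C A) = Id (Fun_cts fundamental_cat) (eval_at fundamental_cat A)" if A: "A \<in> Ob C" for A
    using is_functorD(5)[OF fibreD(1) A] homD(2,3)[OF Id_in_hom[OF A]]
    by (simp add: functor_cat_def cong: restrict_cong)
  show "?e (g \<cdot> f) = ?e g \<cdot>\<^bsub>Fun_cts fundamental_cat\<^esub> ?e f" if fg: "f \<in> hom C A B" "g \<in> hom C B D" for A B D f g
    using is_functorD(6)[OF fibreD(1) fg] homD(2,3)[OF Comp_in_hom[OF fg]] homD(2,3)[OF fg(1)] homD(2,3)[OF fg(2)]
    by (simp add: functor_cat_def cong: restrict_cong)
qed

lemma ev_simps:
  "A \<in> Ob C \<Longrightarrow> fob (ev C fundamental_cat) A = eval_at fundamental_cat A"
  "f \<in> Arr C \<Longrightarrow> G \<in> \<Phi> \<Longrightarrow> ncmp (far (ev C fundamental_cat) f) G = far G f"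
  by (simp_all add: ev_def)

text \<open>Faithfulness is \<open>arr_eqI\<close>, fullness is \<open>ex_arrow_of_natural\<close>,
  and essential surjectivity is \<open>ex_object_of_functor\<close> fed with
  \<open>continuous_functor_coordinates\<close>; what remains is to pass between elements and arrows
  of \<open>Fin\<close>.\<close>

lemma is_equivalence_ev: "is_equivalence C (Fun_cts fundamental_cat) (ev C fundamental_cat)"
proof (rule is_equivalenceI[OF is_functor_ev])
  show "f = g" if f: "f \<in> hom C A B" and g: "g \<in> hom C A B" and eq: "far (ev C fundamental_cat) f = far (ev C fundamental_cat) g" for A B f g
  proof (rule arr_eqI[OF f g])
    fix G x assume "G \<in> \<Phi>"
    then show "act G f x = act G g x"
      using ev_simps(2)[of f G] ev_simps(2)[of g G] homD(1)[OF f] homD(1)[OF g] eq by simp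
  qed
next
  fix A B h assume A: "A \<in> Ob C" and B: "B \<in> Ob C" and h: "h \<in> hom (Fun_cts fundamental_cat) (fob (ev C fundamental_cat) A) (fob (ev C fundamental_cat) B)"
  have h: "is_ntrans fundamental_cat Fin h" "nsrc h = eval_at fundamental_cat A" "ntgt h = eval_at fundamental_cat B"
    using h A B by (simp_all add: hom_Fun_cts ev_simps)
  obtain f where f: "f \<in> hom C A B" "\<And>G x. G \<in> \<Phi> \<Longrightarrow> x \<in> fob G A \<Longrightarrow> act G f x = mfun (ncmp h G) x"
  proof (rule ex_arrow_of_natural[OF A B, of "\<lambda>G. mfun (ncmp h G)"])
    show "mfun (ncmp h G) x \<in> fob G B" if "G \<in> \<Phi>" "x \<in> fob G A" for G x
      using fin_ntransD(1)[OF h(1), of G x] h(2,3) that by simp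
    show "mfun (ncmp h H) (mfun (ncmp \<phi> A) x) = mfun (ncmp \<phi> B) (mfun (ncmp h G) x)"
      if "G \<in> \<Phi>" "H \<in> \<Phi>" "\<phi> \<in> nat_trans G H" "x \<in> fob G A" for G H \<phi> x
    proof -
      have \<phi>: "\<phi> \<in> hom fundamental_cat G H" using that by (simp add: hom_fundamental_cat)
      show ?thesis using fin_ntransD(2)[OF h(1) \<phi>, of x] h(2,3) that eval_at_simps(2)[OF \<phi>] by simp
    qed
  qed blast
  have "far (ev C fundamental_cat) f = h"
  proof (rule ntrans_eqI[of fundamental_cat Fin])
    note e = is_functorD(4)[OF is_functor_ev f(1)]
    show "is_ntrans fundamental_cat Fin (far (ev C fundamental_cat) f)" "nsrc (far (ev C fundamental_cat) f) = nsrc h" "ntgt (far (ev C fundamental_cat) f) = ntgt h"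
      using e h A B by (simp_all add: hom_Fun_cts ev_simps)
    show "ncmp (far (ev C fundamental_cat) f) G = ncmp h G" if "G \<in> Ob fundamental_cat" for G
    proof -
      have G: "G \<in> \<Phi>" using that by simp
      have "ncmp h G \<in> hom Fin (fob G A) (fob G B)"
        using is_ntransD(3)[OF h(1) that] h(2,3) G by simp
      then have "far G f = ncmp h G"
        using is_functorD(4)[OF fibreD(1)[OF G] f(1)] f(2)[OF G] by (intro Fin_eqI)
      then show ?thesis using ev_simps(2)[OF homD(1)[OF f(1)] G] by simp
    qed
  qed (rule h(1))
  then show "\<exists>f \<in> hom C A B. far (ev C fundamental_cat) f = h" using f(1) by blast
next
  fix \<Gamma> :: "(('o, 'a, 'u) fin_ftor, ('o, 'a, 'u) fin_ntrans, 'u) fin_ftor"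
  assume "\<Gamma> \<in> Ob (Fun_cts fundamental_cat)"
  then have \<Gamma>: "continuous_functor fundamental_cat \<Gamma>" by simp
  then have \<Gamma>F: "is_functor fundamental_cat Fin \<Gamma>" by (simp add: continuous_functor_def)
  have homPi: "\<phi> \<in> hom fundamental_cat G H" if "G \<in> \<Phi>" "H \<in> \<Phi>" "\<phi> \<in> nat_trans G H" for G H \<phi> using that by (simp add: hom_fundamental_cat)
  obtain Q \<tau> where Q: "Q \<in> Ob C" and bij: "\<And>G. G \<in> \<Phi> \<Longrightarrow> bij_betw (\<tau> G) (fob G Q) (fob \<Gamma> G)"
    and nat: "\<And>G H \<phi> x. G \<in> \<Phi> \<Longrightarrow> H \<in> \<Phi> \<Longrightarrow> \<phi> \<in> nat_trans G H \<Longrightarrow> x \<in> fob G Q \<Longrightarrow>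
      \<tau> H (mfun (ncmp \<phi> Q) x) = mfun (far \<Gamma> \<phi>) (\<tau> G x)"
  proof (rule ex_object_of_functor[of "fob \<Gamma>" "\<lambda>\<phi>. mfun (far \<Gamma> \<phi>)"])
    show "finite (fob \<Gamma> G)" if "G \<in> \<Phi>" for G using fin_functorD(1)[OF \<Gamma>F, of G] that by simp
    show "mfun (far \<Gamma> \<phi>) x \<in> fob \<Gamma> H" if "G \<in> \<Phi>" "H \<in> \<Phi>" "\<phi> \<in> nat_trans G H" "x \<in> fob \<Gamma> G" for G H \<phi> x
      using fin_functorD(2)[OF \<Gamma>F homPi[OF that(1-3)] that(4)] .
    show "mfun (far \<Gamma> (\<psi> \<cdot>\<^bsub>functor_cat C Fin\<^esub> \<phi>)) x = mfun (far \<Gamma> \<psi>) (mfun (far \<Gamma> \<phi>) x)"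
      if "G \<in> \<Phi>" "H \<in> \<Phi>" "K \<in> \<Phi>" "\<phi> \<in> nat_trans G H" "\<psi> \<in> nat_trans H K" "x \<in> fob \<Gamma> G" for G H K \<phi> \<psi> x
      using fin_functorD(3)[OF \<Gamma>F homPi[OF that(1,2,4)] homPi[OF that(2,3,5)] that(6)] by simp
    show "mfun (far \<Gamma> (Id (functor_cat C Fin) G)) x = x" if "G \<in> \<Phi>" "x \<in> fob \<Gamma> G" for G x
      using fin_functorD(4)[OF \<Gamma>F, of G x] that by simp
    show "\<exists>X. finite X \<and> X \<subseteq> Ob C \<and> (\<forall>\<phi> \<in> nat_trans G H. \<forall>\<psi> \<in> nat_trans G H.
        (\<forall>A \<in> X. ncmp \<phi> A = ncmp \<psi> A) \<longrightarrow> mfun (far \<Gamma> \<phi>) x = mfun (far \<Gamma> \<psi>) x)"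
      if "G \<in> \<Phi>" "H \<in> \<Phi>" "x \<in> fob \<Gamma> G" for G H x
      by (rule continuous_functor_coordinates[OF \<Gamma> that])
  qed (rule that)
  let ?\<eta> = "\<lparr>nsrc = eval_at fundamental_cat Q, ntgt = \<Gamma>,
    ncmp = \<lambda>G \<in> Ob fundamental_cat. fin_map (fob (eval_at fundamental_cat Q) G) (fob \<Gamma> G) (\<tau> G)\<rparr>"
  have \<eta>: "is_ntrans fundamental_cat Fin ?\<eta>"
  proof (rule fin_ntransI[OF is_functor_eval_at[OF Q] \<Gamma>F])
    show "\<tau> G x \<in> fob \<Gamma> G" if "G \<in> Ob fundamental_cat" "x \<in> fob (eval_at fundamental_cat Q) G" for G x
    proof -
      have G: "G \<in> \<Phi>" using that(1) by simp
      have "x \<in> fob G Q" using that(2) eval_at_simps(1)[OF G] by simp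
      then show ?thesis using bij_betwE[OF bij[OF G]] by blast
    qed
    fix \<phi> G H x assume \<phi>: "\<phi> \<in> hom fundamental_cat G H" and x: "x \<in> fob (eval_at fundamental_cat Q) G"
    then have GH: "G \<in> \<Phi>" "H \<in> \<Phi>" "\<phi> \<in> nat_trans G H" by (auto simp: hom_fundamental_cat split: if_splits)
    then show "\<tau> H (mfun (far (eval_at fundamental_cat Q) \<phi>) x) = mfun (far \<Gamma> \<phi>) (\<tau> G x)"
      using nat[OF GH, of x] x eval_at_simps(2)[OF \<phi>] by simp
  qed
  have "is_iso Fin (ncmp ?\<eta> G)" if "G \<in> Ob fundamental_cat" for G
  proof -
    have G: "G \<in> \<Phi>" using that by simp
    have e: "ncmp ?\<eta> G = fin_map (fob G Q) (fob \<Gamma> G) (\<tau> G)" using G by simp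
    have "bij_betw (mfun (fin_map (fob G Q) (fob \<Gamma> G) (\<tau> G))) (fob G Q) (fob \<Gamma> G)"
      using bij[OF G] by (simp cong: bij_betw_cong)
    moreover have "ncmp ?\<eta> G \<in> hom Fin (fob G Q) (fob \<Gamma> G)"
      using is_ntransD(3)[OF \<eta> that] G by simp
    ultimately show ?thesis using is_iso_Fin unfolding e by blast
  qed
  then have "is_iso (functor_cat fundamental_cat Fin) ?\<eta>" by (rule is_iso_functor_catI[OF \<eta>])
  then have "is_iso (Fun_cts fundamental_cat) ?\<eta>"
    unfolding Fun_cts_def using \<Gamma> continuous_eval_at[OF Q] by (intro is_iso_full_subcat) simp_all
  moreover have "?\<eta> \<in> hom (Fun_cts fundamental_cat) (eval_at fundamental_cat Q) \<Gamma>"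
    using \<eta> \<Gamma> continuous_eval_at[OF Q] by (simp add: hom_Fun_cts)
  ultimately have "isomorphic (Fun_cts fundamental_cat) (fob (ev C fundamental_cat) Q) \<Gamma>"
    unfolding isomorphic_def ev_simps(1)[OF Q] by blast
  then show "\<exists>A \<in> Ob C. isomorphic (Fun_cts fundamental_cat) (fob (ev C fundamental_cat) A) \<Gamma>" using Q by blast
qed

end

theorem theorem2p18:
  fixes C :: "('o, 'a) cat"
    and I :: "'i set"
    and F :: "'i \<Rightarrow> ('o, 'a, 'u :: infinite) fin_ftor"
  assumes "galois_category TYPE('u) C"
    and "finite I"
    and "\<And>i. i \<in> I \<Longrightarrow> fibre_functor C (F i)"
    and "jointly_conservative C I F"
  shows "is_equivalence C (Fun_cts (Pi1 C I F)) (ev C (Pi1 C I F))"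
proof -
  interpret pretopos C using assms(1) by (simp add: galois_category_def)
  interpret fibre_family C "F ` I"
  proof
    show "finite (F ` I)" using assms(2) by simp
    show "fibre_functor C G" if "G \<in> F ` I" for G using that assms(3) by blast
    show "is_iso C f" if "f \<in> Arr C" "\<And>G. G \<in> F ` I \<Longrightarrow> is_iso Fin (far G f)" for f
      using assms(4) that unfolding jointly_conservative_def by blast
  qed
  \<comment> \<open>\<open>Pi1\<close> sees the indexed family only through its image, and
    reindexing that image by itself does not change it.\<close>
  have "Pi1 C I F = fundamental_cat" by (simp add: fundamental_cat_def Pi1_def)
  then show ?thesis using is_equivalence_ev by simp
qed

end
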